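(* Let $d\ge 1$, let $N$ be a non-negative integer, let $\omega$ be an admissible radial measure on $\overline{\mathbb{B}_d}$, and let $B^N_\omega$ be the associated radially weighted Besov space. If $\phi,\psi\in \mathrm{Mult}(B^N_\omega)$ satisfy $|\phi(z)|\le|\psi(z)|$ for all $z\in\mathbb{B}_d$, and if $\phi$ is weak$^\ast$ sequentially cyclic, then $\psi$ is weak$^\ast$ sequentially cyclic.
   Context: $\mathbb{B}_d$ is the open unit ball of $\mathbb{C}^d$, $\sigma$ the normalized rotation-invariant measure on $\partial\mathbb{B}_d$, $\mathrm{Hol}(\mathbb{B}_d)$ the holomorphic functions on $\mathbb{B}_d$. An admissible radial measure $\omega$ on $\overline{\mathbb{B}_d}$ is a measure of the form $d\omega(z)=d\mu(r)\,d\sigma(w)$, $z=rw$, where $\mu$ is a finite Borel measure on $[0,1]$ with $\mu((r,1])>0$ for all $0<r<1$. For $f\in\mathrm{Hol}(\mathbb{B}_d)$ put $\|f\|^2_{L^2(\omega)}=\int_{\mathbb{B}_d}|f|^2d\omega+\mu(\{1\})\|f\|^2_{H^2(\partial\mathbb{B}_d)}$, where $\|f\|^2_{H^2(\partial\mathbb{B}_d)}=\sup_{0\le r<1}\int_{\partial\mathbb{B}_d}|f(rz)|^2d\sigma(z)$ (the second term is absent if $\mu(\{1\})=0$). With $R=\sum_{j=1}^d z_j\frac{\partial}{\partial z_j}$, the radially weighted Besov space is $B^N_\omega=\{f\in\mathrm{Hol}(\mathbb{B}_d): R^Nf\in L^2(\omega)\}$, with norm $\|f\|^2=\|f\|^2_{L^2(\omega)}$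 if $N=0$ and $\|f\|^2=\omega(\overline{\mathbb{B}_d})|f(0)|^2+\|R^Nf\|^2_{L^2(\omega)}$ if $N>0$; it is a Hilbert space with continuous point evaluations. For a Hilbert function space $H$ on $\mathbb{B}_d$, $\mathrm{Mult}(H)=\{\phi:\mathbb{B}_d\to\mathbb{C}:\ \phi f\in H\text{ for all }f\in H\}$, normed by $\|\phi\|_{\mathrm{Mult}(H)}=\|M_\phi\|$, the operator norm of multiplication by $\phi$ on $H$. Via $\phi\mapsto M_\phi$ it is a weak$^\ast$-closed subalgebra of the bounded operators $\mathcal{B}(H)$ (the dual of the trace class) and carries the resulting weak$^\ast$ topology. A sequence $\phi_n$ converges weak$^\ast$ to $\phi$ in $\mathrm{Mult}(H)$ if and only if $\sup_n\|\phi_n\|_{\mathrm{Mult}(H)}<\infty$ and $\phi_n(z)\to\phi(z)$ for all $z\in\mathbb{B}_d$. $\phi\in\mathrm{Mult}(H)$ is weak$^\ast$ sequentially cyclic if there is a sequence $\{u_n\}\subseteq\mathrm{Mult}(H)$ with $u_n\phi\to1$ weak$^\ast$. *)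

theory Defs
  imports "HOL-Probability.Probability"
begin

section \<open>The normalized rotation-invariant measure on the sphere\<close>

definition rotation_invariant_probability :: "'a::euclidean_space measure \<Rightarrow> bool" where
  "rotation_invariant_probability \<sigma> \<longleftrightarrow>
     prob_space \<sigma> \<and> sets \<sigma> = sets (restrict_space borel (sphere 0 1)) \<and>
     (\<forall>U. orthogonal_transformation U \<longrightarrow> distr \<sigma> \<sigma> U = \<sigma>)"

text \<open>Such a measure exists: project the normalized Lebesgue measure of the unit ball
  radially to the sphere.\<close>

lemma orthogonal_transformation_borel:
  fixes U :: "'a::euclidean_space \<Rightarrow> 'a"
  assumes "orthogonal_transformation U"
  shows "U \<in> borel_measurable borel"
  using assms unfolding orthogonal_transformation_def
  by (intro borel_measurable_continuous_onI linear_continuous_on linear_conv_bounded_linear[THEN iffD1]) simp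

lemma lborel_distr_orthogonal:
  fixes U :: "'a::euclidean_space \<Rightarrow> 'a"
  assumes U: "orthogonal_transformation U"
  shows "distr lborel borel U = lborel"
proof -
  have U_meas [measurable]: "U \<in> borel_measurable borel"
    by (rule orthogonal_transformation_borel[OF U])
  have linU: "linear U" and normU: "\<And>v. norm (U v) = norm v"
    using U by (auto simp: orthogonal_transformation)
  have surjU: "surj U" by (rule orthogonal_transformation_surj[OF U])
  define m :: "'a measure" where "m = distr lborel borel U"
  have sets_m [measurable_cong]: "sets m = sets borel" by (simp add: m_def)
  have transl: "(\<integral>\<^sup>+x. g (x + c) \<partial>lborel) = (\<integral>\<^sup>+x. g x \<partial>lborel)"
    if [measurable]: "g \<in> borel_measurable borel" for g :: "'a \<Rightarrow> ennreal" and c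
  proof -
    have "(\<integral>\<^sup>+x. g x \<partial>lborel) = (\<integral>\<^sup>+x. g x \<partial>distr lborel borel ((+) c))"
      by (simp add: lborel_distr_plus)
    also have "\<dots> = (\<integral>\<^sup>+x. g (c + x) \<partial>lborel)"
      by (subst nn_integral_distr) auto
    finally show ?thesis by (simp add: add.commute)
  qed
  have refl: "(\<integral>\<^sup>+x. g (c - x) \<partial>lborel) = (\<integral>\<^sup>+x. g x \<partial>lborel)"
    if [measurable]: "g \<in> borel_measurable borel" for g :: "'a \<Rightarrow> ennreal" and c
  proof -
    have "lborel = density (distr lborel borel (\<lambda>x::'a. c + (-1) *\<^sub>R x)) (\<lambda>_. ennreal (\<bar>-1\<bar> ^ DIM('a)))"
      by (rule lborel_affine) simp
    then have "lborel = distr lborel borel (\<lambda>x::'a. c - x)"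
      by (simp add: density_1)
    then have "(\<integral>\<^sup>+x. g x \<partial>lborel) = (\<integral>\<^sup>+x. g x \<partial>distr lborel borel (\<lambda>x::'a. c - x))"
      by simp
    also have "\<dots> = (\<integral>\<^sup>+x. g (c - x) \<partial>lborel)"
      by (subst nn_integral_distr) auto
    finally show ?thesis ..
  qed
  have transl_m: "(\<integral>\<^sup>+x. g (x + c) \<partial>m) = (\<integral>\<^sup>+x. g x \<partial>m)"
    if [measurable]: "g \<in> borel_measurable borel" for g :: "'a \<Rightarrow> ennreal" and c
  proof -
    obtain b where b: "c = U b" using surjU by (metis surjD)
    have "(\<integral>\<^sup>+x. g (x + c) \<partial>m) = (\<integral>\<^sup>+x. g (U x + U b) \<partial>lborel)"
      unfolding m_def b by (subst nn_integral_distr) auto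
    also have "\<dots> = (\<integral>\<^sup>+x. g (U (x + b)) \<partial>lborel)"
      by (simp add: linear_add[OF linU])
    also have "\<dots> = (\<integral>\<^sup>+x. g (U x) \<partial>lborel)"
      by (rule transl[of "\<lambda>x. g (U x)"]) measurable
    also have "\<dots> = (\<integral>\<^sup>+x. g x \<partial>m)"
      unfolding m_def by (subst nn_integral_distr) auto
    finally show ?thesis .
  qed
  let ?B = "ball (0::'a) 1"
  have preB: "U -` ?B = ?B" by (auto simp: normU)
  have mB: "emeasure m ?B = emeasure lborel ?B"
    unfolding m_def by (subst emeasure_distr) (auto simp: preB)
  have B_fin: "emeasure lborel ?B < \<infinity>"
    by (rule emeasure_bounded_finite) simp
  have B_pos: "emeasure lborel ?B \<noteq> 0"
    using content_ball_pos[of 1 "0::'a"] by (auto simp: measure_def)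
  interpret m: sigma_finite_measure m
  proof
    have cov: "(\<Union>n. ball (0::'a) (real n)) = UNIV"
      using reals_Archimedean2 by (auto simp: dist_norm)
    have "emeasure m (ball 0 (real n)) \<noteq> \<infinity>" for n
    proof -
      have "U -` ball 0 (real n) = ball 0 (real n)" by (auto simp: normU)
      then have "emeasure m (ball 0 (real n)) = emeasure lborel (ball (0::'a) (real n))"
        unfolding m_def by (subst emeasure_distr) auto
      also have "\<dots> < \<infinity>" by (rule emeasure_bounded_finite) simp
      finally show ?thesis by simp
    qed
    then show "\<exists>A. countable A \<and> A \<subseteq> sets m \<and> \<Union>A = space m \<and> (\<forall>a\<in>A. emeasure m a \<noteq> \<infinity>)"
      using cov by (intro exI[of _ "range (\<lambda>n. ball (0::'a) (real n))"])
        (auto simp: m_def)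
  qed
  interpret pair_sigma_finite m "lborel :: 'a measure" ..
  have eq: "emeasure m A * emeasure lborel ?B = emeasure m ?B * emeasure lborel A"
    if [measurable]: "A \<in> sets borel" for A
  proof -
    define g h :: "'a \<Rightarrow> ennreal" where "g = indicator A" and "h = indicator ?B"
    have [measurable]: "g \<in> borel_measurable borel" "h \<in> borel_measurable borel"
      using that by (simp_all add: g_def h_def borel_measurable_indicator)
    have g: "(\<integral>\<^sup>+x. g x \<partial>k) = emeasure k A" and h: "(\<integral>\<^sup>+x. h x \<partial>k) = emeasure k ?B"
      if "sets k = sets borel" for k :: "'a measure"
      using that by (simp_all add: g_def h_def)
    have "emeasure m A * emeasure lborel ?B = (\<integral>\<^sup>+x. g x * (\<integral>\<^sup>+y. h y \<partial>lborel) \<partial>m)"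
      by (subst nn_integral_multc) (simp_all add: g h sets_m)
    also have "\<dots> = (\<integral>\<^sup>+x. g x * (\<integral>\<^sup>+y. h (y + x) \<partial>lborel) \<partial>m)"
      by (simp only: transl[OF \<open>h \<in> borel_measurable borel\<close>])
    also have "\<dots> = (\<integral>\<^sup>+x. \<integral>\<^sup>+y. g x * h (y + x) \<partial>lborel \<partial>m)"
      by (intro nn_integral_cong nn_integral_cmult[symmetric]) measurable
    also have "\<dots> = (\<integral>\<^sup>+y. \<integral>\<^sup>+x. g x * h (y + x) \<partial>m \<partial>lborel)"
      by (rule Fubini'[symmetric]) measurable
    also have "\<dots> = (\<integral>\<^sup>+y. \<integral>\<^sup>+x. g (x - y) * h x \<partial>m \<partial>lborel)"
    proof (rule nn_integral_cong)
      fix y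
      have "(\<lambda>x. g (x - y) * h x) \<in> borel_measurable borel" by measurable
      from transl_m[OF this, of y]
      show "(\<integral>\<^sup>+x. g x * h (y + x) \<partial>m) = (\<integral>\<^sup>+x. g (x - y) * h x \<partial>m)"
        by (simp add: add.commute)
    qed
    also have "\<dots> = (\<integral>\<^sup>+x. \<integral>\<^sup>+y. g (x - y) * h x \<partial>lborel \<partial>m)"
      by (rule Fubini') measurable
    also have "\<dots> = (\<integral>\<^sup>+x. (\<integral>\<^sup>+y. g (x - y) \<partial>lborel) * h x \<partial>m)"
      by (intro nn_integral_cong nn_integral_multc) measurable
    also have "\<dots> = (\<integral>\<^sup>+x. (\<integral>\<^sup>+y. g y \<partial>lborel) * h x \<partial>m)"
      by (simp only: refl[OF \<open>g \<in> borel_measurable borel\<close>])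
    also have "\<dots> = emeasure m ?B * emeasure lborel A"
      by (subst nn_integral_cmult) (simp_all add: g h sets_m mult.commute)
    finally show ?thesis .
  qed
  have "m = lborel"
  proof (rule measure_eqI)
    fix A assume "A \<in> sets m"
    then have "A \<in> sets borel" by (simp add: sets_m)
    from eq[OF this] have "emeasure lborel ?B * emeasure m A = emeasure lborel ?B * emeasure lborel A"
      by (simp add: mB mult.commute)
    then show "emeasure m A = emeasure lborel A"
      using B_fin B_pos by (auto simp: ennreal_mult_cancel_left)
  qed (simp add: sets_m)
  then show ?thesis by (simp add: m_def)
qed

lemma rotation_invariant_probability_exists:
  "\<exists>\<sigma> :: 'a::euclidean_space measure. rotation_invariant_probability \<sigma>"
proof -
  let ?B = "ball (0::'a) 1" and ?S = "restrict_space borel (sphere (0::'a) 1)"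
  obtain e :: 'a where e: "norm e = 1" using vector_choose_size[of 1] by auto
  define p where "p z = (if z = 0 then e else z /\<^sub>R norm z)" for z :: 'a
  define n :: "'a measure" where "n = uniform_measure lborel ?B"
  define s where "s = distr n ?S p"
  have sets_n [measurable_cong]: "sets n = sets borel" by (simp add: n_def)
  have B_fin: "emeasure lborel ?B < \<infinity>"
    by (rule emeasure_bounded_finite) simp
  have B_pos: "emeasure lborel ?B \<noteq> 0"
    using content_ball_pos[of 1 "0::'a"] by (auto simp: measure_def)
  have prob_n: "prob_space n"
    unfolding n_def using B_fin B_pos by (intro prob_space_uniform_measure) auto
  have p_sphere: "norm (p z) = 1" for z by (simp add: p_def e)
  have p_borel: "p \<in> borel_measurable borel" unfolding p_def by measurable
  have p_meas: "p \<in> n \<rightarrow>\<^sub>M ?S"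
    using p_borel p_sphere by (auto intro!: measurable_restrict_space2 simp: sets_n cong: measurable_cong_sets)
  have p_meas': "p \<in> borel \<rightarrow>\<^sub>M ?S"
    using p_borel p_sphere by (auto intro!: measurable_restrict_space2)
  have "distr s s U = s" if U: "orthogonal_transformation U" for U
  proof -
    have linU: "linear U" and normU: "\<And>v. norm (U v) = norm v"
      using U by (auto simp: orthogonal_transformation)
    have [measurable]: "U \<in> borel_measurable borel" by (rule orthogonal_transformation_borel[OF U])
    have US: "U \<in> ?S \<rightarrow>\<^sub>M ?S"
      by (intro measurable_restrict_space2 measurable_restrict_space1)
        (auto simp: normU space_restrict_space)
    have "distr n borel U = n"
    proof (rule measure_eqI)
      fix A assume "A \<in> sets (distr n borel U)"
      then have [measurable]: "A \<in> sets borel" by simp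
      have "?B \<inter> U -` A = U -` (?B \<inter> A)" by (auto simp: normU)
      moreover have "emeasure lborel (U -` (?B \<inter> A)) = emeasure (distr lborel borel U) (?B \<inter> A)"
        by (subst emeasure_distr) auto
      ultimately have "emeasure lborel (?B \<inter> U -` A) = emeasure lborel (?B \<inter> A)"
        by (simp add: lborel_distr_orthogonal[OF U])
      moreover have "U -` A \<in> sets borel"
        using measurable_sets[of U borel borel A] by simp
      ultimately show "emeasure (distr n borel U) A = emeasure n A"
        by (subst emeasure_distr) (auto simp: n_def)
    qed (simp add: sets_n)
    then have nU: "distr n n U = n"
      by (metis distr_cong sets_n)
    have "distr s s U = distr s ?S U" by (rule distr_cong) (auto simp: s_def)
    also have "\<dots> = distr n ?S (U \<circ> p)" unfolding s_def by (rule distr_distr[OF US p_meas])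
    also have "\<dots> = distr n ?S (p \<circ> U)"
    proof (rule distr_cong_AE)
      have "AE z in lborel. z \<noteq> (0::'a)" by (rule AE_lborel_singleton)
      then have "AE z in n. z \<noteq> 0"
        unfolding n_def by (intro AE_uniform_measureI) auto
      then show "AE z in n. (U \<circ> p) z = (p \<circ> U) z"
      proof eventually_elim
        case (elim z)
        then have "U z \<noteq> 0" using normU[of z] by (metis norm_eq_zero)
        with elim show ?case by (simp add: p_def normU linear_cmul[OF linU])
      qed
      show "U \<circ> p \<in> n \<rightarrow>\<^sub>M ?S" by (rule measurable_comp[OF p_meas US])
      show "p \<circ> U \<in> n \<rightarrow>\<^sub>M ?S" by (rule measurable_comp[OF _ p_meas']) measurable
    qed auto
    also have "\<dots> = distr (distr n n U) ?S p"
      by (rule distr_distr[symmetric, OF p_meas]) measurable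
    also have "\<dots> = s" by (simp add: nU s_def)
    finally show ?thesis .
  qed
  moreover have "prob_space s" unfolding s_def by (rule prob_space.prob_space_distr[OF prob_n p_meas])
  ultimately have "rotation_invariant_probability s"
    unfolding rotation_invariant_probability_def by (auto simp: s_def)
  then show ?thesis ..
qed


section \<open>Admissible radial measures\<close>

text \<open>The radial measure \<open>\<omega>\<close> is given by its radial part \<open>\<mu>\<close>.\<close>

definition admissible :: "real measure \<Rightarrow> bool" where
  "admissible \<mu> \<longleftrightarrow>
     finite_measure \<mu> \<and> sets \<mu> = sets (restrict_space borel {0..1}) \<and>
     (\<forall>r. 0 < r \<and> r < 1 \<longrightarrow> emeasure \<mu> {r<..1} > 0)"

definition radial_measure :: "(complex^'n) measure \<Rightarrow> real measure \<Rightarrow> (complex^'n) measure" where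
  "radial_measure \<sigma> \<mu> =
     distr (\<mu> \<Otimes>\<^sub>M \<sigma>) (restrict_space borel (cball 0 1)) (\<lambda>(r, w). r *\<^sub>R w)"


section \<open>Radially weighted Besov spaces\<close>

text \<open>Functions on the open unit ball are represented by total functions on
  \<open>complex^'n\<close>; every notion below depends only on the values in \<open>ball 0 1\<close>.\<close>

definition Hol_ball :: "(complex^'n \<Rightarrow> complex) set" where
  "Hol_ball = {f. \<forall>z\<in>ball 0 1. \<exists>D. (f has_derivative D) (at z) \<and> (\<forall>c v. D (c *s v) = c * D v)}"

definition partial_deriv :: "'n \<Rightarrow> (complex^'n \<Rightarrow> complex) \<Rightarrow> complex^'n \<Rightarrow> complex" where
  "partial_deriv j f z = deriv (\<lambda>w. f (\<chi> i. if i = j then w else z $ i)) (z $ j)"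

definition radial_deriv :: "(complex^'n \<Rightarrow> complex) \<Rightarrow> complex^'n \<Rightarrow> complex" where
  "radial_deriv f z = (\<Sum>j\<in>UNIV. z $ j * partial_deriv j f z)"

text \<open>Squared norms take values in \<open>ennreal\<close>, so that they are \<open>\<infinity>\<close> outside the respective
  spaces. As \<open>0 * \<infinity> = 0\<close> in \<open>ennreal\<close>, the Hardy term vanishes if \<open>\<mu>\<close> has no mass
  at 1.\<close>

definition hardy_sqnorm :: "(complex^'n) measure \<Rightarrow> (complex^'n \<Rightarrow> complex) \<Rightarrow> ennreal" where
  "hardy_sqnorm \<sigma> f = (SUP r\<in>{0..<1}. \<integral>\<^sup>+z. ennreal ((cmod (f (r *\<^sub>R z)))\<^sup>2) \<partial>\<sigma>)"

definition L2_sqnorm :: "(complex^'n) measure \<Rightarrow> real measure \<Rightarrow> (complex^'n \<Rightarrow> complex) \<Rightarrow> ennreal" where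
  "L2_sqnorm \<sigma> \<mu> f =
     (\<integral>\<^sup>+z\<in>ball 0 1. ennreal ((cmod (f z))\<^sup>2) \<partial>radial_measure \<sigma> \<mu>) +
     emeasure \<mu> {1} * hardy_sqnorm \<sigma> f"

definition besov_space :: "(complex^'n) measure \<Rightarrow> real measure \<Rightarrow> nat \<Rightarrow> (complex^'n \<Rightarrow> complex) set" where
  "besov_space \<sigma> \<mu> N = {f \<in> Hol_ball. L2_sqnorm \<sigma> \<mu> ((radial_deriv ^^ N) f) < \<infinity>}"

definition besov_sqnorm :: "(complex^'n) measure \<Rightarrow> real measure \<Rightarrow> nat \<Rightarrow> (complex^'n \<Rightarrow> complex) \<Rightarrow> ennreal" where
  "besov_sqnorm \<sigma> \<mu> N f =
     (if N = 0 then L2_sqnorm \<sigma> \<mu> f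
      else emeasure (radial_measure \<sigma> \<mu>) (cball 0 1) * ennreal ((cmod (f 0))\<^sup>2)
         + L2_sqnorm \<sigma> \<mu> ((radial_deriv ^^ N) f))"

definition besov_norm :: "(complex^'n) measure \<Rightarrow> real measure \<Rightarrow> nat \<Rightarrow> (complex^'n \<Rightarrow> complex) \<Rightarrow> real" where
  "besov_norm \<sigma> \<mu> N f = sqrt (enn2real (besov_sqnorm \<sigma> \<mu> N f))"


section \<open>Multipliers and the weak* topology\<close>

text \<open>A Hilbert function space is given by its set of functions \<open>H\<close> and its norm \<open>nrm\<close>.\<close>

definition Mult :: "('a \<Rightarrow> complex) set \<Rightarrow> ('a \<Rightarrow> complex) set" where
  "Mult H = {\<phi>. \<forall>f\<in>H. (\<lambda>z. \<phi> z * f z) \<in> H}"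

text \<open>The inner product is recovered from the norm by polarization; it is linear in the
  first argument.\<close>

definition hfs_inner :: "(('a \<Rightarrow> complex) \<Rightarrow> real) \<Rightarrow> ('a \<Rightarrow> complex) \<Rightarrow> ('a \<Rightarrow> complex) \<Rightarrow> complex" where
  "hfs_inner nrm f g =
     (complex_of_real ((nrm (\<lambda>z. f z + g z))\<^sup>2 - (nrm (\<lambda>z. f z - g z))\<^sup>2)
      + \<i> * complex_of_real ((nrm (\<lambda>z. f z + \<i> * g z))\<^sup>2 - (nrm (\<lambda>z. f z - \<i> * g z))\<^sup>2)) / 4"

text \<open>The trace class operators on a Hilbert space are the operators
  \<open>A = (\<Sum>k. \<langle>\<sqdot>, y k\<rangle> x k)\<close> with \<open>(\<Sum>k. \<parallel>x k\<parallel> \<parallel>y k\<parallel>) < \<infinity>\<close>, and then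
  \<open>tr (T A) = (\<Sum>k. \<langle>T (x k), y k\<rangle>)\<close> for every bounded operator \<open>T\<close>.\<close>

definition trace_class_reps ::
  "('a \<Rightarrow> complex) set \<Rightarrow> (('a \<Rightarrow> complex) \<Rightarrow> real) \<Rightarrow>
   ((nat \<Rightarrow> 'a \<Rightarrow> complex) \<times> (nat \<Rightarrow> 'a \<Rightarrow> complex)) set" where
  "trace_class_reps H nrm =
     {(x, y). (\<forall>k. x k \<in> H \<and> y k \<in> H) \<and> summable (\<lambda>k. nrm (x k) * nrm (y k))}"

definition trace_pairing ::
  "(('a \<Rightarrow> complex) \<Rightarrow> real) \<Rightarrow> ('a \<Rightarrow> complex) \<Rightarrow>
   (nat \<Rightarrow> 'a \<Rightarrow> complex) \<times> (nat \<Rightarrow> 'a \<Rightarrow> complex) \<Rightarrow> complex" where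
  "trace_pairing nrm \<phi> = (\<lambda>(x, y). \<Sum>k. hfs_inner nrm (\<lambda>z. \<phi> z * x k z) (y k))"

text \<open>The initial topology on \<open>Mult H\<close> for the functionals \<open>\<phi> \<mapsto> tr (M\<^sub>\<phi> A)\<close>, with \<open>A\<close>
  ranging over the trace class.\<close>

definition weak_star_topology ::
  "('a \<Rightarrow> complex) set \<Rightarrow> (('a \<Rightarrow> complex) \<Rightarrow> real) \<Rightarrow> ('a \<Rightarrow> complex) topology" where
  "weak_star_topology H nrm =
     pullback_topology (Mult H)
       (\<lambda>\<phi>. restrict (trace_pairing nrm \<phi>) (trace_class_reps H nrm))
       (product_topology (\<lambda>_. euclidean) (trace_class_reps H nrm))"

definition weak_star_seq_cyclic ::
  "('a \<Rightarrow> complex) set \<Rightarrow> (('a \<Rightarrow> complex) \<Rightarrow> real) \<Rightarrow> ('a \<Rightarrow> complex) \<Rightarrow> bool" where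
  "weak_star_seq_cyclic H nrm \<phi> \<longleftrightarrow>
     (\<exists>u :: nat \<Rightarrow> 'a \<Rightarrow> complex. (\<forall>n. u n \<in> Mult H) \<and>
        limitin (weak_star_topology H nrm) (\<lambda>n z. u n z * \<phi> z) (\<lambda>_. 1) sequentially)"

end

theory Submission
  imports Defs "HOL-Complex_Analysis.Complex_Analysis" "HOL-Real_Asymp.Real_Asymp"
begin

text \<open>
  Suppose \<open>u\<^sub>n \<phi> \<longlonglongrightarrow> 1\<close> weak*. If weak* convergence of sequences means boundedness and pointwise
  convergence, then also \<open>(u\<^sub>n \<phi>)\<^sup>N\<^sup>+\<^sup>1 \<longlonglongrightarrow> 1\<close> weak*, and in particular \<open>\<phi>\<close> and \<open>\<psi>\<close> have no zeros. Writing
  \<open>(u\<^sub>n \<phi>)\<^sup>N\<^sup>+\<^sup>1 = (u\<^sub>n\<^sup>N\<^sup>+\<^sup>1 \<sqdot> \<phi>\<^sup>N\<^sup>+\<^sup>1 / \<psi>) \<sqdot> \<psi>\<close> reduces the theorem to the claim that \<open>\<phi>\<^sup>N\<^sup>+\<^sup>1 / \<psi>\<close> is a multiplier.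

  This claim (\<open>quotient_Mult\<close>) has a short pointwise proof. Fix \<open>z\<close> and put \<open>c = \<phi> z / \<psi> z\<close>, so \<open>\<bar>c\<bar> \<le> 1\<close>. In the binomial expansion of
  \<open>(\<phi> - c \<psi>)\<^sup>N\<^sup>+\<^sup>1\<close> all terms but \<open>\<phi>\<^sup>N\<^sup>+\<^sup>1\<close> are divisible by \<open>\<psi>\<close>, which gives
  \<open>\<phi>\<^sup>N\<^sup>+\<^sup>1 f / \<psi> = (\<phi> - c \<psi>)\<^sup>N\<^sup>+\<^sup>1 f / \<psi> - (\<Sum>i\<le>N. b\<^sub>i (- c)\<^sup>N\<^sup>+\<^sup>1\<^sup>-\<^sup>i \<phi>\<^sup>i \<psi>\<^sup>N\<^sup>-\<^sup>i f)\<close> with the binomial coefficients \<open>b\<^sub>i\<close>.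
  At \<open>z\<close> the first term has \<open>N + 1\<close> vanishing factors and is killed by \<open>R\<^sup>N\<close>. Hence \<open>\<bar>R\<^sup>N (\<phi>\<^sup>N\<^sup>+\<^sup>1 f / \<psi>)\<bar>\<close>
  is at most \<open>\<Sum>i\<le>N. b\<^sub>i \<bar>R\<^sup>N (\<phi>\<^sup>i \<psi>\<^sup>N\<^sup>-\<^sup>i f)\<bar>\<close> at every point, and the functions on the right have finite norm because \<open>\<phi>\<close> and \<open>\<psi>\<close>
  are multipliers.

  The description of weak* convergence holds in every Hilbert function space that contains the constants (\<open>weak_star_limit_imp\<close>
  and \<open>weak_star_limitI\<close>). It rests on reproducing kernels, the density of their span, and the principle of uniform
  boundedness, which also shows that multipliers are bounded operators.

  It remains to see that \<open>B\<^sup>N\<^sub>\<omega>\<close> is such a space. Let \<open>f = (\<Sum>n. f\<^sub>n)\<close> be the homogeneous expansion.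
  Rotation invariance makes the \<open>f\<^sub>n\<close> orthogonal on the sphere, and the norm becomes a weighted sum of
  the mean squares of the \<open>f\<^sub>n\<close> (\<open>besov_sqnorm_eq\<close>). This gives the inner product. Point evaluations are bounded because the maximum of \<open>\<bar>f\<^sub>n\<bar>\<close>
  on the sphere exceeds its quadratic mean at most by a factor of polynomial growth in \<open>n\<close> (\<open>hcoef_sup_bound\<close>), whereas admissibility of \<open>\<mu>\<close>
  prevents the weights from decaying geometrically. A Cauchy sequence therefore converges locally uniformly, and
  Fatou's lemma gives completeness.
\<close>

section \<open>Hilbert function spaces\<close>

lemma limitin_pullback_topology:
  assumes "l \<in> A" "\<And>n. a n \<in> A"
  shows "limitin (pullback_topology A \<Phi> T) a l F \<longleftrightarrow> limitin T (\<lambda>n. \<Phi> (a n)) (\<Phi> l) F"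
proof -
  have "(\<forall>U. (\<exists>V. openin T V \<and> U = \<Phi> -` V \<inter> A) \<and> l \<in> U \<longrightarrow> (\<forall>\<^sub>F n in F. a n \<in> U)) \<longleftrightarrow>
      (\<forall>V. openin T V \<and> l \<in> \<Phi> -` V \<inter> A \<longrightarrow> (\<forall>\<^sub>F n in F. a n \<in> \<Phi> -` V \<inter> A))"
    by blast
  then show ?thesis
    using assms unfolding limitin_def topspace_pullback_topology openin_pullback_topology by simp
qed

text \<open>The functions are total, but only their values on \<open>X\<close> matter: two functions that agree on \<open>X\<close> have
  distance 0, so that \<open>nrm\<close> is only a seminorm on \<open>H\<close>.\<close>

locale hilbert_function_space =
  fixes X :: "'a set" and H :: "('a \<Rightarrow> complex) set" and nrm :: "('a \<Rightarrow> complex) \<Rightarrow> real"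
  assumes one_mem: "(\<lambda>_. 1) \<in> H"
    and add_mem: "f \<in> H \<Longrightarrow> g \<in> H \<Longrightarrow> (\<lambda>z. f z + g z) \<in> H"
    and cmult_mem: "f \<in> H \<Longrightarrow> (\<lambda>z. c * f z) \<in> H"
    and ip_add: "f \<in> H \<Longrightarrow> g \<in> H \<Longrightarrow> h \<in> H \<Longrightarrow>
      hfs_inner nrm (\<lambda>z. f z + g z) h = hfs_inner nrm f h + hfs_inner nrm g h"
    and ip_cmult: "f \<in> H \<Longrightarrow> g \<in> H \<Longrightarrow> hfs_inner nrm (\<lambda>z. c * f z) g = c * hfs_inner nrm f g"
    and ip_sym: "f \<in> H \<Longrightarrow> g \<in> H \<Longrightarrow> hfs_inner nrm g f = cnj (hfs_inner nrm f g)"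
    and ip_self: "f \<in> H \<Longrightarrow> hfs_inner nrm f f = of_real ((nrm f)\<^sup>2)"
    and nrm_nonneg: "nrm f \<ge> 0"
    and eval_bounded: "z \<in> X \<Longrightarrow> \<exists>C. \<forall>f\<in>H. cmod (f z) \<le> C * nrm f"
    and nrm_eq_0: "f \<in> H \<Longrightarrow> (\<And>z. z \<in> X \<Longrightarrow> f z = 0) \<Longrightarrow> nrm f = 0"
    and complete: "(\<And>k::nat. F k \<in> H) \<Longrightarrow>
      (\<And>e. e > 0 \<Longrightarrow> \<exists>K. \<forall>k\<ge>K. \<forall>l\<ge>K. nrm (\<lambda>z. F k z - F l z) < e) \<Longrightarrow>
      \<exists>g\<in>H. (\<lambda>k. nrm (\<lambda>z. F k z - g z)) \<longlonglongrightarrow> 0"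
begin

abbreviation ip where "ip \<equiv> hfs_inner nrm"

lemma zero_mem: "(\<lambda>_. 0) \<in> H"
  using cmult_mem[OF one_mem, of 0] by simp

lemma diff_mem: "f \<in> H \<Longrightarrow> g \<in> H \<Longrightarrow> (\<lambda>z. f z - g z) \<in> H"
  using add_mem[OF _ cmult_mem[of g "-1"], of f] by simp

lemma ip_diff: "f \<in> H \<Longrightarrow> g \<in> H \<Longrightarrow> h \<in> H \<Longrightarrow> ip (\<lambda>z. f z - g z) h = ip f h - ip g h"
  using ip_add[OF _ cmult_mem[of g "-1"], of f h] ip_cmult[of g h "-1"] by simp

lemma ip_add_right: "f \<in> H \<Longrightarrow> g \<in> H \<Longrightarrow> h \<in> H \<Longrightarrow> ip h (\<lambda>z. f z + g z) = ip h f + ip h g"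
  using ip_add[of f g h] ip_sym[OF add_mem[of f g], of h] ip_sym[of f h] ip_sym[of g h] by simp

lemma ip_cmult_right: "f \<in> H \<Longrightarrow> g \<in> H \<Longrightarrow> ip g (\<lambda>z. c * f z) = cnj c * ip g f"
  using ip_cmult[of f g c] ip_sym[OF cmult_mem[of f c], of g] ip_sym[of f g] by simp

lemma ip_diff_right: "f \<in> H \<Longrightarrow> g \<in> H \<Longrightarrow> h \<in> H \<Longrightarrow> ip h (\<lambda>z. f z - g z) = ip h f - ip h g"
  using ip_diff[of f g h] ip_sym[OF diff_mem[of f g], of h] ip_sym[of f h] ip_sym[of g h] by simp

lemma ip_zero: "f \<in> H \<Longrightarrow> ip (\<lambda>_. 0) f = 0" 
  using ip_cmult[OF one_mem, of f 0] by simp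

lemma ip_zero_right: "f \<in> H \<Longrightarrow> ip f (\<lambda>_. 0) = 0" 
  using ip_sym[of "\<lambda>_. 0" f] ip_zero[of f] zero_mem by simp

lemma nrm_square: "f \<in> H \<Longrightarrow> (nrm f)\<^sup>2 = Re (ip f f)"
  by (simp add: ip_self)

lemma nrm_square_add:
  assumes "f \<in> H" "g \<in> H"
  shows "(nrm (\<lambda>z. f z + g z))\<^sup>2 = (nrm f)\<^sup>2 + 2 * Re (ip f g) + (nrm g)\<^sup>2"
  using assms ip_sym[OF assms]
  by (simp add: nrm_square add_mem ip_add ip_add_right)

lemma nrm_cmult: "f \<in> H \<Longrightarrow> nrm (\<lambda>z. c * f z) = cmod c * nrm f"
proof -
  assume f: "f \<in> H"
  have "(nrm (\<lambda>z. c * f z))\<^sup>2 = Re (c * cnj c * ip f f)"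
    using f by (simp add: nrm_square cmult_mem ip_cmult ip_cmult_right mult_ac)
  also have "\<dots> = (cmod c * nrm f)\<^sup>2"
    unfolding complex_norm_square[symmetric] ip_self[OF f] of_real_mult[symmetric] 
    by (simp add: power_mult_distrib)
  finally show ?thesis
    by (rule power2_eq_imp_eq) (simp_all add: nrm_nonneg)
qed

lemma nrm_square_diff:
  assumes "f \<in> H" "g \<in> H"
  shows "(nrm (\<lambda>z. f z - g z))\<^sup>2 = (nrm f)\<^sup>2 - 2 * Re (ip f g) + (nrm g)\<^sup>2"
  using nrm_square_add[OF assms(1) cmult_mem[OF assms(2), of "-1"]] ip_cmult_right[OF assms(2,1), of "-1"]
    nrm_cmult[OF assms(2), of "-1"] by simp

text \<open>Moving from \<open>f\<close> in the direction of \<open>\<langle>f, g\<rangle> g\<close> is the choice that yields the Cauchy-Schwarz inequality, and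
  that makes a point of minimal distance a foot of a perpendicular.\<close>

lemma nrm_square_diff_cmult:
  assumes "f \<in> H" "g \<in> H"
  shows "(nrm (\<lambda>z. f z - of_real t * ip f g * g z))\<^sup>2
    = (nrm f)\<^sup>2 - 2 * t * (cmod (ip f g))\<^sup>2 + t\<^sup>2 * (cmod (ip f g))\<^sup>2 * (nrm g)\<^sup>2"
proof -
  have "Re (ip f (\<lambda>z. of_real t * ip f g * g z)) = Re (of_real t * (ip f g * cnj (ip f g)))"
    unfolding ip_cmult_right[OF assms(2,1)] by (simp add: mult_ac)
  also have "\<dots> = t * (cmod (ip f g))\<^sup>2"
    unfolding complex_norm_square[symmetric] of_real_mult[symmetric] by simp
  finally show ?thesis
    using nrm_square_diff[OF assms(1) cmult_mem[OF assms(2), of "of_real t * ip f g"]]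
      nrm_cmult[OF assms(2), of "of_real t * ip f g"]
    by (simp add: norm_mult power_mult_distrib)
qed

lemma Cauchy_Schwarz:
  assumes "f \<in> H" "g \<in> H"
  shows "cmod (ip f g) \<le> nrm f * nrm g"
proof -
  let ?a = "(cmod (ip f g))\<^sup>2"
  have pos: "0 \<le> (nrm f)\<^sup>2 - 2 * t * ?a + t\<^sup>2 * ?a * (nrm g)\<^sup>2" for t
    unfolding nrm_square_diff_cmult[OF assms, symmetric] by simp
  have "?a \<le> (nrm f * nrm g)\<^sup>2"
  proof (cases "nrm g = 0")
    case True
    have "?a = 0"
    proof (rule ccontr)
      assume a: "?a \<noteq> 0"
      have "0 \<le> (nrm f)\<^sup>2 - 2 * (((nrm f)\<^sup>2 + 1) / (2 * ?a)) * ?a"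
        using pos[of "((nrm f)\<^sup>2 + 1) / (2 * ?a)"] True by simp
      also have "2 * (((nrm f)\<^sup>2 + 1) / (2 * ?a)) * ?a = (nrm f)\<^sup>2 + 1"
        using a by (simp only: times_divide_eq_left times_divide_eq_right) simp
      finally show False by simp
    qed
    then show ?thesis by simp
  next
    case False
    then have g: "(nrm g)\<^sup>2 > 0" by simp
    have red: "F - 2 * (1 / G) * A + (1 / G)\<^sup>2 * A * G = F - A / G" if "G > 0" for F A G :: real
      using that by (simp add: power2_eq_square)
    have "0 \<le> (nrm f)\<^sup>2 - ?a / (nrm g)\<^sup>2"
      using pos[of "1 / (nrm g)\<^sup>2"] unfolding red[OF g] .
    then show ?thesis using g by (simp add: power_mult_distrib field_simps)
  qed
  then show ?thesis by (rule power2_le_imp_le) (simp add: nrm_nonneg)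
qed

lemma nrm_triangle:
  assumes "f \<in> H" "g \<in> H"
  shows "nrm (\<lambda>z. f z + g z) \<le> nrm f + nrm g"
proof (rule power2_le_imp_le)
  have "Re (ip f g) \<le> nrm f * nrm g"
    using Cauchy_Schwarz[OF assms] complex_Re_le_cmod[of "ip f g"] by linarith
  then show "(nrm (\<lambda>z. f z + g z))\<^sup>2 \<le> (nrm f + nrm g)\<^sup>2"
    by (simp add: nrm_square_add[OF assms] power2_sum)
qed (simp add: nrm_nonneg)

lemma nrm_diff_commute:
  assumes "f \<in> H" "g \<in> H"
  shows "nrm (\<lambda>z. f z - g z) = nrm (\<lambda>z. g z - f z)"
  using nrm_cmult[OF diff_mem[OF assms], of "-1"] by simp

lemma nrm_triangle_diff:
  assumes "f \<in> H" "g \<in> H" "h \<in> H"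
  shows "nrm (\<lambda>z. f z - h z) \<le> nrm (\<lambda>z. f z - g z) + nrm (\<lambda>z. g z - h z)"
  using nrm_triangle[OF diff_mem[OF assms(1,2)] diff_mem[OF assms(2,3)]] by simp

lemma nrm_le_add_diff:
  assumes "f \<in> H" "g \<in> H"
  shows "nrm f \<le> nrm g + nrm (\<lambda>z. f z - g z)"
  using nrm_triangle[OF assms(2) diff_mem[OF assms]] by simp

lemma nrm_cong:
  assumes "f \<in> H" "g \<in> H" "\<And>z. z \<in> X \<Longrightarrow> f z = g z"
  shows "nrm f = nrm g"
  using nrm_le_add_diff[OF assms(1,2)] nrm_le_add_diff[OF assms(2,1)] assms(3)
    nrm_eq_0[OF diff_mem[OF assms(1,2)]] nrm_eq_0[OF diff_mem[OF assms(2,1)]]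
  by fastforce

lemma tendsto_ip:
  assumes "\<And>k. F k \<in> H" "f \<in> H" "g \<in> H" "(\<lambda>k. nrm (\<lambda>z. F k z - f z)) \<longlonglongrightarrow> 0"
  shows "(\<lambda>k. ip (F k) g) \<longlonglongrightarrow> ip f g"
proof (rule LIM_zero_cancel, rule Lim_null_comparison)
  show "\<forall>\<^sub>F k in sequentially. norm (ip (F k) g - ip f g) \<le> nrm (\<lambda>z. F k z - f z) * nrm g"
    using Cauchy_Schwarz[OF diff_mem assms(3)] assms by (auto simp: ip_diff)
  show "(\<lambda>k. nrm (\<lambda>z. F k z - f z) * nrm g) \<longlonglongrightarrow> 0"
    using tendsto_mult_right[OF assms(4), of "nrm g"] by simp
qed

lemma tendsto_nrm:
  assumes "\<And>k. F k \<in> H" "f \<in> H" "(\<lambda>k. nrm (\<lambda>z. F k z - f z)) \<longlonglongrightarrow> 0"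
  shows "(\<lambda>k. nrm (F k)) \<longlonglongrightarrow> nrm f"
proof (rule LIM_zero_cancel, rule Lim_null_comparison[OF _ assms(3)])
  show "\<forall>\<^sub>F k in sequentially. norm (nrm (F k) - nrm f) \<le> nrm (\<lambda>z. F k z - f z)"
    using nrm_le_add_diff[OF assms(1,2)] nrm_le_add_diff[OF assms(2,1)] nrm_diff_commute[OF assms(1,2)]
    by (intro always_eventually allI) (smt (verit) real_norm_def)
qed

lemma tendsto_eval:
  assumes "\<And>k. F k \<in> H" "f \<in> H" "(\<lambda>k. nrm (\<lambda>z. F k z - f z)) \<longlonglongrightarrow> 0" "z \<in> X"
  shows "(\<lambda>k. F k z) \<longlonglongrightarrow> f z"
proof -
  obtain C where C: "\<And>f. f \<in> H \<Longrightarrow> cmod (f z) \<le> C * nrm f"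
    using eval_bounded[OF assms(4)] by blast
  show ?thesis
  proof (rule LIM_zero_cancel, rule Lim_null_comparison)
    show "\<forall>\<^sub>F k in sequentially. norm (F k z - f z) \<le> C * nrm (\<lambda>z. F k z - f z)"
      using C[OF diff_mem] assms(1,2) by simp
    show "(\<lambda>k. C * nrm (\<lambda>z. F k z - f z)) \<longlonglongrightarrow> 0"
      using tendsto_mult_left[OF assms(3), of C] by simp
  qed
qed

subsection \<open>Uniform boundedness\<close>

text \<open>The gliding hump argument of Sokal: if the norms of the seminorms were unbounded, points with rapidly
  growing seminorms could be added up along a geometric series, and the sum would violate pointwise boundedness.\<close>

lemma uniform_boundedness:
  fixes p :: "'i \<Rightarrow> ('a \<Rightarrow> complex) \<Rightarrow> real"
  assumes sub: "\<And>i f g. i \<in> I \<Longrightarrow> f \<in> H \<Longrightarrow> g \<in> H \<Longrightarrow> p i (\<lambda>z. f z + g z) \<le> p i f + p i g"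
    and hom: "\<And>i c f. i \<in> I \<Longrightarrow> f \<in> H \<Longrightarrow> p i (\<lambda>z. c * f z) = cmod c * p i f"
    and cont: "\<And>i. i \<in> I \<Longrightarrow> \<exists>K. \<forall>f\<in>H. p i f \<le> K * nrm f"
    and bdd: "\<And>f. f \<in> H \<Longrightarrow> \<exists>B. \<forall>i\<in>I. p i f \<le> B"
  obtains C where "C \<ge> 0" "\<And>i f. i \<in> I \<Longrightarrow> f \<in> H \<Longrightarrow> p i f \<le> C * nrm f"
proof -
  define P where "P i = (\<lambda>f. p i f) ` {f \<in> H. nrm f \<le> 1}" for i
  define op where "op i = Sup (P i)" for i
  have nrm0: "nrm (\<lambda>_. 0) = 0" using nrm_eq_0[OF zero_mem] by simp
  have p0: "p i (\<lambda>_. 0) = 0" if "i \<in> I" for i using hom[OF that zero_mem, of 0] by simp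
  have P_bdd: "bdd_above (P i)" if i: "i \<in> I" for i
  proof -
    obtain K where K: "\<And>f. f \<in> H \<Longrightarrow> p i f \<le> K * nrm f" using cont[OF i] by blast
    have "p i f \<le> max K 0" if "f \<in> H" "nrm f \<le> 1" for f
    proof -
      have "p i f \<le> max K 0 * nrm f"
        using K[OF that(1)] nrm_nonneg[of f] mult_right_mono[of K "max K 0" "nrm f"] by linarith
      also have "\<dots> \<le> max K 0 * 1" using that by (intro mult_left_mono) auto
      finally show ?thesis by simp
    qed
    then show ?thesis unfolding P_def by (intro bdd_aboveI2) auto
  qed
  have P_ne: "0 \<in> P i" if "i \<in> I" for i
    unfolding P_def using p0[OF that] zero_mem nrm0 by (intro image_eqI[of _ _ "\<lambda>_. 0"]) auto
  have op0: "op i \<ge> 0" if "i \<in> I" for i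
    unfolding op_def using P_ne[OF that] P_bdd[OF that] by (rule cSup_upper)
  have op: "p i f \<le> op i * nrm f" if i: "i \<in> I" and f: "f \<in> H" for i f
  proof (cases "nrm f = 0")
    case True
    obtain K where "p i f \<le> K * nrm f" using cont[OF i] f by blast
    then show ?thesis using True by simp
  next
    case False
    then have pos: "nrm f > 0" using nrm_nonneg[of f] by simp
    let ?f = "\<lambda>z. of_real (1 / nrm f) * f z"
    have "nrm ?f \<le> 1" unfolding nrm_cmult[OF f] using pos by (simp add: norm_divide)
    then have "p i ?f \<in> P i"
      unfolding P_def using cmult_mem[OF f] by blast
    then have "p i ?f \<le> op i" unfolding op_def using P_bdd[OF i] by (rule cSup_upper)
    then show ?thesis
      unfolding hom[OF i f] using pos by (simp add: norm_divide pos_divide_le_eq)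
  qed
  have "\<exists>C. \<forall>i\<in>I. op i \<le> C"
  proof (rule ccontr)
    assume "\<not> (\<exists>C. \<forall>i\<in>I. op i \<le> C)"
    then have "\<forall>k::nat. \<exists>i\<in>I. op i > 4 ^ k" by (meson not_le)
    \<comment> \<open>The increments \<open>3\<^sup>-\<^sup>k\<close> are followed by a tail of half their size. As two thirds of the norm are attained below, a
      sixth survives, and the norms \<open>4\<^sup>k\<close> outgrow \<open>3\<^sup>k\<close>.\<close>
    then obtain j where j: "\<And>k::nat. j k \<in> I" "\<And>k. op (j k) > 4 ^ k" by metis
    have "\<exists>g\<in>H. nrm g \<le> (1/3) ^ k \<and> p (j k) g \<ge> 2/3 * op (j k) * (1/3) ^ k" for k
    proof -
      have "op (j k) > 0" using j(2)[of k] by (smt (verit) zero_less_power)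
      then have "2/3 * op (j k) < Sup (P (j k))" by (simp add: op_def)
      then obtain y where y: "y \<in> P (j k)" "2/3 * op (j k) < y"
        by (rule less_cSupE) (use P_ne[OF j(1)] in auto)
      then obtain f where f: "f \<in> H" "nrm f \<le> 1" "2/3 * op (j k) < p (j k) f"
        by (auto simp: P_def)
      show ?thesis
      proof (intro bexI[of _ "\<lambda>z. of_real ((1/3) ^ k) * f z"] conjI)
        show "(\<lambda>z. of_real ((1/3) ^ k) * f z) \<in> H" by (rule cmult_mem[OF f(1)])
        have n: "cmod (of_real ((1/3) ^ k)) = (1/3) ^ k" by (simp only: norm_of_real) simp
        show "nrm (\<lambda>z. of_real ((1/3) ^ k) * f z) \<le> (1/3) ^ k"
          unfolding nrm_cmult[OF f(1)] n using f(2) nrm_nonneg[of f] by (intro mult_left_le) auto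
        show "2/3 * op (j k) * (1/3) ^ k \<le> p (j k) (\<lambda>z. of_real ((1/3) ^ k) * f z)"
          unfolding hom[OF j(1) f(1)] n using f(3) by (simp add: field_simps)
      qed
    qed
    then obtain g where g: "\<And>k. g k \<in> H" "\<And>k. nrm (g k) \<le> (1/3) ^ k"
      "\<And>k. p (j k) (g k) \<ge> 2/3 * op (j k) * (1/3) ^ k" by metis
    \<comment> \<open>As \<open>2 g = (x + g) - (x - g)\<close>, a seminorm is at one of the points \<open>x + g\<close> and \<open>x - g\<close> at least as large
      as at \<open>g\<close>. The sequence moves to that point.\<close>
    define x where "x = rec_nat (\<lambda>_. 0 :: complex) (\<lambda>k y. if p (j k) (g k) \<le> p (j k) (\<lambda>z. y z + g k z)
      then (\<lambda>z. y z + g k z) else (\<lambda>z. y z - g k z))"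
    have x_Suc: "x (Suc k) = (if p (j k) (g k) \<le> p (j k) (\<lambda>z. x k z + g k z)
      then (\<lambda>z. x k z + g k z) else (\<lambda>z. x k z - g k z))" for k by (simp add: x_def)
    have xH: "x k \<in> H" for k
    proof (induction k)
      case 0 show ?case using zero_mem by (simp add: x_def)
    next
      case (Suc k) then show ?case using g(1) by (simp add: x_Suc add_mem diff_mem)
    qed
    have step: "nrm (\<lambda>z. x (Suc k) z - x k z) \<le> (1/3) ^ k" for k
      using g(2)[of k] nrm_cmult[OF g(1)[of k], of "-1"] by (simp add: x_Suc)
    have gain: "2/3 * op (j k) * (1/3) ^ k \<le> p (j k) (x (Suc k))" for k
    proof -
      have "2 * p (j k) (g k) = p (j k) (\<lambda>z. 2 * g k z)" using hom[OF j(1) g(1), of k 2] by simp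
      also have "\<dots> = p (j k) (\<lambda>z. (x k z + g k z) + (-1) * (x k z - g k z))"
        by (rule arg_cong[where f = "p (j k)"]) (simp add: fun_eq_iff)
      also have "\<dots> \<le> p (j k) (\<lambda>z. x k z + g k z) + p (j k) (\<lambda>z. (-1) * (x k z - g k z))"
        by (rule sub[OF j(1) add_mem[OF xH g(1)] cmult_mem[OF diff_mem[OF xH g(1)]]])
      also have "p (j k) (\<lambda>z. (-1) * (x k z - g k z)) = p (j k) (\<lambda>z. x k z - g k z)"
        using hom[OF j(1) diff_mem[OF xH g(1)], of k "-1" k k] by simp
      finally have "p (j k) (g k) \<le> p (j k) (x (Suc k))" by (auto simp: x_Suc)
      with g(3)[of k] show ?thesis by linarith
    qed
    have far: "nrm (\<lambda>z. x (k + n) z - x k z) \<le> 3/2 * (1/3) ^ k - 3/2 * (1/3) ^ (k + n)" for k n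
    proof (induction n)
      case 0 then show ?case using nrm0 by simp
    next
      case (Suc n)
      have "nrm (\<lambda>z. x (k + Suc n) z - x k z) \<le> nrm (\<lambda>z. x (Suc (k + n)) z - x (k + n) z) + nrm (\<lambda>z. x (k + n) z - x k z)"
        using nrm_triangle_diff[OF xH xH xH] by simp
      also have "\<dots> \<le> (1/3) ^ (k + n) + (3/2 * (1/3) ^ k - 3/2 * (1/3) ^ (k + n))"
        by (intro add_mono step Suc.IH)
      finally show ?case by simp
    qed
    have far': "nrm (\<lambda>z. x l z - x k z) \<le> 3/2 * (1/3) ^ k" if "k \<le> l" for k l
    proof -
      have "(0::real) \<le> 3/2 * (1/3) ^ (k + (l - k))" by simp
      then have "nrm (\<lambda>z. x (k + (l - k)) z - x k z) \<le> 3/2 * (1/3) ^ k"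
        using far[of k "l - k"] by linarith
      then show ?thesis using that by simp
    qed
    have "\<exists>y\<in>H. (\<lambda>k. nrm (\<lambda>z. x k z - y z)) \<longlonglongrightarrow> 0"
    proof (rule complete[OF xH])
      fix e :: real assume "e > 0"
      have "(\<lambda>k. 3/2 * (1/3) ^ k) \<longlonglongrightarrow> (3/2 * 0 :: real)"
        by (intro tendsto_intros LIMSEQ_power_zero) auto
      then have "\<forall>\<^sub>F k in sequentially. 3/2 * (1/3) ^ k < e"
        by (rule order_tendstoD(2)) (use \<open>e > 0\<close> in simp)
      then obtain K where K: "\<And>k. k \<ge> K \<Longrightarrow> 3/2 * (1/3) ^ k < e"
        unfolding eventually_sequentially by blast
      have "nrm (\<lambda>z. x k z - x l z) < e" if "k \<ge> K" "l \<ge> K" for k l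
        using far'[of k l] far'[of l k] K[OF that(1)] K[OF that(2)] nrm_diff_commute[OF xH xH, of k l]
        by (cases "k \<le> l") auto
      then show "\<exists>K. \<forall>k\<ge>K. \<forall>l\<ge>K. nrm (\<lambda>z. x k z - x l z) < e" by blast
    qed
    then obtain y where y: "y \<in> H" "(\<lambda>k. nrm (\<lambda>z. x k z - y z)) \<longlonglongrightarrow> 0" by blast
    have near: "nrm (\<lambda>z. x k z - y z) \<le> 3/2 * (1/3) ^ k" for k
    proof (rule LIMSEQ_le_const)
      show "(\<lambda>l. 3/2 * (1/3) ^ k + nrm (\<lambda>z. x l z - y z)) \<longlonglongrightarrow> 3/2 * (1/3) ^ k"
        using tendsto_add[OF tendsto_const y(2)] by simp
      have "nrm (\<lambda>z. x k z - y z) \<le> 3/2 * (1/3) ^ k + nrm (\<lambda>z. x l z - y z)" if "l \<ge> k" for l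
        using nrm_triangle_diff[OF xH xH y(1), of k l] far'[OF that] nrm_diff_commute[OF xH xH, of k l] by simp
      then show "\<exists>N. \<forall>n\<ge>N. nrm (\<lambda>z. x k z - y z) \<le> 3/2 * (1/3) ^ k + nrm (\<lambda>z. x n z - y z)" by blast
    qed
    obtain B where B: "\<And>i. i \<in> I \<Longrightarrow> p i y \<le> B" using bdd[OF y(1)] by blast
    have big: "1/6 * (4/3) ^ k \<le> p (j k) y" for k
    proof -
      have "p (j k) (x (Suc k)) = p (j k) (\<lambda>z. y z + (x (Suc k) z - y z))" by simp
      also have "\<dots> \<le> p (j k) y + p (j k) (\<lambda>z. x (Suc k) z - y z)"
        by (rule sub[OF j(1) y(1) diff_mem[OF xH y(1)]])
      also have "p (j k) (\<lambda>z. x (Suc k) z - y z) \<le> op (j k) * nrm (\<lambda>z. x (Suc k) z - y z)"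
        by (rule op[OF j(1) diff_mem[OF xH y(1)]])
      also have "\<dots> \<le> op (j k) * (3/2 * (1/3) ^ Suc k)"
        by (intro mult_left_mono near op0 j)
      finally have "2/3 * op (j k) * (1/3) ^ k \<le> p (j k) y + op (j k) * (3/2 * (1/3) ^ Suc k)"
        using gain[of k] by linarith
      then have "1/6 * (op (j k) * (1/3) ^ k) \<le> p (j k) y" by simp
      moreover have "(4/3 :: real) ^ k = 4 ^ k * (1/3) ^ k"
        unfolding power_mult_distrib[symmetric] by simp
      then have "(4/3) ^ k \<le> op (j k) * (1/3) ^ k"
        using j(2)[of k] by simp
      ultimately show ?thesis by linarith
    qed
    obtain k where "6 * B < (4/3) ^ k" using real_arch_pow[of "4/3" "6 * B"] by auto
    with big[of k] B[OF j(1), of k] show False by linarith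
  qed
  then obtain C where C: "\<And>i. i \<in> I \<Longrightarrow> op i \<le> C" by blast
  show thesis
  proof (rule that[of "max C 0"])
    fix i f assume i: "i \<in> I" and f: "f \<in> H"
    have "p i f \<le> op i * nrm f" by (rule op[OF i f])
    also have "\<dots> \<le> max C 0 * nrm f" using C[OF i] by (intro mult_right_mono nrm_nonneg) auto
    finally show "p i f \<le> max C 0 * nrm f" .
  qed simp
qed


subsection \<open>Projections and reproducing kernels\<close>

text \<open>By the parallelogram law a sequence in \<open>S\<close> whose distances to \<open>g\<close> tend to the infimum is a Cauchy sequence.
  Its limit \<open>t\<close>, a point of the closure of \<open>S\<close>, is the foot of the perpendicular.\<close>

lemma projection:
  assumes S: "S \<subseteq> H" "(\<lambda>_. 0) \<in> S" "\<And>f g. f \<in> S \<Longrightarrow> g \<in> S \<Longrightarrow> (\<lambda>z. f z + g z) \<in> S"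
      "\<And>c f. f \<in> S \<Longrightarrow> (\<lambda>z. c * f z) \<in> S"
    and g: "g \<in> H"
  obtains s t where "\<And>k::nat. s k \<in> S" "t \<in> H" "(\<lambda>k. nrm (\<lambda>z. s k z - t z)) \<longlonglongrightarrow> 0"
    "\<And>u. u \<in> S \<Longrightarrow> ip (\<lambda>z. g z - t z) u = 0"
proof -
  define D where "D = (\<lambda>s. (nrm (\<lambda>z. g z - s z))\<^sup>2) ` S"
  define d where "d = Inf D"
  have D0: "bdd_below D" unfolding D_def by (rule bdd_belowI2[of _ 0]) simp
  have Dne: "D \<noteq> {}" unfolding D_def using S(2) by blast
  have d_le: "d \<le> (nrm (\<lambda>z. g z - s z))\<^sup>2" if "s \<in> S" for s
    unfolding d_def using D0 that by (intro cInf_lower) (auto simp: D_def)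
  have "\<exists>s\<in>S. (nrm (\<lambda>z. g z - s z))\<^sup>2 < d + 1 / (real k + 1)" for k
  proof -
    have "Inf D < d + 1 / (real k + 1)" by (simp add: d_def)
    then obtain y where "y \<in> D" "y < d + 1 / (real k + 1)"
      using cInf_lessD[OF Dne] by blast
    then show ?thesis by (auto simp: D_def)
  qed
  then obtain s where s: "\<And>k. s k \<in> S" "\<And>k. (nrm (\<lambda>z. g z - s k z))\<^sup>2 < d + 1 / (real k + 1)"
    by metis
  have sH: "s k \<in> H" for k using s(1) S(1) by blast
  have par: "(nrm (\<lambda>z. s k z - s l z))\<^sup>2 \<le> 2 / (real k + 1) + 2 / (real l + 1)" for k l
  proof -
    define a where "a z = g z - s k z" for z
    define b where "b z = g z - s l z" for z
    have a: "a \<in> H" and b: "b \<in> H" unfolding a_def b_def by (auto intro: diff_mem g sH)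
    have "(\<lambda>z. (1/2) * (s k z + s l z)) \<in> S" by (intro S s)
    from d_le[OF this] have "d \<le> (nrm (\<lambda>z. (1/2) * (a z + b z)))\<^sup>2"
      by (simp add: a_def b_def algebra_simps)
    also have "\<dots> = (nrm (\<lambda>z. a z + b z))\<^sup>2 / 4"
      unfolding nrm_cmult[OF add_mem[OF a b]] by (simp add: power_mult_distrib norm_divide power2_eq_square)
    finally have "4 * d \<le> (nrm (\<lambda>z. a z + b z))\<^sup>2" by simp
    moreover have "(\<lambda>z. s k z - s l z) = (\<lambda>z. b z - a z)" by (simp add: a_def b_def fun_eq_iff)
    then have "(nrm (\<lambda>z. s k z - s l z))\<^sup>2 = (nrm (\<lambda>z. a z - b z))\<^sup>2"
      using nrm_diff_commute[OF a b] by simp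
    moreover have "(nrm a)\<^sup>2 < d + 1 / (real k + 1)" "(nrm b)\<^sup>2 < d + 1 / (real l + 1)"
      using s(2)[of k] s(2)[of l] by (simp_all add: a_def[abs_def] b_def[abs_def])
    ultimately show ?thesis
      using nrm_square_add[OF a b] nrm_square_diff[OF a b]
        mult_2[of "1 / (real k + 1)"] mult_2[of "1 / (real l + 1)"] by simp
  qed
  have "\<exists>t\<in>H. (\<lambda>k. nrm (\<lambda>z. s k z - t z)) \<longlonglongrightarrow> 0"
  proof (rule complete[OF sH])
    fix e :: real assume e: "e > 0"
    obtain K :: nat where K: "4 / e\<^sup>2 < real K" using reals_Archimedean2 by blast
    have "nrm (\<lambda>z. s k z - s l z) < e" if "k \<ge> K" "l \<ge> K" for k l
    proof (rule power2_less_imp_less)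
      have small: "2 / (real k + 1) < e\<^sup>2 / 2" if "k \<ge> K" for k
      proof -
        have "4 / e\<^sup>2 < real k + 1" using K that by linarith
        then show ?thesis using e by (simp add: field_simps)
      qed
      show "(nrm (\<lambda>z. s k z - s l z))\<^sup>2 < e\<^sup>2"
        using par[of k l] small[OF that(1)] small[OF that(2)] by linarith
    qed (use e in simp)
    then show "\<exists>K. \<forall>k\<ge>K. \<forall>l\<ge>K. nrm (\<lambda>z. s k z - s l z) < e" by blast
  qed
  then obtain t where t: "t \<in> H" "(\<lambda>k. nrm (\<lambda>z. s k z - t z)) \<longlonglongrightarrow> 0" by blast
  define w where "w z = g z - t z" for z
  have wH: "w \<in> H" unfolding w_def by (rule diff_mem[OF g t(1)])
  have gsH: "(\<lambda>z. g z - s k z) \<in> H" for k by (rule diff_mem[OF g sH])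
  have gs_w: "(\<lambda>k. nrm (\<lambda>z. (g z - s k z) - w z)) \<longlonglongrightarrow> 0"
    using t(2) nrm_diff_commute[OF sH t(1)] by (simp add: w_def)
  have w_le: "(nrm w)\<^sup>2 \<le> d"
  proof (rule LIMSEQ_le)
    show "(\<lambda>k. (nrm (\<lambda>z. g z - s k z))\<^sup>2) \<longlonglongrightarrow> (nrm w)\<^sup>2"
      by (intro tendsto_intros tendsto_nrm gsH wH gs_w)
    show "(\<lambda>k. d + 1 / (real k + 1)) \<longlonglongrightarrow> d"
      using tendsto_add[OF tendsto_const[of d] LIMSEQ_inverse_real_of_nat]
      by (simp add: inverse_eq_divide add.commute)
    show "\<exists>N. \<forall>n\<ge>N. (nrm (\<lambda>z. g z - s n z))\<^sup>2 \<le> d + 1 / (real n + 1)"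
      using s(2) by (meson less_imp_le)
  qed
  have w_min: "d \<le> (nrm (\<lambda>z. w z - c * u z))\<^sup>2" if u: "u \<in> S" for u c
  proof (rule LIMSEQ_le_const)
    have uH: "u \<in> H" using u S(1) by blast
    show "(\<lambda>k. (nrm (\<lambda>z. g z - s k z - c * u z))\<^sup>2) \<longlonglongrightarrow> (nrm (\<lambda>z. w z - c * u z))\<^sup>2"
    proof (intro tendsto_power tendsto_nrm)
      have "(\<lambda>z. g z - s k z - c * u z - (w z - c * u z)) = (\<lambda>z. g z - s k z - w z)" for k
        by (simp add: fun_eq_iff)
      then show "(\<lambda>k. nrm (\<lambda>z. g z - s k z - c * u z - (w z - c * u z))) \<longlonglongrightarrow> 0"
        using gs_w by (simp only:)
    qed (intro diff_mem gsH wH cmult_mem uH)+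
    show "\<exists>N. \<forall>n\<ge>N. d \<le> (nrm (\<lambda>z. g z - s n z - c * u z))\<^sup>2"
    proof (intro exI[of _ 0] allI impI)
      fix n
      have "(\<lambda>z. s n z + c * u z) \<in> S" by (intro S s u)
      from d_le[OF this] show "d \<le> (nrm (\<lambda>z. g z - s n z - c * u z))\<^sup>2"
        by (simp add: algebra_simps)
    qed
  qed
  show thesis
  proof (rule that[OF s(1) t])
    fix u assume u: "u \<in> S"
    then have uH: "u \<in> H" using S(1) by blast
    let ?a = "(cmod (ip w u))\<^sup>2"
    define q where "q = 1 / ((nrm u)\<^sup>2 + 1)"
    have q: "q > 0" "q * (nrm u)\<^sup>2 \<le> 1" by (auto simp: q_def divide_simps add_nonneg_pos)
    have "(nrm w)\<^sup>2 \<le> (nrm w)\<^sup>2 - 2 * q * ?a + q\<^sup>2 * ?a * (nrm u)\<^sup>2"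
      using w_le w_min[OF u, of "of_real q * ip w u"] nrm_square_diff_cmult[OF wH uH, of q] by linarith
    then have "2 * q * ?a \<le> q * ?a * (q * (nrm u)\<^sup>2)"
      by (simp add: power2_eq_square mult_ac)
    also have "\<dots> \<le> q * ?a" using q by (intro mult_left_le) auto
    finally have "?a \<le> 0" using q by (simp add: mult_le_0_iff)
    then show "ip (\<lambda>z. g z - t z) u = 0" by (simp add: w_def[abs_def])
  qed
qed

text \<open>The kernel is a multiple of the component of the constant 1 that is orthogonal to
  the functions vanishing at \<open>z\<close>.\<close>

lemma reproducing_kernel_exists:
  assumes z: "z \<in> X"
  shows "\<exists>k\<in>H. \<forall>f\<in>H. ip f k = f z"
proof -
  define S where "S = {f \<in> H. f z = 0}"
  obtain s t where st: "\<And>k::nat. s k \<in> S" "t \<in> H" "(\<lambda>k. nrm (\<lambda>z. s k z - t z)) \<longlonglongrightarrow> 0"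
    "\<And>u. u \<in> S \<Longrightarrow> ip (\<lambda>z. 1 - t z) u = 0"
    using projection[of S "\<lambda>_. 1"] one_mem zero_mem add_mem cmult_mem by (auto simp: S_def)
  have "(\<lambda>k. s k z) \<longlonglongrightarrow> t z"
    by (rule tendsto_eval[OF _ st(2,3) z]) (use st(1) S_def in auto)
  then have tz: "t z = 0" using st(1) by (simp add: S_def LIMSEQ_const_iff)
  define w where "w x = 1 - t x" for x
  have w: "w \<in> H" "w z = 1" using diff_mem[OF one_mem st(2)] tz by (auto simp: w_def[abs_def])
  obtain C where "cmod (w z) \<le> C * nrm w" using eval_bounded[OF z] w(1) by blast
  then have nw: "nrm w \<noteq> 0" using w(2) by auto
  have "ip f (\<lambda>x. of_real (1 / (nrm w)\<^sup>2) * w x) = f z" if f: "f \<in> H" for f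
  proof -
    have u: "(\<lambda>x. f x - f z * w x) \<in> S"
      using f w diff_mem cmult_mem by (auto simp: S_def)
    then have uH: "(\<lambda>x. f x - f z * w x) \<in> H" by (simp add: S_def)
    have "ip (\<lambda>x. f x - f z * w x) w = 0"
      using ip_sym[OF w(1) uH] st(4)[OF u] by (simp add: w_def[abs_def])
    then have "ip f w = f z * of_real ((nrm w)\<^sup>2)"
      using ip_diff[OF f cmult_mem[OF w(1)] w(1), of "f z"] ip_cmult[OF w(1) w(1), of "f z"] ip_self[OF w(1)]
      by simp
    then show ?thesis
      unfolding ip_cmult_right[OF w(1) f] using nw by simp
  qed
  with cmult_mem[OF w(1)] show ?thesis by blast
qed

definition kern :: "'a \<Rightarrow> 'a \<Rightarrow> complex" where
  "kern z = (SOME k. k \<in> H \<and> (\<forall>f\<in>H. ip f k = f z))"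

lemma kern: "z \<in> X \<Longrightarrow> kern z \<in> H" "z \<in> X \<Longrightarrow> f \<in> H \<Longrightarrow> ip f (kern z) = f z"
  using someI_ex[of "\<lambda>k. k \<in> H \<and> (\<forall>f\<in>H. ip f k = f z)"] reproducing_kernel_exists[of z]
  unfolding kern_def[symmetric] by blast+

inductive_set kern_span :: "('a \<Rightarrow> complex) set" where
  zero: "(\<lambda>_. 0) \<in> kern_span"
| add_kern: "s \<in> kern_span \<Longrightarrow> z \<in> X \<Longrightarrow> (\<lambda>x. s x + c * kern z x) \<in> kern_span"

lemma kern_span_mem: "s \<in> kern_span \<Longrightarrow> s \<in> H"
proof (induction rule: kern_span.induct)
  case (add_kern s z c)
  then show ?case by (intro add_mem cmult_mem kern(1))
qed (rule zero_mem)

lemma kern_span_add: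
  assumes "s \<in> kern_span" "t \<in> kern_span"
  shows "(\<lambda>x. s x + t x) \<in> kern_span"
  using assms(2)
proof (induction rule: kern_span.induct)
  case (add_kern t z c)
  from kern_span.add_kern[OF this(3,2), of c] show ?case by (simp add: add.assoc)
qed (use assms in simp)

lemma kern_span_cmult: "s \<in> kern_span \<Longrightarrow> (\<lambda>x. c * s x) \<in> kern_span"
proof (induction rule: kern_span.induct)
  case (add_kern s z a)
  from kern_span.add_kern[OF this(3,2), of "c * a"] show ?case by (simp add: algebra_simps)
qed (use kern_span.zero in simp)

text \<open>A function orthogonal to all kernels vanishes, so finite combinations of kernels are dense.\<close>

lemma kern_span_dense:
  assumes g: "g \<in> H"
  obtains s where "\<And>k::nat. s k \<in> kern_span" "(\<lambda>k. nrm (\<lambda>z. s k z - g z)) \<longlonglongrightarrow> 0"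
proof -
  obtain s t where st: "\<And>k::nat. s k \<in> kern_span" "t \<in> H" "(\<lambda>k. nrm (\<lambda>z. s k z - t z)) \<longlonglongrightarrow> 0"
    "\<And>u. u \<in> kern_span \<Longrightarrow> ip (\<lambda>z. g z - t z) u = 0"
  proof (rule projection[where S = kern_span and g = g])
    show "kern_span \<subseteq> H" using kern_span_mem by blast
  qed (use kern_span.zero kern_span_add kern_span_cmult g in auto)
  have gt: "(\<lambda>z. g z - t z) \<in> H" by (rule diff_mem[OF g st(2)])
  have "g z - t z = 0" if z: "z \<in> X" for z
  proof -
    have "kern z \<in> kern_span" using kern_span.add_kern[OF kern_span.zero z, of 1] by simp
    from st(4)[OF this] kern(2)[OF z gt] show ?thesis by simp
  qed
  then have n0: "nrm (\<lambda>z. t z - g z) = 0" using nrm_eq_0[OF gt] nrm_diff_commute[OF g st(2)] by simp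
  have sH: "s k \<in> H" for k by (rule kern_span_mem[OF st(1)])
  have "(\<lambda>k. nrm (\<lambda>z. s k z - g z)) \<longlonglongrightarrow> 0"
  proof (rule Lim_null_comparison[OF _ st(3)])
    show "\<forall>\<^sub>F k in sequentially. norm (nrm (\<lambda>z. s k z - g z)) \<le> nrm (\<lambda>z. s k z - t z)"
      using nrm_triangle_diff[OF sH st(2) g] n0 by (simp add: nrm_nonneg)
  qed
  with st(1) show thesis by (rule that)
qed

subsection \<open>Multipliers\<close>

lemma Mult_mem: "\<phi> \<in> Mult H \<Longrightarrow> f \<in> H \<Longrightarrow> (\<lambda>z. \<phi> z * f z) \<in> H"
  by (simp add: Mult_def)

lemma one_Mult: "(\<lambda>_. 1) \<in> Mult H"
  by (simp add: Mult_def)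

lemma Mult_mult:
  assumes "\<phi> \<in> Mult H" "\<psi> \<in> Mult H"
  shows "(\<lambda>z. \<phi> z * \<psi> z) \<in> Mult H"
  unfolding Mult_def using Mult_mem[OF assms(1) Mult_mem[OF assms(2)]] by (simp add: mult.assoc)

lemma Mult_power: "\<phi> \<in> Mult H \<Longrightarrow> (\<lambda>z. \<phi> z ^ k) \<in> Mult H"
  by (induction k) (auto intro: one_Mult Mult_mult)

text \<open>The functionals \<open>f \<mapsto> \<langle>\<phi> f, s\<rangle>\<close> with \<open>s\<close> a combination of kernels only involve finitely many
  values of \<open>f\<close> and hence are continuous; they are pointwise bounded on the unit ball of
  the span, and they determine the norm of \<open>\<phi> f\<close>.\<close>

lemma Mult_bounded:
  assumes \<phi>: "\<phi> \<in> Mult H"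
  obtains C where "C \<ge> 0" "\<And>f. f \<in> H \<Longrightarrow> nrm (\<lambda>z. \<phi> z * f z) \<le> C * nrm f"
proof -
  let ?M = "\<lambda>f z. \<phi> z * f z"
  let ?I = "{s \<in> kern_span. nrm s \<le> 1}"
  have mem: "(?M f) \<in> H" if "f \<in> H" for f by (rule Mult_mem[OF \<phi> that])
  have cont: "\<exists>K. \<forall>f\<in>H. cmod (ip (?M f) s) \<le> K * nrm f" if "s \<in> kern_span" for s
    using that
  proof (induction rule: kern_span.induct)
    case zero
    then show ?case using ip_zero_right mem by (intro exI[of _ 0]) auto
  next
    case (add_kern s z c)
    then obtain K where K: "\<And>f. f \<in> H \<Longrightarrow> cmod (ip (?M f) s) \<le> K * nrm f" by blast
    obtain L where L: "\<And>f. f \<in> H \<Longrightarrow> cmod (f z) \<le> L * nrm f" using eval_bounded[OF add_kern(2)] by blast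
    have "cmod (ip (?M f) (\<lambda>x. s x + c * kern z x)) \<le> (K + cmod c * cmod (\<phi> z) * L) * nrm f" if f: "f \<in> H" for f
    proof -
      have "ip (?M f) (\<lambda>x. s x + c * kern z x) = ip (?M f) s + cnj c * (\<phi> z * f z)"
        using add_kern mem[OF f] by (simp add: ip_add_right ip_cmult_right kern_span_mem kern cmult_mem)
      also have "cmod \<dots> \<le> K * nrm f + cmod (cnj c * (\<phi> z * f z))"
        by (rule order.trans[OF norm_triangle_ineq]) (intro add_mono K f order_refl)
      also have "cmod (cnj c * (\<phi> z * f z)) \<le> cmod c * cmod (\<phi> z) * (L * nrm f)"
        using mult_left_mono[OF L[OF f], of "cmod c * cmod (\<phi> z)"] by (simp add: norm_mult mult_ac)
      finally show ?thesis by (simp add: algebra_simps)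
    qed
    then show ?case by blast
  qed
  obtain C where C: "C \<ge> 0" "\<And>s f. s \<in> ?I \<Longrightarrow> f \<in> H \<Longrightarrow> cmod (ip (?M f) s) \<le> C * nrm f"
  proof (rule uniform_boundedness[where I = ?I and p = "\<lambda>s f. cmod (ip (?M f) s)"])
    fix s f g assume s: "s \<in> ?I" and f: "f \<in> H" and g: "g \<in> H"
    then have "s \<in> H" by (simp add: kern_span_mem)
    then show "cmod (ip (\<lambda>z. \<phi> z * (f z + g z)) s) \<le> cmod (ip (?M f) s) + cmod (ip (?M g) s)"
      using mem[OF f] mem[OF g] by (simp add: distrib_left ip_add norm_triangle_ineq)
  next
    fix s c f assume s: "s \<in> ?I" and f: "f \<in> H"
    then have "s \<in> H" by (simp add: kern_span_mem)
    with mem[OF f] have "ip (\<lambda>z. c * (\<phi> z * f z)) s = c * ip (?M f) s"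
      by (intro ip_cmult)
    then show "cmod (ip (\<lambda>z. \<phi> z * (c * f z)) s) = cmod c * cmod (ip (?M f) s)"
      by (simp add: norm_mult mult.left_commute)
  next
    fix f assume f: "f \<in> H"
    have "cmod (ip (?M f) s) \<le> nrm (?M f)" if "s \<in> ?I" for s
      using Cauchy_Schwarz[OF mem[OF f], of s] mult_left_le[of "nrm s" "nrm (?M f)"] that
      by (auto simp: kern_span_mem nrm_nonneg)
    then show "\<exists>B. \<forall>s\<in>?I. cmod (ip (?M f) s) \<le> B" by blast
  qed (use cont in auto)
  have C': "cmod (ip (?M f) s) \<le> C * nrm f * nrm s" if s: "s \<in> kern_span" and f: "f \<in> H" for s f
  proof (cases "nrm s = 0")
    case True
    then show ?thesis using Cauchy_Schwarz[OF mem[OF f] kern_span_mem[OF s]] by simp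
  next
    case False
    then have pos: "nrm s > 0" using nrm_nonneg[of s] by simp
    have sH: "s \<in> H" by (rule kern_span_mem[OF s])
    have "(\<lambda>z. of_real (1 / nrm s) * s z) \<in> ?I"
      using kern_span_cmult[OF s, of "of_real (1 / nrm s)"] nrm_cmult[OF sH, of "of_real (1 / nrm s)"] pos
      by (simp add: norm_divide)
    from C(2)[OF this f] show ?thesis
      unfolding ip_cmult_right[OF sH mem[OF f]] using pos by (simp add: norm_mult norm_divide field_simps)
  qed
  have "nrm (?M f) \<le> C * nrm f" if f: "f \<in> H" for f
  proof -
    let ?h = "?M f"
    obtain s where s: "\<And>k::nat. s k \<in> kern_span" "(\<lambda>k. nrm (\<lambda>z. s k z - ?h z)) \<longlonglongrightarrow> 0"
      using kern_span_dense[OF mem[OF f]] by blast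
    have sH: "s k \<in> H" for k by (rule kern_span_mem[OF s(1)])
    have "cmod (ip ?h ?h) \<le> C * nrm f * nrm ?h"
    proof (rule LIMSEQ_le)
      show "(\<lambda>k. cmod (ip (s k) ?h)) \<longlonglongrightarrow> cmod (ip ?h ?h)"
        by (intro tendsto_norm tendsto_ip sH mem f s)
      show "(\<lambda>k. C * nrm f * nrm (s k)) \<longlonglongrightarrow> C * nrm f * nrm ?h"
        by (intro tendsto_mult tendsto_const tendsto_nrm sH mem f s)
      show "\<exists>N. \<forall>n\<ge>N. cmod (ip (s n) ?h) \<le> C * nrm f * nrm (s n)"
      proof (intro exI[of _ 0] allI impI)
        fix n
        have "cmod (ip (s n) ?h) = cmod (ip ?h (s n))" by (subst ip_sym[OF mem[OF f] sH]) simp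
        also have "\<dots> \<le> C * nrm f * nrm (s n)" by (rule C'[OF s(1) f])
        finally show "cmod (ip (s n) ?h) \<le> C * nrm f * nrm (s n)" .
      qed
    qed
    then have "nrm ?h * nrm ?h \<le> C * nrm f * nrm ?h"
      by (simp add: ip_self[OF mem[OF f]] power2_eq_square norm_mult)
    then show ?thesis
      using nrm_nonneg[of ?h] nrm_nonneg[of f] C(1) by (cases "nrm ?h = 0") auto
  qed
  with C(1) show thesis by (rule that)
qed

subsection \<open>Weak* convergence of sequences of multipliers\<close>

lemma limitin_weak_star_iff:
  assumes "l \<in> Mult H" "\<And>n. a n \<in> Mult H"
  shows "limitin (weak_star_topology H nrm) a l F \<longleftrightarrow>
    (\<forall>xy\<in>trace_class_reps H nrm. ((\<lambda>n. trace_pairing nrm (a n) xy) \<longlongrightarrow> trace_pairing nrm l xy) F)"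
  unfolding weak_star_topology_def
  by (subst limitin_pullback_topology[OF assms]) (simp add: limitin_componentwise)

text \<open>Testing against the rank one operators \<open>\<langle>\<sqdot>, g\<rangle> f\<close> gives \<open>\<langle>a\<^sub>n f, g\<rangle> \<longlonglongrightarrow> \<langle>f, g\<rangle>\<close>. Uniform
  boundedness for the functionals \<open>g \<mapsto> \<langle>a\<^sub>n f, g\<rangle>\<close> bounds \<open>a\<^sub>n f\<close> for each \<open>f\<close>, and a second application bounds the multiplication
  operators. The reproducing kernels as \<open>g\<close> give the values.\<close>

lemma weak_star_limit_imp:
  assumes a: "\<And>n. a n \<in> Mult H" and lim: "limitin (weak_star_topology H nrm) a (\<lambda>_. 1) sequentially"
  obtains C where "C \<ge> 0" "\<And>n f. f \<in> H \<Longrightarrow> nrm (\<lambda>z. a n z * f z) \<le> C * nrm f"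
    "\<And>z. z \<in> X \<Longrightarrow> (\<lambda>n. a n z) \<longlonglongrightarrow> 1"
proof -
  let ?T = "\<lambda>n f z. a n z * f z"
  have mem: "(?T n f) \<in> H" if "f \<in> H" for n f by (rule Mult_mem[OF a that])
  have nrm0: "nrm (\<lambda>_. 0) = 0" using nrm_eq_0[OF zero_mem] by simp
  have weak: "(\<lambda>n. ip (?T n f) g) \<longlonglongrightarrow> ip f g" if f: "f \<in> H" and g: "g \<in> H" for f g
  proof -
    define x where "x k = (if k = (0::nat) then f else (\<lambda>_. 0))" for k
    define y where "y k = (if k = (0::nat) then g else (\<lambda>_. 0))" for k
    have "summable (\<lambda>k. nrm (x k) * nrm (y k))"
      by (rule summable_finite[of "{0}"]) (auto simp: x_def nrm0)
    then have xy: "(x, y) \<in> trace_class_reps H nrm"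
      using f g zero_mem by (auto simp: trace_class_reps_def x_def y_def)
    have pair: "trace_pairing nrm \<theta> (x, y) = ip (\<lambda>z. \<theta> z * f z) g" for \<theta>
    proof -
      have "trace_pairing nrm \<theta> (x, y) = (\<Sum>k\<in>{0}. ip (\<lambda>z. \<theta> z * x k z) (y k))"
        unfolding trace_pairing_def prod.case
        by (rule suminf_finite) (auto simp: x_def y_def ip_zero[OF zero_mem])
      then show ?thesis by (simp add: x_def y_def)
    qed
    from lim xy have "(\<lambda>n. trace_pairing nrm (a n) (x, y)) \<longlonglongrightarrow> trace_pairing nrm (\<lambda>_. 1) (x, y)"
      unfolding limitin_weak_star_iff[OF one_Mult a] by blast
    then show ?thesis by (simp add: pair)
  qed
  have ptw: "\<exists>B. \<forall>n. nrm (?T n f) \<le> B" if f: "f \<in> H" for f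
  proof -
    obtain C where C: "\<And>n g. g \<in> H \<Longrightarrow> cmod (ip (?T n f) g) \<le> C * nrm g"
    proof (rule uniform_boundedness[where I = UNIV and p = "\<lambda>n g. cmod (ip (?T n f) g)"])
      show "cmod (ip (?T n f) (\<lambda>z. g z + h z)) \<le> cmod (ip (?T n f) g) + cmod (ip (?T n f) h)"
        if "g \<in> H" "h \<in> H" for n g h
        using that by (simp add: ip_add_right mem[OF f] norm_triangle_ineq)
      show "cmod (ip (?T n f) (\<lambda>z. c * g z)) = cmod c * cmod (ip (?T n f) g)"
        if "g \<in> H" for n c g
        using that by (simp add: ip_cmult_right mem[OF f] norm_mult)
      show "\<exists>K. \<forall>g\<in>H. cmod (ip (?T n f) g) \<le> K * nrm g" for n
        using Cauchy_Schwarz[OF mem[OF f]] by blast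
      show "\<exists>B. \<forall>n\<in>UNIV. cmod (ip (?T n f) g) \<le> B" if "g \<in> H" for g
        using convergent_imp_Bseq[OF convergentI[OF weak[OF f that]]] unfolding Bseq_def by auto
    qed auto
    have "nrm (?T n f) \<le> max C 0" for n
    proof (cases "nrm (?T n f) = 0")
      case False
      then have pos: "nrm (?T n f) > 0" using nrm_nonneg[of "?T n f"] by simp
      have "nrm (?T n f) * nrm (?T n f) \<le> C * nrm (?T n f)"
        using C[OF mem[OF f], of n n] by (simp add: ip_self[OF mem[OF f]] power2_eq_square norm_mult)
      then show ?thesis using pos by simp
    qed simp
    then show ?thesis by blast
  qed
  obtain C where C: "C \<ge> 0" "\<And>n f. f \<in> H \<Longrightarrow> nrm (?T n f) \<le> C * nrm f"
  proof (rule uniform_boundedness[where I = UNIV and p = "\<lambda>n f. nrm (?T n f)"])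
    show "nrm (\<lambda>z. a n z * (f z + g z)) \<le> nrm (?T n f) + nrm (?T n g)"
      if "f \<in> H" "g \<in> H" for n f g
      using nrm_triangle[OF mem[OF that(1)] mem[OF that(2)]] by (simp add: distrib_left)
    show "nrm (\<lambda>z. a n z * (c * f z)) = cmod c * nrm (?T n f)" if "f \<in> H" for n c f
      using nrm_cmult[OF mem[OF that], of c] by (simp add: mult.left_commute)
    show "\<exists>K. \<forall>f\<in>H. nrm (?T n f) \<le> K * nrm f" for n
      by (rule Mult_bounded[OF a[of n]]) blast
  qed (use ptw in auto)
  show thesis
  proof (rule that[OF C])
    fix z assume z: "z \<in> X"
    from weak[OF one_mem kern(1)[OF z]] show "(\<lambda>n. a n z) \<longlonglongrightarrow> 1"
      using kern(2)[OF z mem[OF one_mem]] kern(2)[OF z one_mem] by simp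
  qed
qed

text \<open>Pointwise convergence is convergence of \<open>\<langle>a\<^sub>n f, s\<rangle>\<close> for combinations \<open>s\<close> of kernels. These are dense, so
  boundedness extends it to all \<open>s\<close>, and Tannery's theorem extends it to the series that represent trace class operators.\<close>

lemma weak_star_limitI:
  assumes a: "\<And>n. a n \<in> Mult H"
    and C: "\<And>n f. f \<in> H \<Longrightarrow> nrm (\<lambda>z. a n z * f z) \<le> C * nrm f"
    and ptw: "\<And>z. z \<in> X \<Longrightarrow> (\<lambda>n. a n z) \<longlonglongrightarrow> 1"
  shows "limitin (weak_star_topology H nrm) a (\<lambda>_. 1) sequentially"
proof -
  let ?T = "\<lambda>n f z. a n z * f z"
  have mem: "(?T n f) \<in> H" if "f \<in> H" for n f by (rule Mult_mem[OF a that])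
  have span: "(\<lambda>n. ip (?T n f) s) \<longlonglongrightarrow> ip f s" if "s \<in> kern_span" and f: "f \<in> H" for s f
    using that(1)
  proof (induction rule: kern_span.induct)
    case zero
    then show ?case using f by (simp add: ip_zero_right mem)
  next
    case (add_kern s z c)
    have "ip g (\<lambda>x. s x + c * kern z x) = ip g s + cnj c * g z" if "g \<in> H" for g
      using add_kern that by (simp add: ip_add_right ip_cmult_right kern_span_mem kern cmult_mem)
    moreover have "(\<lambda>n. ip (?T n f) s + cnj c * (a n z * f z)) \<longlonglongrightarrow> ip f s + cnj c * (1 * f z)"
      by (intro tendsto_intros add_kern ptw)
    ultimately show ?case using f mem[OF f] by simp
  qed
  have weak: "(\<lambda>n. ip (?T n f) g) \<longlonglongrightarrow> ip f g" if f: "f \<in> H" and g: "g \<in> H" for f g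
  proof (rule LIM_zero_cancel, rule tendstoI)
    fix e :: real assume e: "e > 0"
    define B where "B = \<bar>C\<bar> * nrm f + nrm f + 1"
    have B: "B > 0" unfolding B_def using nrm_nonneg[of f] by (intro add_nonneg_pos add_nonneg_nonneg) auto
    obtain s where s: "\<And>k::nat. s k \<in> kern_span" "(\<lambda>k. nrm (\<lambda>z. s k z - g z)) \<longlonglongrightarrow> 0"
      using kern_span_dense[OF g] by blast
    have "\<forall>\<^sub>F k in sequentially. nrm (\<lambda>z. s k z - g z) < e / (2 * B)"
      using s(2) e B by (intro order_tendstoD) auto
    then obtain k where k: "nrm (\<lambda>z. s k z - g z) < e / (2 * B)"
      by (auto simp: eventually_sequentially)
    have sH: "s k \<in> H" by (rule kern_span_mem[OF s(1)])
    have hH: "(\<lambda>z. a n z * f z - f z) \<in> H" for n by (rule diff_mem[OF mem[OF f] f])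
    have hB: "nrm (\<lambda>z. a n z * f z - f z) \<le> B" for n
    proof -
      have "nrm (\<lambda>z. a n z * f z - f z) \<le> nrm (?T n f) + nrm f"
        using nrm_triangle[OF mem[OF f] cmult_mem[OF f, of "-1"]] nrm_cmult[OF f, of "-1"] by simp
      also have "\<dots> \<le> \<bar>C\<bar> * nrm f + nrm f"
        using C[OF f, of n] mult_right_mono[OF abs_ge_self nrm_nonneg, of C f] by linarith
      finally show ?thesis by (simp add: B_def)
    qed
    have "(\<lambda>n. ip (?T n f) (s k) - ip f (s k)) \<longlonglongrightarrow> ip f (s k) - ip f (s k)"
      by (intro tendsto_intros span s f)
    then have "(\<lambda>n. cmod (ip (?T n f) (s k) - ip f (s k))) \<longlonglongrightarrow> 0"
      by (simp add: tendsto_norm_zero)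
    then have "\<forall>\<^sub>F n in sequentially. cmod (ip (?T n f) (s k) - ip f (s k)) < e / 2"
      by (rule order_tendstoD(2)) (use e in simp)
    then show "\<forall>\<^sub>F n in sequentially. dist (ip (?T n f) g - ip f g) 0 < e"
    proof eventually_elim
      case (elim n)
      let ?h = "\<lambda>z. a n z * f z - f z"
      have "ip ?h g = ip ?h (s k) - ip ?h (\<lambda>z. s k z - g z)"
        by (simp add: ip_diff_right sH g hH)
      then have "cmod (ip ?h g) \<le> cmod (ip ?h (s k)) + cmod (ip ?h (\<lambda>z. s k z - g z))"
        by (simp only: norm_triangle_ineq4)
      moreover have "cmod (ip ?h (\<lambda>z. s k z - g z)) \<le> nrm ?h * nrm (\<lambda>z. s k z - g z)"
        by (rule Cauchy_Schwarz[OF hH diff_mem[OF sH g]])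
      moreover have "nrm ?h * nrm (\<lambda>z. s k z - g z) \<le> B * (e / (2 * B))"
        by (intro mult_mono hB less_imp_le[OF k] less_imp_le[OF B] nrm_nonneg)
      moreover have "B * (e / (2 * B)) = e / 2" using B by simp
      moreover have "cmod (ip ?h (s k)) < e / 2"
        using elim by (simp add: ip_diff[OF mem[OF f] f] sH)
      ultimately have "cmod (ip ?h g) < e" by linarith
      then show ?case by (simp add: ip_diff[OF mem[OF f] f] g)
    qed
  qed
  show ?thesis
    unfolding limitin_weak_star_iff[OF one_Mult a]
  proof clarify
    fix x y assume xy: "(x, y) \<in> trace_class_reps H nrm"
    then have x: "\<And>k. x k \<in> H" and y: "\<And>k. y k \<in> H" and sm: "summable (\<lambda>k. nrm (x k) * nrm (y k))"
      by (auto simp: trace_class_reps_def)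
    have bnd: "norm (ip (?T n (x k)) (y k)) \<le> C * (nrm (x k) * nrm (y k))" for k n
      using Cauchy_Schwarz[OF mem[OF x] y, of n k k] mult_right_mono[OF C[OF x] nrm_nonneg, of n k "y k"]
      by (simp add: mult.assoc)
    have "(\<lambda>n. \<Sum>k. ip (?T n (x k)) (y k)) \<longlonglongrightarrow> (\<Sum>k. ip (x k) (y k))"
      by (rule tannerys_theorem[where M = "\<lambda>k. C * (nrm (x k) * nrm (y k))", THEN conjunct2, THEN conjunct2])
        (use weak x y bnd sm in \<open>auto intro!: summable_mult always_eventually\<close>)
    then show "(\<lambda>n. trace_pairing nrm (a n) (x, y)) \<longlonglongrightarrow> trace_pairing nrm (\<lambda>_. 1) (x, y)"
      by (simp add: trace_pairing_def)
  qed
qed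

end

section \<open>Holomorphic functions on the ball\<close>

lemma norm_vector_smult_complex: "norm (c *s v) = cmod c * norm (v :: complex^'n)"
proof -
  have "norm (c *s v) = L2_set (\<lambda>i. cmod c * norm (v $ i)) UNIV"
    by (simp add: norm_vec_def norm_mult)
  also have "\<dots> = cmod c * L2_set (\<lambda>i. norm (v $ i)) UNIV"
    by (simp add: L2_set_right_distrib)
  finally show ?thesis by (simp add: norm_vec_def)
qed

lemma scaleR_eq_vector_smult: "r *\<^sub>R (v :: complex^'n) = of_real r *s v"
  by (simp add: vec_eq_iff) (simp add: scaleR_conv_of_real)

lemma bounded_linear_smult_left: "bounded_linear (\<lambda>t. t *s (v :: complex^'n))"
proof (rule bounded_linear_intro[where K = "norm v"])
  show "(x + y) *s v = x *s v + y *s v" for x y by (simp add: vec_eq_iff algebra_simps)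
  show "(r *\<^sub>R x) *s v = r *\<^sub>R (x *s v)" for r x by (simp add: vec_eq_iff)
  show "norm (x *s v) \<le> norm x * norm v" for x by (simp add: norm_vector_smult_complex)
qed

lemma bounded_linear_smult_right: "bounded_linear (\<lambda>v. c *s (v :: complex^'n))"
proof (rule bounded_linear_intro[where K = "cmod c"])
  show "c *s (x + y) = c *s x + c *s y" for x y :: "complex^'n" by (simp add: vec_eq_iff algebra_simps)
  show "c *s (r *\<^sub>R x) = r *\<^sub>R (c *s x)" for r and x :: "complex^'n" by (simp add: vec_eq_iff)
  show "norm (c *s x) \<le> norm x * cmod c" for x :: "complex^'n"
    by (simp add: norm_vector_smult_complex mult.commute)
qed

lemma polar_decomposition:
  fixes z :: "complex^'n"
  obtains u where "u \<in> sphere 0 1" "z = of_real (norm z) *s u"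
proof (cases "z = 0")
  case True
  obtain e :: "complex^'n" where "norm e = 1" using vector_choose_size[of 1] by auto
  then show thesis using that[of e] True by simp
next
  case False
  then show thesis using that[of "of_real (1 / norm z) *s z"]
    by (simp add: norm_vector_smult_complex norm_divide vector_smult_assoc)
qed

lemma Hol_ballI:
  assumes "\<And>z. z \<in> ball 0 1 \<Longrightarrow> (f has_derivative D z) (at z)"
    and "\<And>z c v. z \<in> ball 0 1 \<Longrightarrow> D z (c *s v) = c * D z v"
  shows "f \<in> Hol_ball"
  using assms unfolding Hol_ball_def by blast

lemma Hol_ball_derivative:
  assumes "f \<in> Hol_ball" "z \<in> ball 0 1"
  shows "(f has_derivative frechet_derivative f (at z)) (at z)"
    and "frechet_derivative f (at z) (c *s v) = c * frechet_derivative f (at z) v"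
proof -
  obtain D where D: "(f has_derivative D) (at z)" "\<And>c v. D (c *s v) = c * D v"
    using assms unfolding Hol_ball_def by blast
  then show "(f has_derivative frechet_derivative f (at z)) (at z)"
    "frechet_derivative f (at z) (c *s v) = c * frechet_derivative f (at z) v"
    using frechet_derivative_at[OF D(1)] by simp_all
qed

lemma Hol_ball_cong:
  assumes "f \<in> Hol_ball" "\<And>z. z \<in> ball 0 1 \<Longrightarrow> g z = f z"
  shows "g \<in> Hol_ball"
proof (rule Hol_ballI)
  fix z :: "complex^'a" assume z: "z \<in> ball 0 1"
  show "(g has_derivative frechet_derivative f (at z)) (at z)"
    by (rule has_derivative_transform_within_open[OF Hol_ball_derivative(1)[OF assms(1) z] open_ball z])
      (simp add: assms(2))
qed (rule Hol_ball_derivative(2)[OF assms(1)])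

lemma Hol_ball_continuous_on: "f \<in> Hol_ball \<Longrightarrow> continuous_on (ball 0 1) f"
  by (metis Hol_ball_derivative(1) continuous_at_imp_continuous_on has_derivative_continuous)

lemma Hol_ball_const: "(\<lambda>z. c) \<in> Hol_ball"
  by (rule Hol_ballI[OF has_derivative_const]) simp

lemma Hol_ball_add:
  assumes f: "f \<in> Hol_ball" and g: "g \<in> Hol_ball"
  shows "(\<lambda>z. f z + g z) \<in> Hol_ball"
  by (rule Hol_ballI[OF has_derivative_add[OF Hol_ball_derivative(1)[OF f] Hol_ball_derivative(1)[OF g]]])
    (simp_all add: Hol_ball_derivative(2)[OF f] Hol_ball_derivative(2)[OF g] algebra_simps)

lemma Hol_ball_mult:
  assumes f: "f \<in> Hol_ball" and g: "g \<in> Hol_ball"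
  shows "(\<lambda>z. f z * g z) \<in> Hol_ball"
  by (rule Hol_ballI[OF has_derivative_mult[OF Hol_ball_derivative(1)[OF f] Hol_ball_derivative(1)[OF g]]])
    (simp_all add: Hol_ball_derivative(2)[OF f] Hol_ball_derivative(2)[OF g] algebra_simps)

lemma Hol_ball_power: "f \<in> Hol_ball \<Longrightarrow> (\<lambda>z. f z ^ k) \<in> Hol_ball"
  by (induction k) (auto intro: Hol_ball_const Hol_ball_mult)

lemma Hol_ball_cmult: "f \<in> Hol_ball \<Longrightarrow> (\<lambda>z. c * f z) \<in> Hol_ball"
  by (intro Hol_ball_mult Hol_ball_const)

lemma Hol_ball_diff: "f \<in> Hol_ball \<Longrightarrow> g \<in> Hol_ball \<Longrightarrow> (\<lambda>z. f z - g z) \<in> Hol_ball"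
  using Hol_ball_add[of f "\<lambda>z. -1 * g z"] Hol_ball_cmult[of g "-1"] by simp

lemma Hol_ball_sum:
  "(\<And>i. i \<in> I \<Longrightarrow> f i \<in> Hol_ball) \<Longrightarrow> (\<lambda>z. \<Sum>i\<in>I. f i z) \<in> Hol_ball"
  by (induction I rule: infinite_finite_induct) (auto intro: Hol_ball_const Hol_ball_add)

lemma Hol_ball_divide:
  assumes f: "f \<in> Hol_ball" and g: "g \<in> Hol_ball" and nz: "\<And>z. z \<in> ball 0 1 \<Longrightarrow> g z \<noteq> 0"
  shows "(\<lambda>z. f z / g z) \<in> Hol_ball"
proof -
  have "(\<lambda>z. inverse (g z)) \<in> Hol_ball"
    by (rule Hol_ballI[OF Deriv.has_derivative_inverse[OF nz Hol_ball_derivative(1)[OF g]]])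
      (simp_all add: Hol_ball_derivative(2)[OF g] algebra_simps)
  from Hol_ball_mult[OF f this] show ?thesis by (simp add: field_simps)
qed

lemma Hol_ball_dilate:
  assumes f: "f \<in> Hol_ball" and "cmod c \<le> 1"
  shows "(\<lambda>z. f (c *s z)) \<in> Hol_ball"
proof (rule Hol_ballI[OF has_derivative_compose[OF bounded_linear_imp_has_derivative[OF bounded_linear_smult_right]]])
  fix z :: "complex^'a" assume "z \<in> ball 0 1"
  then have cz: "c *s z \<in> ball 0 1"
    using mult_right_mono[OF assms(2), of "norm z"] by (simp add: norm_vector_smult_complex)
  show "(f has_derivative frechet_derivative f (at (c *s z))) (at (c *s z))"
    by (rule Hol_ball_derivative(1)[OF f cz])
  show "frechet_derivative f (at (c *s z)) (c *s (d *s v)) = d * frechet_derivative f (at (c *s z)) (c *s v)" for d v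
    by (simp add: Hol_ball_derivative(2)[OF f cz])
qed

lemma has_field_derivative_slice:
  assumes f: "f \<in> Hol_ball" and x: "x \<in> ball 0 1" "a + t *s v = x"
  shows "((\<lambda>t. f (a + t *s v)) has_field_derivative frechet_derivative f (at x) v) (at t)"
proof -
  have "((\<lambda>t. a + t *s v) has_derivative (\<lambda>s. 0 + s *s v)) (at t)"
    by (intro has_derivative_add has_derivative_const
        bounded_linear_imp_has_derivative[OF bounded_linear_smult_left])
  then have "((\<lambda>t. f (a + t *s v)) has_derivative (\<lambda>s. frechet_derivative f (at x) (0 + s *s v))) (at t)"
    by (rule has_derivative_compose) (simp only: x(2) Hol_ball_derivative(1)[OF f x(1)])
  then show ?thesis
    by (simp add: has_field_derivative_def Hol_ball_derivative(2)[OF f x(1)] mult.commute[of _ "frechet_derivative f (at x) v"])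
qed

lemma Hol_ball_slice_holomorphic:
  assumes "f \<in> Hol_ball" "\<And>t. t \<in> S \<Longrightarrow> norm (a + t *s v) < 1"
  shows "(\<lambda>t. f (a + t *s v)) holomorphic_on S"
proof (rule holomorphic_onI)
  fix t assume "t \<in> S"
  then have "a + t *s v \<in> ball 0 1" using assms(2) by simp
  from has_field_derivative_slice[OF assms(1) this refl]
  show "(\<lambda>t. f (a + t *s v)) field_differentiable at t within S"
    by (metis field_differentiable_at_within field_differentiable_def)
qed

lemma Hol_ball_radial_holomorphic:
  assumes "(f :: complex^'n \<Rightarrow> complex) \<in> Hol_ball" "norm z * R \<le> 1" "0 < R"
  shows "(\<lambda>t. f (t *s z)) holomorphic_on ball 0 R"
proof -
  have "norm (0 + t *s z) < 1" if "t \<in> ball 0 R" for t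
  proof (cases "z = 0")
    case False
    then have "cmod t * norm z < R * norm z" using that by simp
    also have "\<dots> \<le> 1" using assms by (simp add: mult.commute)
    finally show ?thesis by (simp add: norm_vector_smult_complex)
  qed simp
  from Hol_ball_slice_holomorphic[OF assms(1), of "ball 0 R" 0 z, OF this] show ?thesis by simp
qed

lemma Hol_ball_deriv_bound:
  assumes f: "f \<in> Hol_ball"
    and sub: "cball x r \<subseteq> ball 0 1" "0 < r" and M: "\<And>y. y \<in> cball x r \<Longrightarrow> cmod (f y) \<le> M"
  shows "cmod (frechet_derivative f (at x) h) \<le> M / r * norm h"
proof (cases "h = 0")
  case True
  have "x \<in> ball 0 1" using subsetD[OF sub(1), of x] sub(2) by simp
  from Hol_ball_derivative(2)[OF f this, of 0 0] True show ?thesis by simp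
next
  case False
  define \<rho> where "\<rho> = r / norm h"
  have \<rho>: "\<rho> > 0" using False sub by (simp add: \<rho>_def)
  have mem: "x + t *s h \<in> cball x r" if "cmod t \<le> \<rho>" for t
    using that False by (simp add: norm_vector_smult_complex dist_norm \<rho>_def field_simps)
  let ?g = "\<lambda>t. f (x + t *s h)"
  have hol: "?g holomorphic_on cball 0 \<rho>"
    by (rule Hol_ball_slice_holomorphic[OF f]) (use mem sub in force)
  have "cmod ((deriv ^^ 1) ?g 0) \<le> fact 1 * M / \<rho> ^ 1"
  proof (rule Cauchy_inequality[OF _ _ \<rho>])
    show "?g holomorphic_on ball 0 \<rho>" using hol by (rule holomorphic_on_subset) auto
    show "continuous_on (cball 0 \<rho>) ?g" using hol by (rule holomorphic_on_imp_continuous_on)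
    show "cmod (?g t) \<le> M" if "cmod (0 - t) = \<rho>" for t
      by (rule M, rule mem) (use that in simp)
  qed
  moreover have "deriv ?g 0 = frechet_derivative f (at x) h"
    by (rule DERIV_imp_deriv, rule has_field_derivative_slice[OF f]) (use subsetD[OF sub(1), of x] sub(2) in auto)
  ultimately show ?thesis using False sub by (simp add: \<rho>_def field_simps)
qed

text \<open>Cauchy's estimate on slices turns local uniform convergence of the functions into local
  uniform convergence of their derivatives, and complex linearity of the derivatives survives the limit.\<close>

lemma Hol_ball_uniform_limit:
  assumes fk: "\<And>k. (f k :: complex^'n \<Rightarrow> complex) \<in> Hol_ball"
    and lim: "\<And>s. s < 1 \<Longrightarrow> uniform_limit (cball 0 s) f g sequentially"
  shows "g \<in> Hol_ball"
proof -
  have "\<exists>D. (g has_derivative D) (at a) \<and> (\<forall>c v. D (c *s v) = c * D v)" if a: "a \<in> ball 0 1" for a :: "complex^'n"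
  proof -
  define \<delta> where "\<delta> = (1 - norm a) / 2"
  have s: "norm a + \<delta> < 1" using a by (simp add: \<delta>_def field_simps)
  have inner: "ball a \<delta> \<subseteq> cball 0 (norm a + \<delta>)"
  proof
    fix z assume "z \<in> ball a \<delta>"
    then show "z \<in> cball 0 (norm a + \<delta>)"
      using norm_triangle_sub[of z a] by (simp add: dist_norm norm_minus_commute)
  qed
  have \<delta>: "\<delta> > 0" "ball a \<delta> \<subseteq> ball 0 1" "uniform_limit (ball a \<delta>) f g sequentially"
    using a s inner uniform_limit_on_subset[OF lim[OF s] inner] by (auto simp: \<delta>_def)
  let ?S = "ball a (\<delta>/2)"
  have S: "?S \<subseteq> ball a \<delta>" using \<delta> by (intro subset_ball) auto
  define D where "D k x = frechet_derivative (f k) (at x)" for k x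
  have D: "(f k has_derivative D k x) (at x)" "D k x (c *s v) = c * D k x v" if "x \<in> ?S" for k x c v
    using Hol_ball_derivative[OF fk] that S \<delta>(2) unfolding D_def by blast+
  have bnd: "cmod (D k x h - D l x h) \<le> e / (\<delta>/3) * norm h"
    if x: "x \<in> ?S" and e: "\<And>y. y \<in> ball a \<delta> \<Longrightarrow> cmod (f k y - f l y) \<le> e" for k l x h e
  proof -
    have sub: "cball x (\<delta>/3) \<subseteq> ball a \<delta>"
    proof
      fix y assume "y \<in> cball x (\<delta>/3)"
      then show "y \<in> ball a \<delta>" using x \<delta>(1) dist_triangle[of a y x] by (simp add: dist_commute)
    qed
    have "(\<lambda>h. D k x h - D l x h) = frechet_derivative (\<lambda>x. f k x - f l x) (at x)"
      by (rule frechet_derivative_at) (intro has_derivative_diff D x)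
    moreover have "cmod (frechet_derivative (\<lambda>x. f k x - f l x) (at x) h) \<le> e / (\<delta>/3) * norm h"
      by (rule Hol_ball_deriv_bound) (use fk sub \<delta> e in \<open>auto intro!: Hol_ball_diff\<close>)
    ultimately show ?thesis by (metis (no_types))
  qed
  have cau: "\<exists>K. \<forall>k\<ge>K. \<forall>l\<ge>K. \<forall>x\<in>?S. \<forall>h. cmod (D k x h - D l x h) \<le> e * norm h" if "e > 0" for e
  proof -
    have "0 < e * \<delta> / 6" using that \<delta> by simp
    then have "\<forall>\<^sub>F n in sequentially. \<forall>y\<in>ball a \<delta>. dist (f n y) (g y) < e * \<delta> / 6"
      using \<delta>(3) unfolding uniform_limit_iff by blast
    then obtain K where K: "\<And>n y. n \<ge> K \<Longrightarrow> y \<in> ball a \<delta> \<Longrightarrow> dist (f n y) (g y) < e * \<delta> / 6"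
      unfolding eventually_sequentially by blast
    have "cmod (D k x h - D l x h) \<le> e * norm h" if kl: "k \<ge> K" "l \<ge> K" and x: "x \<in> ?S" for k l x h
    proof -
      have "cmod (f k y - f l y) \<le> e * \<delta> / 3" if "y \<in> ball a \<delta>" for y
        using K[OF kl(1) that] K[OF kl(2) that] dist_triangle2[of "f k y" "f l y" "g y"]
        by (simp add: dist_norm)
      from bnd[OF x this] show ?thesis using \<delta> by simp
    qed
    then show ?thesis by blast
  qed
  define E where "E x h = lim (\<lambda>k. D k x h)" for x h
  have E: "(\<lambda>k. D k x h) \<longlonglongrightarrow> E x h" if x: "x \<in> ?S" for x h
  proof -
    have "Cauchy (\<lambda>k. D k x h)"
    proof (rule metric_CauchyI)
      fix e :: real assume e: "e > 0"
      define e' where "e' = e / (norm h + 1)"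
      have e': "e' > 0" using e by (simp add: e'_def add_nonneg_pos)
      have "norm h + 1 > 0" by (simp add: add_nonneg_pos)
      then have "e' * norm h < e" using e by (simp add: e'_def pos_divide_less_eq)
      with cau[OF e'] x show "\<exists>M. \<forall>m\<ge>M. \<forall>n\<ge>M. dist (D m x h) (D n x h) < e"
        unfolding dist_norm by (meson le_less_trans)
    qed
    then show ?thesis unfolding E_def by (simp add: Cauchy_convergent_iff convergent_LIMSEQ_iff)
  qed
  have unif: "\<forall>\<^sub>F k in sequentially. \<forall>x\<in>?S. \<forall>h. cmod (D k x h - E x h) \<le> e * norm h" if e: "e > 0" for e
  proof -
    obtain K where K: "\<And>k l x h. k\<ge>K \<Longrightarrow> l\<ge>K \<Longrightarrow> x\<in>?S \<Longrightarrow> cmod (D k x h - D l x h) \<le> e * norm h"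
      using cau[OF e] by blast
    have "cmod (D k x h - E x h) \<le> e * norm h" if "k \<ge> K" "x \<in> ?S" for k x h
    proof (rule LIMSEQ_le_const2)
      show "(\<lambda>l. cmod (D k x h - D l x h)) \<longlonglongrightarrow> cmod (D k x h - E x h)"
        by (intro tendsto_intros E that)
    qed (use K[OF that(1) _ that(2)] in blast)
    then show ?thesis unfolding eventually_sequentially by blast
  qed
  have aS: "a \<in> ?S" using \<delta> by simp
  have ptw: "(\<lambda>k. f k x) \<longlonglongrightarrow> g x" if "x \<in> ?S" for x
    by (rule tendsto_uniform_limitI[OF \<delta>(3)]) (use that S in blast)
  have "\<exists>g'. \<forall>x\<in>?S. (\<lambda>n. f n x) \<longlonglongrightarrow> g' x \<and> (g' has_derivative E x) (at x within ?S)"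
  proof (rule has_derivative_sequence[where f' = D and g' = E])
    show "(f k has_derivative D k x) (at x within ?S)" if "x \<in> ?S" for k x
      using D(1)[OF that] by (rule has_derivative_at_withinI)
    show "a \<in> ?S" by (rule aS)
    show "(\<lambda>k. f k a) \<longlonglongrightarrow> g a" by (rule ptw[OF aS])
  qed (use unif in simp_all)
  then obtain g' where g'0: "\<forall>x\<in>?S. (\<lambda>n. f n x) \<longlonglongrightarrow> g' x \<and> (g' has_derivative E x) (at x within ?S)" ..
  have g': "(\<lambda>n. f n x) \<longlonglongrightarrow> g' x" "(g' has_derivative E x) (at x within ?S)" if "x \<in> ?S" for x
    using g'0 that by simp_all
  have eq: "g' x = g x" if "x \<in> ?S" for x using LIMSEQ_unique[OF g'(1)[OF that] ptw[OF that]] .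
  have "(g' has_derivative E a) (at a)" using g'(2)[OF aS] by (simp only: at_within_open[OF aS open_ball])
  then have "(g has_derivative E a) (at a)"
    by (rule has_derivative_transform_within_open[OF _ open_ball aS eq])
  moreover have "E a (c *s v) = c * E a v" for c v
  proof (rule LIMSEQ_unique[OF E[OF aS]])
    show "(\<lambda>k. D k a (c *s v)) \<longlonglongrightarrow> c * E a v"
      unfolding D(2)[OF aS] by (intro tendsto_intros E aS)
  qed
  ultimately show ?thesis by blast
  qed
  then show ?thesis unfolding Hol_ball_def by blast
qed


section \<open>Homogeneous expansions\<close>

text \<open>The Taylor coefficient of the slice \<open>t \<mapsto> f (t z)\<close> at 0. As a function of \<open>z\<close> this is the homogeneous part of
  degree \<open>n\<close> of \<open>f\<close>.\<close>

definition hcoef :: "nat \<Rightarrow> (complex^'n \<Rightarrow> complex) \<Rightarrow> complex^'n \<Rightarrow> complex" where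
  "hcoef n f z = (deriv ^^ n) (\<lambda>t. f (t *s z)) 0 / fact n"

lemma hcoef_sums:
  assumes "f \<in> Hol_ball" "norm z \<le> 1" "cmod t < 1"
  shows "(\<lambda>n. hcoef n f z * t ^ n) sums f (t *s z)"
proof -
  have "(\<lambda>t. f (t *s z)) holomorphic_on ball 0 1"
    by (rule Hol_ball_radial_holomorphic) (use assms in auto)
  from holomorphic_power_series[OF this, of t] assms(3) show ?thesis
    by (simp add: hcoef_def)
qed

lemma hcoef_sums_1:
  assumes "f \<in> Hol_ball" "z \<in> ball 0 1"
  shows "(\<lambda>n. hcoef n f z) sums f z"
proof -
  define R where "R = (if z = 0 then 2 else 1 / norm z)"
  have R: "norm z * R \<le> 1" "R > 1" using assms by (auto simp: R_def field_simps)
  have "(\<lambda>t. f (t *s z)) holomorphic_on ball 0 R"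
    by (rule Hol_ball_radial_holomorphic) (use assms R in auto)
  from holomorphic_power_series[OF this, of 1] R(2) show ?thesis
    by (simp add: hcoef_def)
qed

lemma hcoef_unique:
  assumes "\<And>t. cmod t < 1 \<Longrightarrow> (\<lambda>n. c n * t ^ n) sums f (t *s z)"
  shows "hcoef n f z = c n"
proof -
  have "(\<lambda>t. f (t *s z)) has_fps_expansion Abs_fps c"
  proof (rule has_fps_expansionI)
    have "\<forall>\<^sub>F t in nhds (0::complex). t \<in> ball 0 1"
      by (rule eventually_nhds_in_open) auto
    then show "\<forall>\<^sub>F t in nhds 0. (\<lambda>n. fps_nth (Abs_fps c) n * t ^ n) sums f (t *s z)"
      by eventually_elim (simp add: assms)
  qed
  from fps_nth_fps_expansion[OF this, of n] show ?thesis by (simp add: hcoef_def)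
qed

lemma hcoef_smult:
  assumes "f \<in> Hol_ball" "norm z \<le> 1" "cmod c \<le> 1"
  shows "hcoef n f (c *s z) = c ^ n * hcoef n f z"
proof (rule hcoef_unique)
  fix t :: complex assume t: "cmod t < 1"
  have "cmod (t * c) < 1"
    unfolding norm_mult using mult_mono[of "cmod t" "cmod t" "cmod c" 1] t assms(3) by simp
  from hcoef_sums[OF assms(1,2) this]
  show "(\<lambda>n. c ^ n * hcoef n f z * t ^ n) sums f (t *s (c *s z))"
    by (simp add: power_mult_distrib mult_ac)
qed

lemma hcoef_add:
  assumes "f \<in> Hol_ball" "g \<in> Hol_ball" "norm z \<le> 1"
  shows "hcoef n (\<lambda>z. f z + g z) z = hcoef n f z + hcoef n g z"
  by (rule hcoef_unique) (use assms in \<open>simp add: distrib_right sums_add hcoef_sums\<close>)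

lemma hcoef_cmult:
  assumes "f \<in> Hol_ball" "norm z \<le> 1"
  shows "hcoef n (\<lambda>z. c * f z) z = c * hcoef n f z"
  by (rule hcoef_unique) (use assms in \<open>simp add: mult.assoc sums_mult hcoef_sums\<close>)

lemma hcoef_diff:
  assumes "f \<in> Hol_ball" "g \<in> Hol_ball" "norm z \<le> 1"
  shows "hcoef n (\<lambda>z. f z - g z) z = hcoef n f z - hcoef n g z"
  by (rule hcoef_unique) (use assms in \<open>simp add: left_diff_distrib sums_diff hcoef_sums\<close>)

lemma hcoef_cong:
  assumes "f \<in> Hol_ball" "\<And>z. z \<in> ball 0 1 \<Longrightarrow> g z = f z" "norm z \<le> 1"
  shows "hcoef n g z = hcoef n f z"
proof (rule hcoef_unique)
  fix t :: complex assume t: "cmod t < 1"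
  have "cmod t * norm z < 1"
    using mult_mono[of "cmod t" "cmod t" "norm z" 1] t assms(3) by simp
  then have "g (t *s z) = f (t *s z)" by (intro assms) (simp add: norm_vector_smult_complex)
  then show "(\<lambda>n. hcoef n f z * t ^ n) sums g (t *s z)"
    using hcoef_sums[OF assms(1,3) t] by simp
qed

lemma hcoef_const:
  "hcoef n (\<lambda>z. c) (z :: complex^'n) = (if n = 0 then c else 0)"
proof (rule hcoef_unique)
  show "(\<lambda>n. (if n = 0 then c else 0) * t ^ n) sums c" for t :: complex
    using sums_single[of 0 "\<lambda>n. c * t ^ n"] by (simp add: if_distrib[of "\<lambda>x. x * _"] cong: if_cong)
qed

lemma hcoef_0: "hcoef 0 f (z :: complex^'n) = f 0"
  by (simp add: hcoef_def)

lemma hcoef_bound: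
  assumes f: "f \<in> Hol_ball" and M: "\<And>x. norm x \<le> s \<Longrightarrow> cmod (f x) \<le> M"
    and r: "0 < r" "norm z * r \<le> s" "s < 1"
  shows "cmod (hcoef n f z) \<le> M / r ^ n"
proof -
  let ?g = "\<lambda>t. f (t *s z)"
  have mem: "norm (t *s z) \<le> s" if "cmod t \<le> r" for t
  proof -
    have "cmod t * norm z \<le> r * norm z" by (rule mult_right_mono) (use that in auto)
    then show ?thesis using r by (simp add: norm_vector_smult_complex mult.commute)
  qed
  have hol: "?g holomorphic_on cball 0 r"
    using Hol_ball_slice_holomorphic[OF f, of "cball 0 r" 0 z] mem r(3) by force
  have "cmod ((deriv ^^ n) ?g 0) \<le> fact n * M / r ^ n"
  proof (rule Cauchy_inequality[OF _ _ r(1)])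
    show "?g holomorphic_on ball 0 r" using hol by (rule holomorphic_on_subset) auto
    show "continuous_on (cball 0 r) ?g" using hol by (rule holomorphic_on_imp_continuous_on)
    show "cmod (?g t) \<le> M" if "cmod (0 - t) = r" for t
      by (rule M, rule mem) (use that in simp)
  qed
  then show ?thesis by (simp add: hcoef_def norm_divide field_simps)
qed

lemma Hol_ball_bounded_cball:
  assumes "f \<in> Hol_ball" "s < 1"
  obtains M where "M \<ge> 0" "\<And>x. norm x \<le> s \<Longrightarrow> cmod (f x) \<le> M"
proof -
  have "continuous_on (cball 0 s) f"
    by (rule continuous_on_subset[OF Hol_ball_continuous_on[OF assms(1)]]) (use assms in auto)
  then have "compact (f ` cball 0 s)" by (rule compact_continuous_image) simp
  then obtain M where M: "\<forall>y \<in> f ` cball 0 s. norm y \<le> M"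
    using compact_imp_bounded bounded_iff by metis
  show thesis
  proof (rule that[of "max M 0"])
    show "cmod (f x) \<le> max M 0" if "norm x \<le> s" for x
      using M that by (simp add: le_max_iff_disj)
  qed simp
qed

text \<open>For \<open>\<parallel>z\<parallel> \<le> s < 1\<close> the slices extend to a common disc of radius greater than 1, on which Cauchy's estimate is uniform.\<close>

lemma hcoef_geometric_bound:
  fixes f :: "complex^'n \<Rightarrow> complex"
  assumes "f \<in> Hol_ball" "s < 1"
  obtains M q where "M \<ge> 0" "0 < q" "q < 1" "\<And>z n. norm z \<le> s \<Longrightarrow> cmod (hcoef n f z) \<le> M * q ^ n"
proof -
  define s' where "s' = max s (1/2)"
  define q where "q = sqrt s'"
  have s': "0 < s'" "s' < 1" "s \<le> s'" using assms by (auto simp: s'_def)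
  have q: "0 < q" "q < 1" "q * q = s'" using s' by (auto simp: q_def)
  obtain M where M: "M \<ge> 0" "\<And>x. norm x \<le> q \<Longrightarrow> cmod (f x) \<le> M"
    using Hol_ball_bounded_cball[OF assms(1) q(2)] by metis
  show thesis
  proof (rule that[OF M(1) q(1,2)])
    fix z :: "complex^'n" and n assume z: "norm z \<le> s"
    have "norm z * (1 / q) \<le> q" using z s' q by (simp add: pos_divide_le_eq)
    from hcoef_bound[OF assms(1) M(2) _ this q(2), of n] q(1)
    show "cmod (hcoef n f z) \<le> M * q ^ n" by (simp add: power_divide)
  qed
qed

text \<open>The part of degree \<open>n\<close> is the limit, for \<open>t \<longlonglongrightarrow> 0\<close>, of \<open>t\<^sup>-\<^sup>n\<close> times what remains of \<open>f (t z)\<close> after subtracting the parts of lower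
  degree, and the limit is locally uniform. Thus the differentiability in all variables is inherited from \<open>f\<close>.\<close>

lemma hcoef_Hol_ball:
  fixes f :: "complex^'n \<Rightarrow> complex"
  assumes f: "f \<in> Hol_ball"
  shows "hcoef n f \<in> Hol_ball"
proof (induction n rule: less_induct)
  case (less n)
  define t where "t k = (1 / (real k + 2))" for k
  have t: "0 < t k" "t k \<le> 1/2" for k by (auto simp: t_def field_simps)
  define g where "g k z = (1 / of_real (t k)) ^ n * (f (of_real (t k) *s z) - (\<Sum>j<n. of_real (t k) ^ j * hcoef j f z))"
    for k z
  show ?case
  proof (rule Hol_ball_uniform_limit[where f = g])
    show "g k \<in> Hol_ball" for k
      unfolding g_def using t[of k]
      by (intro Hol_ball_cmult Hol_ball_diff Hol_ball_sum Hol_ball_dilate f less) auto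
  next
    fix s :: real assume s: "s < 1"
    obtain M q where M: "M \<ge> 0" "0 < q" "q < 1" "\<And>z n. norm z \<le> s \<Longrightarrow> cmod (hcoef n f z) \<le> M * q ^ n"
      using hcoef_geometric_bound[OF f s] by metis
    have est: "cmod (g k z - hcoef n f z) \<le> 2 * M * t k" if z: "norm z \<le> s" for k z
    proof -
      have z1: "norm z \<le> 1" using z s by simp
      have "(\<lambda>m. hcoef m f z * of_real (t k) ^ m) sums f (of_real (t k) *s z)"
        by (rule hcoef_sums[OF f z1]) (use t[of k] in auto)
      then have "(\<lambda>m. hcoef (m + Suc n) f z * of_real (t k) ^ (m + Suc n)) sums
          (f (of_real (t k) *s z) - (\<Sum>j<Suc n. hcoef j f z * of_real (t k) ^ j))"
        by (rule sums_split_initial_segment)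
      then have "(\<lambda>m. (1 / of_real (t k)) ^ n * (hcoef (m + Suc n) f z * of_real (t k) ^ (m + Suc n))) sums
          ((1 / of_real (t k)) ^ n * (f (of_real (t k) *s z) - (\<Sum>j<Suc n. hcoef j f z * of_real (t k) ^ j)))"
        by (rule sums_mult)
      moreover have "(1 / of_real (t k)) ^ n * (hcoef (m + Suc n) f z * of_real (t k) ^ (m + Suc n))
          = of_real (t k) * (hcoef (m + Suc n) f z * of_real (t k) ^ m)" for m
        using t(1)[of k] by (simp add: power_add power_divide)
      moreover have "(1 / of_real (t k)) ^ n * (f (of_real (t k) *s z) - (\<Sum>j<Suc n. hcoef j f z * of_real (t k) ^ j))
          = g k z - hcoef n f z"
        using t(1)[of k] by (simp add: g_def power_divide field_simps)
      ultimately have sums: "(\<lambda>m. of_real (t k) * (hcoef (m + Suc n) f z * of_real (t k) ^ m)) sums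
          (g k z - hcoef n f z)"
        by (simp only:)
      have trm: "cmod (of_real (t k) * (hcoef (m + Suc n) f z * of_real (t k) ^ m)) \<le> t k * M * (1/2) ^ m" for m
      proof -
        have "cmod (hcoef (m + Suc n) f z) \<le> M * q ^ (m + Suc n)" by (rule M(4)[OF z])
        also have "\<dots> \<le> M * 1" by (intro mult_left_mono power_le_one) (use M in auto)
        finally have "cmod (hcoef (m + Suc n) f z) \<le> M" by simp
        moreover have "t k ^ m \<le> (1/2) ^ m" by (rule power_mono) (use t[of k] in auto)
        ultimately have "cmod (hcoef (m + Suc n) f z) * t k ^ m \<le> M * (1/2) ^ m"
          using t[of k] M by (intro mult_mono) auto
        then have "t k * (cmod (hcoef (m + Suc n) f z) * t k ^ m) \<le> t k * (M * (1/2) ^ m)"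
          using t[of k] by (intro mult_left_mono) auto
        then show ?thesis using t[of k] by (simp add: norm_mult norm_power mult.assoc)
      qed
      have gs: "(\<lambda>m. t k * M * (1/2) ^ m) sums (t k * M * 2)"
        using sums_mult[OF geometric_sums[of "1/2 :: real"], of "t k * M"] by simp
      have "cmod (g k z - hcoef n f z) \<le> (\<Sum>m. t k * M * (1/2) ^ m)"
        unfolding sums_unique[OF sums]
        by (rule norm_suminf_le[OF trm sums_summable[OF gs]])
      also have "\<dots> = t k * M * 2" using gs by (rule sums_unique[symmetric])
      finally show ?thesis by (simp add: mult_ac)
    qed
    have lim: "(\<lambda>k. 2 * M * t k) \<longlonglongrightarrow> 0"
      unfolding t_def by real_asymp
    show "uniform_limit (cball 0 s) g (hcoef n f) sequentially"
    proof (rule uniform_limitI)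
      fix e :: real assume "e > 0"
      with lim have "\<forall>\<^sub>F k in sequentially. 2 * M * t k < e"
        by (auto simp: tendsto_iff dist_norm elim!: eventually_mono)
      then show "\<forall>\<^sub>F k in sequentially. \<forall>z\<in>cball 0 s. dist (g k z) (hcoef n f z) < e"
      proof eventually_elim
        case (elim k)
        show ?case
        proof
          fix z :: "complex^'n" assume "z \<in> cball 0 s"
          then show "dist (g k z) (hcoef n f z) < e" using est[of z k] elim by (simp add: dist_norm)
        qed
      qed
    qed
  qed
qed

lemma radial_deriv_eq:
  assumes f: "f \<in> Hol_ball" and z: "z \<in> ball 0 1"
  shows "radial_deriv f z = frechet_derivative f (at z) z"
proof -
  let ?D = "frechet_derivative f (at z)"
  have "partial_deriv j f z = ?D (axis j 1)" for j
  proof -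
    have eq: "(\<chi> i. if i = j then w else z $ i) = (z - (z $ j) *s axis j 1) + w *s axis j 1" for w
      by (simp add: vec_eq_iff axis_def)
    show ?thesis unfolding partial_deriv_def eq
      by (rule DERIV_imp_deriv, rule has_field_derivative_slice[OF f z]) simp
  qed
  then have "radial_deriv f z = (\<Sum>j\<in>UNIV. ?D (z $ j *s axis j 1))"
    by (simp add: radial_deriv_def Hol_ball_derivative(2)[OF f z])
  also have "\<dots> = ?D (\<Sum>j\<in>UNIV. z $ j *s axis j 1)"
    using has_derivative_bounded_linear[OF Hol_ball_derivative(1)[OF f z]]
    by (intro linear_sum[symmetric] bounded_linear.linear)
  finally show ?thesis by (simp add: basis_expansion)
qed

lemma radial_deriv_slice:
  assumes "f \<in> Hol_ball" "z \<in> ball 0 1"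
  shows "((\<lambda>t. f (t *s z)) has_field_derivative radial_deriv f z) (at 1)"
  using has_field_derivative_slice[OF assms, of 0 1 z] by (simp add: radial_deriv_eq[OF assms])

lemma radial_deriv_sums:
  assumes "f \<in> Hol_ball" "z \<in> ball 0 1"
  shows "(\<lambda>n. of_nat n * hcoef n f z) sums radial_deriv f z"
proof -
  let ?c = "\<lambda>n. hcoef n f z"
  define R where "R = (if z = 0 then 2 else 1 / norm z)"
  have R: "norm z * R \<le> 1" "R > 1" using assms by (auto simp: R_def field_simps)
  have hol: "(\<lambda>t. f (t *s z)) holomorphic_on ball 0 R"
    by (rule Hol_ball_radial_holomorphic) (use assms R in auto)
  have sums: "(\<lambda>n. ?c n * t ^ n) sums f (t *s z)" if "cmod t < R" for t
    using holomorphic_power_series[OF hol, of t] that by (simp add: hcoef_def)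
  define K where "K = (1 + R) / 2"
  have K: "1 < K" "K < R" using R by (auto simp: K_def)
  have sK: "summable (\<lambda>n. ?c n * of_real K ^ n)"
    using sums[of "of_real K"] K by (intro sums_summable) auto
  have "DERIV (\<lambda>t. \<Sum>n. ?c n * t ^ n) 1 :> (\<Sum>n. diffs ?c n * 1 ^ n)"
    by (rule termdiffs_strong[OF sK]) (use K in auto)
  then have "((\<lambda>t. f (t *s z)) has_field_derivative (\<Sum>n. diffs ?c n * 1 ^ n)) (at 1)"
    by (rule has_field_derivative_transform_within_open[where S = "ball 0 R"])
      (use R(2) sums in \<open>auto simp: sums_iff\<close>)
  then have "((\<lambda>t. f (t *s z)) has_field_derivative (\<Sum>n. diffs ?c n)) (at 1)"
    by simp
  from DERIV_unique[OF this radial_deriv_slice[OF assms]]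
  have eq: "(\<Sum>n. diffs ?c n) = radial_deriv f z" .
  have "summable (\<lambda>n. diffs ?c n * 1 ^ n)"
    by (rule termdiff_converges[where K = K]) (use K sums in \<open>auto simp: sums_iff\<close>)
  then have "(\<lambda>n. diffs ?c n) sums radial_deriv f z"
    using eq by (simp add: sums_iff)
  then have "(\<lambda>n. of_nat (Suc n) * hcoef (Suc n) f z) sums radial_deriv f z"
    by (simp add: diffs_def)
  then show ?thesis by (subst (asm) sums_Suc_iff) simp
qed

text \<open>The series \<open>\<Sum>n. n f\<^sub>n\<close> of the homogeneous parts converges locally uniformly. This makes iterates of the radial derivative
  meaningful, which is not clear from its definition by partial derivatives.\<close>

lemma radial_deriv_Hol_ball:
  assumes f: "f \<in> Hol_ball"
  shows "radial_deriv f \<in> Hol_ball"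
proof (rule Hol_ball_uniform_limit[where f = "\<lambda>k z. \<Sum>n<k. of_nat n * hcoef n f z"])
  show "(\<lambda>z. \<Sum>n<k. of_nat n * hcoef n f z) \<in> Hol_ball" for k
    by (intro Hol_ball_sum Hol_ball_cmult hcoef_Hol_ball f)
next
  fix s :: real assume s: "s < 1"
  obtain M q where M: "M \<ge> 0" "0 < q" "q < 1" "\<And>z n. norm z \<le> s \<Longrightarrow> cmod (hcoef n f z) \<le> M * q ^ n"
    using hcoef_geometric_bound[OF f s] by metis
  have "uniform_limit (cball 0 s) (\<lambda>k z. \<Sum>n<k. of_nat n * hcoef n f z)
      (\<lambda>z. \<Sum>n. of_nat n * hcoef n f z) sequentially"
  proof (rule Weierstrass_m_test[where M = "\<lambda>n. M * (of_nat n * q ^ n)"])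
    show "cmod (of_nat n * hcoef n f z) \<le> M * (of_nat n * q ^ n)" if "z \<in> cball 0 s" for n z
      using mult_left_mono[OF M(4)[of z n], of "of_nat n"] that by (simp add: norm_mult mult_ac)
    have "summable (\<lambda>n. of_nat n * q ^ n)"
    proof (rule summable_comparison_test')
      show "summable (\<lambda>n. of_nat (Suc n) * q ^ n)"
        using M(2,3) by (intro sums_summable[OF geometric_deriv_sums]) auto
      show "norm (of_nat n * q ^ n) \<le> of_nat (Suc n) * q ^ n" for n
        using M(2) by (auto intro!: mult_right_mono)
    qed
    then show "summable (\<lambda>n. M * (of_nat n * q ^ n))" by (rule summable_mult)
  qed
  moreover have "(\<Sum>n. of_nat n * hcoef n f z) = radial_deriv f z" if "z \<in> cball 0 s" for z
    by (rule sums_unique[symmetric], rule radial_deriv_sums[OF f]) (use that s in auto)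
  ultimately show "uniform_limit (cball 0 s) (\<lambda>k z. \<Sum>n<k. of_nat n * hcoef n f z) (radial_deriv f) sequentially"
    by (metis (no_types, lifting) uniform_limit_cong')
qed

lemma hcoef_radial_deriv:
  assumes f: "f \<in> Hol_ball" and z: "norm z \<le> 1"
  shows "hcoef n (radial_deriv f) z = of_nat n * hcoef n f z"
proof (rule hcoef_unique)
  fix t :: complex assume t: "cmod t < 1"
  have "cmod t * norm z < 1"
    using mult_mono[of "cmod t" "cmod t" "norm z" 1] t z by simp
  then have "t *s z \<in> ball 0 1" by (simp add: norm_vector_smult_complex)
  from radial_deriv_sums[OF f this]
  show "(\<lambda>n. of_nat n * hcoef n f z * t ^ n) sums radial_deriv f (t *s z)"
    using t by (simp add: hcoef_smult[OF f z] mult_ac)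
qed

lemma radial_deriv_iter_Hol_ball:
  assumes f: "f \<in> Hol_ball"
  shows "(radial_deriv ^^ k) f \<in> Hol_ball"
  by (induction k) (auto intro: f radial_deriv_Hol_ball)

lemma hcoef_radial_deriv_iter:
  assumes f: "f \<in> Hol_ball" and z: "norm z \<le> 1"
  shows "hcoef n ((radial_deriv ^^ k) f) z = of_nat n ^ k * hcoef n f z"
  by (induction k) (use f z in \<open>simp_all add: hcoef_radial_deriv radial_deriv_iter_Hol_ball\<close>)

section \<open>The radial derivative as a derivation\<close>

lemma radial_deriv_cong:
  assumes "f \<in> Hol_ball" "\<And>z. z \<in> ball 0 1 \<Longrightarrow> g z = f z" "z \<in> ball 0 1"
  shows "radial_deriv g z = radial_deriv f z"
proof -
  have g: "g \<in> Hol_ball" by (rule Hol_ball_cong[OF assms(1,2)])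
  have z: "norm z \<le> 1" using assms(3) by simp
  from radial_deriv_sums[OF g assms(3)] radial_deriv_sums[OF assms(1,3)]
  show ?thesis using hcoef_cong[OF assms(1,2) z] by (simp add: sums_iff)
qed

lemma radial_deriv_mult:
  assumes "f \<in> Hol_ball" "g \<in> Hol_ball" "z \<in> ball 0 1"
  shows "radial_deriv (\<lambda>z. f z * g z) z = radial_deriv f z * g z + f z * radial_deriv g z"
proof -
  have "((\<lambda>t. f (t *s z) * g (t *s z)) has_field_derivative
      radial_deriv f z * g z + f z * radial_deriv g z) (at 1)"
    using DERIV_mult[OF radial_deriv_slice[OF assms(1,3)] radial_deriv_slice[OF assms(2,3)]]
    by (simp add: mult_ac add_ac)
  from DERIV_unique[OF radial_deriv_slice[OF Hol_ball_mult[OF assms(1,2)] assms(3)] this]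
  show ?thesis .
qed

lemma radial_deriv_add:
  assumes "f \<in> Hol_ball" "g \<in> Hol_ball" "z \<in> ball 0 1"
  shows "radial_deriv (\<lambda>z. f z + g z) z = radial_deriv f z + radial_deriv g z"
  by (rule DERIV_unique[OF radial_deriv_slice[OF Hol_ball_add[OF assms(1,2)] assms(3)]])
    (rule DERIV_add[OF radial_deriv_slice[OF assms(1,3)] radial_deriv_slice[OF assms(2,3)]])

lemma radial_deriv_cmult:
  assumes "f \<in> Hol_ball" "z \<in> ball 0 1"
  shows "radial_deriv (\<lambda>z. c * f z) z = c * radial_deriv f z"
  by (rule DERIV_unique[OF radial_deriv_slice[OF Hol_ball_cmult[OF assms(1)] assms(2)]])
    (rule DERIV_cmult[OF radial_deriv_slice[OF assms]])

lemma radial_deriv_iter_cong: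
  assumes "f \<in> Hol_ball" "\<And>z. z \<in> ball 0 1 \<Longrightarrow> g z = f z" "z \<in> ball 0 1"
  shows "(radial_deriv ^^ k) g z = (radial_deriv ^^ k) f z"
  using assms(3)
proof (induction k arbitrary: z)
  case (Suc k)
  show ?case
    using radial_deriv_cong[OF radial_deriv_iter_Hol_ball[OF assms(1)] Suc.IH Suc.prems] by simp
qed (use assms in auto)

lemma radial_deriv_iter_add:
  assumes "f \<in> Hol_ball" "g \<in> Hol_ball" "z \<in> ball 0 1"
  shows "(radial_deriv ^^ k) (\<lambda>z. f z + g z) z = (radial_deriv ^^ k) f z + (radial_deriv ^^ k) g z"
  using assms(3)
proof (induction k arbitrary: z)
  case (Suc k)
  note h = radial_deriv_iter_Hol_ball[OF assms(1), of k] radial_deriv_iter_Hol_ball[OF assms(2), of k]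
  show ?case
    using radial_deriv_cong[OF Hol_ball_add[OF h] Suc.IH Suc.prems] radial_deriv_add[OF h Suc.prems]
    by simp
qed auto

lemma radial_deriv_iter_cmult:
  assumes "f \<in> Hol_ball" "z \<in> ball 0 1"
  shows "(radial_deriv ^^ k) (\<lambda>z. c * f z) z = c * (radial_deriv ^^ k) f z"
  using assms(2)
proof (induction k arbitrary: z)
  case (Suc k)
  note h = radial_deriv_iter_Hol_ball[OF assms(1), of k]
  show ?case
    using radial_deriv_cong[OF Hol_ball_cmult[OF h] Suc.IH Suc.prems] radial_deriv_cmult[OF h Suc.prems]
    by simp
qed auto

lemma radial_deriv_iter_sum:
  fixes f :: "'i \<Rightarrow> complex^'n \<Rightarrow> complex"
  assumes "\<And>i. i \<in> I \<Longrightarrow> f i \<in> Hol_ball" "z \<in> ball 0 1"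
  shows "(radial_deriv ^^ k) (\<lambda>z. \<Sum>i\<in>I. f i z) z = (\<Sum>i\<in>I. (radial_deriv ^^ k) (f i) z)"
proof -
  have zero: "(radial_deriv ^^ k) (\<lambda>z. 0) z = 0"
    using radial_deriv_iter_cmult[OF Hol_ball_const[of 0] assms(2), of k 0] by simp
  show ?thesis using assms(1)
  proof (induction I rule: infinite_finite_induct)
    case (insert i I)
    then show ?case by (simp add: radial_deriv_iter_add[OF _ Hol_ball_sum assms(2)])
  qed (use zero in simp_all)
qed

text \<open>By the product rule each derivative removes at most one of the factors \<open>u\<close>, so that after \<open>k < m\<close> derivatives at least
  one of them is left.\<close>

lemma radial_deriv_iter_vanish:
  fixes u g :: "complex^'n \<Rightarrow> complex"
  assumes "u \<in> Hol_ball" "g \<in> Hol_ball" "z \<in> ball 0 1" "u z = 0" "k < m"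
  shows "(radial_deriv ^^ k) (\<lambda>z. u z ^ m * g z) z = 0"
  using assms(2,5)
proof (induction k arbitrary: m g)
  case (Suc k)
  define G where "G w = of_nat m * (radial_deriv u w * g w) + u w * radial_deriv g w" for w
  obtain m' where m: "m = Suc m'" "k < m'" using Suc.prems by (cases m) auto
  have G: "G \<in> Hol_ball" unfolding G_def
    by (intro Hol_ball_add Hol_ball_mult Hol_ball_const radial_deriv_Hol_ball assms Suc)
  have pow: "radial_deriv (\<lambda>z. u z ^ Suc j) w = of_nat (Suc j) * u w ^ j * radial_deriv u w"
    if "w \<in> ball 0 1" for w j
  proof (rule DERIV_unique[OF radial_deriv_slice[OF Hol_ball_power[OF assms(1)] that]])
    show "((\<lambda>t. u (t *s w) ^ Suc j) has_field_derivative of_nat (Suc j) * u w ^ j * radial_deriv u w) (at 1)"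
      using DERIV_power[OF radial_deriv_slice[OF assms(1) that], of "Suc j"] by (simp add: mult_ac)
  qed
  have "radial_deriv (\<lambda>z. u z ^ m * g z) w = u w ^ m' * G w" if w: "w \<in> ball 0 1" for w
    using pow[OF w, of m'] radial_deriv_mult[OF Hol_ball_power[OF assms(1), of m] Suc.prems(1) w]
    by (simp add: m G_def algebra_simps)
  from radial_deriv_iter_cong[OF _ this assms(3), where k = k] Suc.IH[OF G m(2)]
  have "(radial_deriv ^^ k) (radial_deriv (\<lambda>z. u z ^ m * g z)) z = 0"
    using Hol_ball_mult[OF Hol_ball_power[OF assms(1)] G] by simp
  then show ?case by (simp only: funpow_Suc_right o_apply)
qed (use assms in auto)

section \<open>Integration over the sphere\<close>

text \<open>The reflection in the hyperplane orthogonal to \<open>a - b\<close> interchanges \<open>a\<close> and \<open>b\<close>.\<close>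

lemma orthogonal_transformation_between:
  fixes a b :: "'a::euclidean_space"
  assumes "norm a = norm b"
  obtains U where "orthogonal_transformation U" "U a = b"
proof (cases "a = b")
  case True
  then show thesis using that[of "\<lambda>x. x"] by (simp add: orthogonal_transformation_id)
next
  case False
  define u where "u = a - b"
  have u: "u \<bullet> u \<noteq> 0" using False by (simp add: u_def)
  define U where "U x = x - (2 * (x \<bullet> u) / (u \<bullet> u)) *\<^sub>R u" for x
  have "linear U"
    by (rule linearI) (simp_all add: U_def inner_add_left algebra_simps add_divide_distrib)
  moreover have "norm (U x) = norm x" for x
  proof -
    have "(U x) \<bullet> (U x) = x \<bullet> x - 2 * (2 * (x \<bullet> u) / (u \<bullet> u)) * (x \<bullet> u)
        + (2 * (x \<bullet> u) / (u \<bullet> u)) * (2 * (x \<bullet> u) / (u \<bullet> u)) * (u \<bullet> u)"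
      by (simp add: U_def inner_diff_left inner_diff_right inner_commute algebra_simps)
    also have "\<dots> = x \<bullet> x" using u by (simp add: field_simps)
    finally show ?thesis by (simp add: norm_eq_sqrt_inner)
  qed
  moreover have "U a = b"
  proof -
    have "a \<bullet> a = b \<bullet> b" using assms by (simp add: norm_eq)
    then have "2 * (a \<bullet> u) = u \<bullet> u"
      by (simp add: u_def inner_diff_left inner_diff_right inner_commute)
    then have "U a = a - u" using u by (simp add: U_def)
    then show ?thesis by (simp add: u_def)
  qed
  ultimately show thesis by (intro that[of U]) (auto simp: orthogonal_transformation)
qed

lemma cnj_measurable [measurable]: "cnj \<in> borel_measurable borel"
  by (intro borel_measurable_continuous_onI continuous_intros)

locale sphere_measure =
  fixes \<sigma> :: "(complex^'n) measure"
  assumes invariant: "rotation_invariant_probability \<sigma>"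
begin

sublocale prob_space \<sigma>
  using invariant by (simp add: rotation_invariant_probability_def)

lemma sets_sphere [measurable_cong]: "sets \<sigma> = sets (restrict_space borel (sphere 0 1))"
  using invariant by (simp add: rotation_invariant_probability_def)

lemma space_sphere: "space \<sigma> = sphere 0 1"
  using sets_eq_imp_space_eq[OF sets_sphere] by (simp add: space_restrict_space)

lemma sphere_setsI: "A \<in> sets borel \<Longrightarrow> sphere 0 1 \<inter> A \<in> sets \<sigma>"
  unfolding sets_sphere by (auto simp: sets_restrict_space)

lemma measurable_continuous_sphere:
  assumes "continuous_on (sphere 0 1) g"
  shows "g \<in> borel_measurable \<sigma>"
  using borel_measurable_continuous_on_restrict[OF assms]
  by (simp add: measurable_cong_sets[OF sets_sphere refl])

lemma orthogonal_measurable: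
  assumes "orthogonal_transformation U"
  shows "U \<in> \<sigma> \<rightarrow>\<^sub>M \<sigma>"
  unfolding measurable_cong_sets[OF sets_sphere sets_sphere]
  using assms orthogonal_transformation_borel[OF assms]
  by (intro measurable_restrict_space2 measurable_restrict_space1)
    (auto simp: orthogonal_transformation space_restrict_space)

lemma integral_orthogonal:
  fixes g :: "complex^'n \<Rightarrow> 'b::{banach, second_countable_topology}"
  assumes U: "orthogonal_transformation U" and g: "g \<in> borel_measurable \<sigma>"
  shows "(\<integral>z. g (U z) \<partial>\<sigma>) = (\<integral>z. g z \<partial>\<sigma>)"
proof -
  have "distr \<sigma> \<sigma> U = \<sigma>" using invariant U by (simp add: rotation_invariant_probability_def)
  then show ?thesis using integral_distr[OF orthogonal_measurable[OF U] g] by simp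
qed

lemma orthogonal_smult:
  assumes "cmod c = 1"
  shows "orthogonal_transformation (\<lambda>z :: complex^'n. c *s z)"
  unfolding orthogonal_transformation using assms
  by (auto simp: norm_vector_smult_complex bounded_linear.linear[OF bounded_linear_smult_right])

lemma continuous_Hol_ball_sphere:
  assumes "f \<in> Hol_ball" "cmod c < 1"
  shows "continuous_on (sphere 0 1) (\<lambda>z. f (c *s z))"
proof (rule continuous_on_compose2[OF Hol_ball_continuous_on[OF assms(1)]])
  show "continuous_on (sphere 0 1) (\<lambda>z. c *s z)"
    by (intro linear_continuous_on bounded_linear_smult_right)
qed (use assms in \<open>auto simp: norm_vector_smult_complex\<close>)

lemma hcoef_half:
  assumes "f \<in> Hol_ball" "norm z \<le> 1"
  shows "hcoef n f z = 2 ^ n * hcoef n f ((1/2) *s z)"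
  unfolding hcoef_smult[OF assms, of "1/2" n, simplified] by (simp add: power_divide)

lemma continuous_hcoef_sphere:
  assumes "f \<in> Hol_ball"
  shows "continuous_on (sphere 0 1) (hcoef n f)"
proof -
  have "continuous_on (sphere 0 1) (\<lambda>z. 2 ^ n * hcoef n f ((1/2) *s z))"
    by (intro continuous_intros continuous_Hol_ball_sphere hcoef_Hol_ball assms) auto
  then show ?thesis
    by (rule continuous_on_eq) (use hcoef_half[OF assms] in auto)
qed

lemma hcoef_measurable:
  assumes "f \<in> Hol_ball"
  shows "hcoef n f \<in> borel_measurable \<sigma>"
  by (rule measurable_continuous_sphere[OF continuous_hcoef_sphere[OF assms]])

lemma hcoef_bounded_sphere:
  assumes "f \<in> Hol_ball"
  obtains B where "B \<ge> 0" "\<And>z. z \<in> sphere 0 1 \<Longrightarrow> cmod (hcoef n f z) \<le> B"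
proof -
  have "compact (hcoef n f ` sphere 0 1)"
    by (rule compact_continuous_image[OF continuous_hcoef_sphere[OF assms] compact_sphere])
  then obtain B where B: "\<forall>y \<in> hcoef n f ` sphere 0 1. norm y \<le> B"
    using compact_imp_bounded bounded_iff by metis
  show thesis
    by (rule that[of "max B 0"]) (use B in \<open>auto simp: le_max_iff_disj\<close>)
qed

lemma integrable_bounded:
  fixes g :: "complex^'n \<Rightarrow> 'b::{banach, second_countable_topology}"
  assumes "g \<in> borel_measurable \<sigma>" "\<And>z. z \<in> sphere 0 1 \<Longrightarrow> norm (g z) \<le> B"
  shows "integrable \<sigma> g"
  by (rule integrable_const_bound[where B = B]) (use assms in \<open>auto simp: space_sphere\<close>)

lemma integrable_hcoef_product:
  assumes f: "f \<in> Hol_ball"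
  shows "integrable \<sigma> (\<lambda>z. hcoef n f z * cnj (hcoef m f z))"
proof -
  obtain B where B: "B \<ge> 0" "\<And>z. z \<in> sphere 0 1 \<Longrightarrow> cmod (hcoef n f z) \<le> B"
    by (rule hcoef_bounded_sphere[OF f]) blast
  obtain C where C: "\<And>z. z \<in> sphere 0 1 \<Longrightarrow> cmod (hcoef m f z) \<le> C"
    by (rule hcoef_bounded_sphere[OF f]) blast
  note [measurable] = hcoef_measurable[OF f]
  show ?thesis
    by (rule integrable_bounded[where B = "B * C"]) (use B C in \<open>auto simp: norm_mult intro!: mult_mono\<close>)
qed

text \<open>The rotation \<open>z \<mapsto> c z\<close> multiplies the integral by \<open>c\<^sup>n\<^sup>-\<^sup>m\<close>, and \<open>c\<close> can be chosen
  such that this factor is \<open>- 1\<close>.\<close>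

lemma hcoef_orthogonal:
  fixes f :: "complex^'n \<Rightarrow> complex"
  assumes f: "f \<in> Hol_ball" and "n \<noteq> m"
  shows "(\<integral>z. hcoef n f z * cnj (hcoef m f z) \<partial>\<sigma>) = 0" (is "?I = 0")
proof -
  define \<theta> where "\<theta> = pi / (real n - real m)"
  define c where "c = cis \<theta>"
  have c: "cmod c = 1" by (simp add: c_def)
  have cc: "c ^ n * cnj c ^ m = -1"
  proof -
    have "c ^ n * cnj c ^ m = cis (real n * \<theta> - real m * \<theta>)"
      by (simp add: c_def Complex.DeMoivre cis_cnj cis_mult)
    also have "real n * \<theta> - real m * \<theta> = (real n - real m) * \<theta>" by (simp add: left_diff_distrib)
    also have "\<dots> = pi" using assms(2) by (simp add: \<theta>_def)
    finally show ?thesis by simp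
  qed
  note [measurable] = hcoef_measurable[OF f]
  have "?I = (\<integral>z. hcoef n f (c *s z) * cnj (hcoef m f (c *s z)) \<partial>\<sigma>)"
    by (rule integral_orthogonal[OF orthogonal_smult[OF c], symmetric]) measurable
  also have "\<dots> = (\<integral>z. (-1) * (hcoef n f z * cnj (hcoef m f z)) \<partial>\<sigma>)"
  proof (rule Bochner_Integration.integral_cong[OF refl])
    fix z assume "z \<in> space \<sigma>"
    then have z: "norm z \<le> 1" by (simp add: space_sphere)
    have "hcoef n f (c *s z) * cnj (hcoef m f (c *s z)) = (c ^ n * cnj c ^ m) * (hcoef n f z * cnj (hcoef m f z))"
      using hcoef_smult[OF f z, of c n] hcoef_smult[OF f z, of c m] c by simp
    then show "hcoef n f (c *s z) * cnj (hcoef m f (c *s z)) = (-1) * (hcoef n f z * cnj (hcoef m f z))"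
      by (simp only: cc)
  qed
  also have "\<dots> = - ?I" by simp
  finally show ?thesis by (simp add: equation_minus_iff)
qed

definition hsq :: "nat \<Rightarrow> (complex^'n \<Rightarrow> complex) \<Rightarrow> real" where
  "hsq n f = (\<integral>z. (cmod (hcoef n f z))\<^sup>2 \<partial>\<sigma>)"

lemma hsq_nonneg: "hsq n f \<ge> 0"
  by (simp add: hsq_def)

lemma integrable_hcoef_square:
  assumes f: "f \<in> Hol_ball"
  shows "integrable \<sigma> (\<lambda>z. (cmod (hcoef n f z))\<^sup>2)"
  using integrable_norm[OF integrable_hcoef_product[OF f, of n n]]
  by (simp add: norm_mult power2_eq_square)

lemma hsq_eq_inner: "of_real (hsq n f) = (\<integral>z. hcoef n f z * cnj (hcoef n f z) \<partial>\<sigma>)"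
  unfolding hsq_def complex_norm_square[symmetric] by (simp only: integral_complex_of_real)

lemma parseval_finite:
  assumes f: "f \<in> Hol_ball"
  shows "(\<integral>z. (cmod (\<Sum>n<K. hcoef n f z * of_real r ^ n))\<^sup>2 \<partial>\<sigma>) = (\<Sum>n<K. r ^ (2 * n) * hsq n f)"
proof -
  have "complex_of_real (\<integral>z. (cmod (\<Sum>n<K. hcoef n f z * of_real r ^ n))\<^sup>2 \<partial>\<sigma>)
      = (\<integral>z. (\<Sum>n<K. \<Sum>m<K. of_real (r ^ n * r ^ m) * (hcoef n f z * cnj (hcoef m f z))) \<partial>\<sigma>)"
    unfolding integral_complex_of_real[symmetric] complex_norm_square
    by (simp add: sum_product mult_ac)
  also have "\<dots> = (\<Sum>n<K. \<Sum>m<K. of_real (r ^ n * r ^ m) * (\<integral>z. hcoef n f z * cnj (hcoef m f z) \<partial>\<sigma>))"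
    by (simp add: integrable_hcoef_product[OF f])
  also have "\<dots> = (\<Sum>n<K. \<Sum>m<K. if n = m then of_real (r ^ (2 * n) * hsq n f) else 0)"
    by (intro sum.cong refl)
      (auto simp: hcoef_orthogonal[OF f] hsq_eq_inner[symmetric] power_add[symmetric] mult_2)
  also have "\<dots> = complex_of_real (\<Sum>n<K. r ^ (2 * n) * hsq n f)"
    by (simp add: sum.delta)
  finally show ?thesis by (simp only: of_real_eq_iff)
qed

text \<open>The partial sums of the expansion of \<open>f (r z)\<close> are orthogonal and converge uniformly on the sphere.\<close>

lemma parseval:
  assumes f: "f \<in> Hol_ball" and r: "0 \<le> r" "r < 1"
  shows "(\<lambda>n. r ^ (2 * n) * hsq n f) sums (\<integral>z. (cmod (f (r *\<^sub>R z)))\<^sup>2 \<partial>\<sigma>)"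
    and "integrable \<sigma> (\<lambda>z. (cmod (f (r *\<^sub>R z)))\<^sup>2)"
proof -
  obtain M q where M: "M \<ge> 0" "0 < q" "q < 1" "\<And>z n. norm z \<le> r \<Longrightarrow> cmod (hcoef n f z) \<le> M * q ^ n"
    using hcoef_geometric_bound[OF f r(2)] by metis
  have coef: "cmod (hcoef n f z * of_real r ^ n) \<le> M * q ^ n" if "z \<in> sphere 0 1" for z n
  proof -
    have "hcoef n f z * of_real r ^ n = hcoef n f (of_real r *s z)"
      using hcoef_smult[OF f, of z "of_real r" n] that r by (simp add: mult.commute)
    then show ?thesis using M(4)[of "of_real r *s z" n] that r by (simp add: norm_vector_smult_complex)
  qed
  have geo: "summable (\<lambda>n. M * q ^ n)" using M by (intro summable_mult summable_geometric) auto
  define B where "B = (\<Sum>n. M * q ^ n)"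
  have bnd: "cmod (\<Sum>n<K. hcoef n f z * of_real r ^ n) \<le> B" if "z \<in> sphere 0 1" for z K
  proof -
    have "cmod (\<Sum>n<K. hcoef n f z * of_real r ^ n) \<le> (\<Sum>n<K. M * q ^ n)"
      by (rule order.trans[OF norm_sum]) (intro sum_mono coef that)
    also have "\<dots> \<le> B" unfolding B_def
      by (rule sum_le_suminf[OF geo]) (use M in auto)
    finally show ?thesis .
  qed
  have lim: "(\<lambda>K. \<Sum>n<K. hcoef n f z * of_real r ^ n) \<longlonglongrightarrow> f (r *\<^sub>R z)" if "z \<in> sphere 0 1" for z
    using hcoef_sums[OF f, of z "of_real r"] that r by (simp add: sums_def scaleR_eq_vector_smult)
  have meas: "(\<lambda>z. f (r *\<^sub>R z)) \<in> borel_measurable \<sigma>"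
    unfolding scaleR_eq_vector_smult
    by (intro measurable_continuous_sphere continuous_Hol_ball_sphere f) (use r in auto)
  note [measurable] = hcoef_measurable[OF f] meas
  have "(\<lambda>K. \<integral>z. (cmod (\<Sum>n<K. hcoef n f z * of_real r ^ n))\<^sup>2 \<partial>\<sigma>) \<longlonglongrightarrow> (\<integral>z. (cmod (f (r *\<^sub>R z)))\<^sup>2 \<partial>\<sigma>)"
  proof (rule integral_dominated_convergence[where w = "\<lambda>_. B\<^sup>2"])
    show "AE z in \<sigma>. (\<lambda>K. (cmod (\<Sum>n<K. hcoef n f z * of_real r ^ n))\<^sup>2) \<longlonglongrightarrow> (cmod (f (r *\<^sub>R z)))\<^sup>2"
      by (rule AE_I2, intro tendsto_intros lim) (simp add: space_sphere)
    show "AE z in \<sigma>. norm ((cmod (\<Sum>n<K. hcoef n f z * of_real r ^ n))\<^sup>2) \<le> B\<^sup>2" for K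
      by (rule AE_I2) (use bnd in \<open>auto simp: space_sphere intro!: power_mono\<close>)
  qed simp_all
  then show "(\<lambda>n. r ^ (2 * n) * hsq n f) sums (\<integral>z. (cmod (f (r *\<^sub>R z)))\<^sup>2 \<partial>\<sigma>)"
    unfolding parseval_finite[OF f] sums_def .
  show "integrable \<sigma> (\<lambda>z. (cmod (f (r *\<^sub>R z)))\<^sup>2)"
  proof (rule integrable_bounded[where B = "B\<^sup>2"])
    show "norm ((cmod (f (r *\<^sub>R z)))\<^sup>2) \<le> B\<^sup>2" if "z \<in> sphere 0 1" for z
      using LIMSEQ_le_const2[OF tendsto_norm[OF lim[OF that]]] bnd[OF that]
      by (auto intro!: power_mono)
  qed measurable
qed

lemma nn_parseval:
  assumes f: "f \<in> Hol_ball" and r: "0 \<le> r" "r < 1"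
  shows "(\<integral>\<^sup>+z. ennreal ((cmod (f (r *\<^sub>R z)))\<^sup>2) \<partial>\<sigma>) = (\<Sum>n. ennreal (r ^ (2 * n) * hsq n f))"
proof -
  have "(\<integral>\<^sup>+z. ennreal ((cmod (f (r *\<^sub>R z)))\<^sup>2) \<partial>\<sigma>) = ennreal (\<integral>z. (cmod (f (r *\<^sub>R z)))\<^sup>2 \<partial>\<sigma>)"
    by (rule nn_integral_eq_integral[OF parseval(2)[OF f r]]) simp
  also have "\<dots> = (\<Sum>n. ennreal (r ^ (2 * n) * hsq n f))"
    by (rule suminf_ennreal_eq[OF _ parseval(1)[OF f r], symmetric]) (use r hsq_nonneg in simp)
  finally show ?thesis .
qed

lemma hardy_sqnorm_eq:
  assumes f: "f \<in> Hol_ball"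
  shows "hardy_sqnorm \<sigma> f = (\<Sum>n. ennreal (hsq n f))"
proof -
  have eq: "hardy_sqnorm \<sigma> f = (SUP r\<in>{0..<1}. \<Sum>n. ennreal (r ^ (2 * n) * hsq n f))"
    unfolding hardy_sqnorm_def by (intro SUP_cong refl) (simp add: nn_parseval[OF f])
  show ?thesis
  proof (rule antisym)
    show "hardy_sqnorm \<sigma> f \<le> (\<Sum>n. ennreal (hsq n f))"
      unfolding eq
    proof (rule SUP_least, rule suminf_le)
      fix r :: real and n assume "r \<in> {0..<1}"
      then have "r ^ (2 * n) \<le> 1" by (intro power_le_one) auto
      then show "ennreal (r ^ (2 * n) * hsq n f) \<le> ennreal (hsq n f)"
        using hsq_nonneg[of n f] by (intro ennreal_leI) (simp add: mult_left_le_one_le mult_right_le_one_le mult_le_cancel_right1)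
    qed auto
    show "(\<Sum>n. ennreal (hsq n f)) \<le> hardy_sqnorm \<sigma> f"
      unfolding suminf_eq_SUP
    proof (rule SUP_least)
      fix K
      define r where "r j = 1 - 1 / (real j + 1)" for j
      have r: "r j \<in> {0..<1}" for j by (auto simp: r_def)
      have "r \<longlonglongrightarrow> 1" unfolding r_def by real_asymp
      then have "(\<lambda>j. \<Sum>n<K. r j ^ (2 * n) * hsq n f) \<longlonglongrightarrow> (\<Sum>n<K. 1 ^ (2 * n) * hsq n f)"
        by (intro tendsto_intros)
      then have "(\<lambda>j. ennreal (\<Sum>n<K. r j ^ (2 * n) * hsq n f)) \<longlonglongrightarrow> ennreal (\<Sum>n<K. hsq n f)"
        by (intro tendsto_ennrealI) simp
      moreover have "ennreal (\<Sum>n<K. r j ^ (2 * n) * hsq n f) \<le> hardy_sqnorm \<sigma> f" for j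
      proof -
        have "ennreal (\<Sum>n<K. r j ^ (2 * n) * hsq n f) = (\<Sum>n<K. ennreal (r j ^ (2 * n) * hsq n f))"
          using r[of j] hsq_nonneg by (intro sum_ennreal[symmetric]) auto
        also have "\<dots> \<le> (\<Sum>n. ennreal (r j ^ (2 * n) * hsq n f))"
          by (rule sum_le_suminf) auto
        also have "\<dots> \<le> hardy_sqnorm \<sigma> f"
          unfolding eq by (rule SUP_upper[OF r])
        finally show ?thesis .
      qed
      ultimately have "ennreal (\<Sum>n<K. hsq n f) \<le> hardy_sqnorm \<sigma> f"
        by (intro LIMSEQ_le_const2) auto
      then show "(\<Sum>n<K. ennreal (hsq n f)) \<le> hardy_sqnorm \<sigma> f"
        by (simp add: sum_ennreal hsq_nonneg)
    qed
  qed
qed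

subsection \<open>Coefficients are bounded by their mean squares\<close>

text \<open>The sphere is covered by at most \<open>(2 k + 1)\<^sup>m\<close> cells of a grid of mesh \<open>1 / k\<close>, where \<open>m\<close> is the
  real dimension. One of these cells has at least the average measure, and all caps of the
  same radius have the same measure.\<close>

lemma cap_measure_lower_bound:
  fixes w :: "complex^'n"
  assumes w: "w \<in> sphere 0 1" and k: "k > (0::nat)"
  shows "1 / (2 * real k + 1) ^ DIM(complex^'n) \<le> measure \<sigma> (sphere 0 1 \<inter> cball w (real DIM(complex^'n) / real k))"
proof -
  let ?m = "DIM(complex^'n)" and ?S = "sphere (0::complex^'n) 1"
  let ?I = "Basis \<rightarrow>\<^sub>E {- int k..int k} :: (complex^'n \<Rightarrow> int) set"
  define C where "C i = ?S \<inter> {x. \<forall>b\<in>Basis. \<lfloor>real k * (x \<bullet> b)\<rfloor> = i b}" for i :: "complex^'n \<Rightarrow> int"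
  have fin: "finite ?I" by (intro finite_PiE) auto
  have card: "real (card ?I) = (2 * real k + 1) ^ ?m" by (simp add: card_PiE)
  have Csets: "C i \<in> sets \<sigma>" for i unfolding C_def by (rule sphere_setsI) measurable
  have cover: "space \<sigma> = (\<Union>i\<in>?I. C i)"
  proof (intro equalityI subsetI)
    fix x assume "x \<in> space \<sigma>"
    then have x: "norm x = 1" by (simp add: space_sphere)
    have "\<bar>x \<bullet> b\<bar> \<le> 1" if "b \<in> Basis" for b using Basis_le_norm[OF that, of x] x by simp
    then have "\<bar>real k * (x \<bullet> b)\<bar> \<le> real k" if "b \<in> Basis" for b
      using that k by (simp add: abs_mult mult_left_le)
    then have fl: "\<lfloor>real k * (x \<bullet> b)\<rfloor> \<in> {- int k..int k}" if "b \<in> Basis" for b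
      using that by (auto simp: le_floor_iff floor_le_iff) force+
    then have "restrict (\<lambda>b. \<lfloor>real k * (x \<bullet> b)\<rfloor>) Basis \<in> ?I" by (intro restrict_PiE_iff[THEN iffD2]) auto
    moreover have "x \<in> C (restrict (\<lambda>b. \<lfloor>real k * (x \<bullet> b)\<rfloor>) Basis)"
      using x by (auto simp: C_def)
    ultimately show "x \<in> (\<Union>i\<in>?I. C i)" by blast
  qed (auto simp: C_def space_sphere)
  have "\<exists>i\<in>?I. 1 / (2 * real k + 1) ^ ?m \<le> measure \<sigma> (C i)"
  proof (rule ccontr)
    assume "\<not> ?thesis"
    then have small: "\<And>i. i \<in> ?I \<Longrightarrow> measure \<sigma> (C i) < 1 / (2 * real k + 1) ^ ?m" by force
    have ne: "?I \<noteq> {}" by (auto simp: PiE_eq_empty_iff)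
    have "1 = measure \<sigma> (\<Union>i\<in>?I. C i)" using prob_space cover by simp
    also have "\<dots> \<le> (\<Sum>i\<in>?I. measure \<sigma> (C i))"
      by (rule finite_measure_subadditive_finite[OF fin]) (use Csets in auto)
    also have "\<dots> < (\<Sum>i\<in>?I. 1 / (2 * real k + 1) ^ ?m)"
      by (rule sum_strict_mono[OF fin ne small])
    also have "\<dots> = 1" using card by (simp add: add_nonneg_pos)
    finally show False by simp
  qed
  then obtain i where i: "1 / (2 * real k + 1) ^ ?m \<le> measure \<sigma> (C i)" by blast
  have "0 < 1 / (2 * real k + 1) ^ ?m" by (simp add: add_nonneg_pos)
  with i have "measure \<sigma> (C i) \<noteq> 0" by linarith
  then have "C i \<noteq> {}" by auto
  then obtain y where y: "y \<in> C i" by blast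
  have sub: "C i \<subseteq> ?S \<inter> cball y (real ?m / real k)"
  proof
    fix x assume x: "x \<in> C i"
    have "\<bar>(y - x) \<bullet> b\<bar> \<le> 1 / real k" if b: "b \<in> Basis" for b
    proof -
      have "\<lfloor>real k * (x \<bullet> b)\<rfloor> = \<lfloor>real k * (y \<bullet> b)\<rfloor>" using x y b by (auto simp: C_def)
      then have "\<bar>real k * (y \<bullet> b) - real k * (x \<bullet> b)\<bar> \<le> 1" by linarith
      then have "real k * \<bar>(y - x) \<bullet> b\<bar> \<le> 1"
        by (simp add: inner_diff_left right_diff_distrib[symmetric] abs_mult)
      then show ?thesis using k by (simp add: field_simps)
    qed
    then have "(\<Sum>b\<in>Basis. \<bar>(y - x) \<bullet> b\<bar>) \<le> (\<Sum>b\<in>(Basis :: (complex^'n) set). 1 / real k)"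
      by (intro sum_mono)
    then have "norm (y - x) \<le> real ?m / real k" using norm_le_l1[of "y - x"] by simp
    then show "x \<in> ?S \<inter> cball y (real ?m / real k)" using x by (auto simp: C_def dist_norm)
  qed
  have capsets: "?S \<inter> cball v s \<in> sets \<sigma>" for v s by (rule sphere_setsI) simp
  have yS: "norm y = norm w" using y w by (simp add: C_def)
  obtain U where U: "orthogonal_transformation U" "U w = y"
    using orthogonal_transformation_between[OF yS[symmetric]] by blast
  have "1 / (2 * real k + 1) ^ ?m \<le> measure \<sigma> (?S \<inter> cball y (real ?m / real k))"
    using i finite_measure_mono[OF sub capsets] by linarith
  also have "\<dots> = measure (distr \<sigma> \<sigma> U) (?S \<inter> cball y (real ?m / real k))"
    using invariant U by (simp add: rotation_invariant_probability_def)
  also have "\<dots> = measure \<sigma> (U -` (?S \<inter> cball y (real ?m / real k)) \<inter> space \<sigma>)"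
    by (rule measure_distr[OF orthogonal_measurable[OF U(1)] capsets])
  also have "U -` (?S \<inter> cball y (real ?m / real k)) \<inter> space \<sigma> = ?S \<inter> cball w (real ?m / real k)"
  proof -
    have "dist y (U x) = dist w x" for x
    proof -
      have "y - U x = U (w - x)" using U by (simp add: orthogonal_transformation linear_diff)
      then show ?thesis using U(1) by (simp add: dist_norm orthogonal_transformation)
    qed
    moreover have "norm (U x) = norm x" for x using U(1) by (simp add: orthogonal_transformation)
    ultimately show ?thesis by (auto simp: space_sphere)
  qed
  finally show ?thesis .
qed

text \<open>The base \<open>14 m (n + 1) + 1\<close> is \<open>2 k + 1\<close> for the grid of mesh \<open>1 / k\<close>, \<open>k = 7 m (n + 1)\<close>, whose cells have diameter at most
  \<open>1 / (7 (n + 1))\<close>. Only the polynomial growth in \<open>n\<close> is of interest.\<close>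

definition sup_const :: "nat \<Rightarrow> real" where
  "sup_const n = 4 * (14 * real DIM(complex^'n) * (real n + 1) + 1) ^ DIM(complex^'n)"

text \<open>By Cauchy's estimate a homogeneous polynomial of degree \<open>n\<close> stays above half of its maximum
  on a cap of radius comparable to \<open>1 / n\<close>. Such caps are not too small, so that the
  maximum is bounded by the mean square up to a constant of polynomial growth.\<close>

lemma hcoef_sup_bound:
  fixes f :: "complex^'n \<Rightarrow> complex"
  assumes f: "f \<in> Hol_ball" and z: "z \<in> sphere 0 1"
  shows "(cmod (hcoef n f z))\<^sup>2 \<le> sup_const n * hsq n f"
proof -
  let ?m = "DIM(complex^'n)" and ?S = "sphere (0::complex^'n) 1"
  define p where "p = hcoef n f"
  have p: "p \<in> Hol_ball" unfolding p_def by (rule hcoef_Hol_ball[OF f])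
  have "continuous_on ?S (\<lambda>z. cmod (p z))"
    unfolding p_def by (intro continuous_intros continuous_hcoef_sphere f)
  then obtain z0 where z0: "z0 \<in> ?S" "\<And>y. y \<in> ?S \<Longrightarrow> cmod (p y) \<le> cmod (p z0)"
    using continuous_attains_sup[OF compact_sphere] z by (metis empty_iff)
  define M where "M = cmod (p z0)"
  have M0: "M \<ge> 0" by (simp add: M_def)
  define \<delta> where "\<delta> = 1 / (real n + 1)"
  have \<delta>: "0 < \<delta>" "\<delta> \<le> 1" by (auto simp: \<delta>_def divide_simps)
  \<comment> \<open>A homogeneous function of degree \<open>n\<close> grows only by the factor \<open>(1 + \<delta>)\<^sup>n \<le> e \<le> 3\<close> on the ball of radius \<open>1 + \<delta>\<close>. The factor
    \<open>1/4\<close> moves that ball into the unit ball, where \<open>p\<close> is known to be holomorphic.\<close>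
  have growth: "cmod (p ((1/4) *s y)) \<le> 3 * M / 4 ^ n" if y: "norm y \<le> 1 + \<delta>" for y
  proof -
    obtain u where u: "u \<in> ?S" "y = of_real (norm y) *s u" by (rule polar_decomposition)
    have "(1/4) *s y = of_real (norm y / 4) *s u"
      using u(2) by (metis of_real_divide of_real_numeral mult.commute times_divide_eq_right
          mult_1_right vector_smult_assoc)
    moreover have "norm u \<le> 1" using u by simp
    moreover have "cmod (of_real (norm y / 4)) \<le> 1" using y \<delta> by simp
    ultimately have "cmod (p ((1/4) *s y)) = (norm y / 4) ^ n * cmod (p u)"
      unfolding p_def using hcoef_smult[OF f, of u "of_real (norm y / 4)" n]
      by (simp add: norm_mult norm_power norm_divide)
    also have "\<dots> \<le> ((1 + \<delta>) / 4) ^ n * M"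
      unfolding M_def using y \<delta> by (intro mult_mono power_mono z0 u) auto
    also have "(1 + \<delta>) ^ n \<le> 3"
    proof -
      have "(1 + \<delta>) ^ n \<le> exp \<delta> ^ n" using \<delta> by (intro power_mono exp_ge_add_one_self) auto
      also have "\<dots> = exp (real n * \<delta>)" by (simp add: exp_of_nat_mult)
      also have "\<dots> \<le> exp 1" by (simp add: \<delta>_def)
      also have "\<dots> \<le> 3" by (rule exp_le)
      finally show ?thesis .
    qed
    then have "((1 + \<delta>) / 4) ^ n * M \<le> 3 * M / 4 ^ n"
      using M0 by (simp add: power_divide divide_right_mono mult_right_mono)
    finally show ?thesis .
  qed
  have half: "M / 2 \<le> cmod (p w)" if w: "w \<in> ?S" "norm (w - z0) \<le> \<delta> / 7" for w
  proof -
    \<comment> \<open>The line from \<open>z0\<close> through \<open>w\<close> may be followed up to parameter 7. On the unit disc this leaves room for discs of radius 6,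
      hence the derivative is at most \<open>3 M / 6 = M / 2\<close>, up to scaling.\<close>
    let ?g = "\<lambda>t. p ((1/4) *s z0 + t *s ((1/4) *s (w - z0)))"
    have arg: "(1/4) *s z0 + t *s ((1/4) *s (w - z0)) = (1/4) *s (z0 + t *s (w - z0))" for t
      by (simp add: vec_eq_iff algebra_simps)
    have nrm: "norm (z0 + t *s (w - z0)) \<le> 1 + \<delta>" if "cmod t \<le> 7" for t
    proof -
      have "norm (z0 + t *s (w - z0)) \<le> norm z0 + cmod t * norm (w - z0)"
        using norm_triangle_ineq[of z0 "t *s (w - z0)"] by (simp only: norm_vector_smult_complex)
      also have "\<dots> \<le> 1 + 7 * (\<delta> / 7)"
        using z0(1) that w by (intro add_mono mult_mono) auto
      finally show ?thesis by simp
    qed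
    have hol: "?g holomorphic_on cball 0 7"
    proof (rule Hol_ball_slice_holomorphic[OF p])
      fix t :: complex assume "t \<in> cball 0 7"
      then have "norm (z0 + t *s (w - z0)) \<le> 2" using nrm[of t] \<delta> by simp
      then show "norm ((1/4) *s z0 + t *s ((1/4) *s (w - z0))) < 1"
        unfolding arg norm_vector_smult_complex by simp
    qed
    have der: "cmod (deriv ?g t) \<le> M / 2 / 4 ^ n" if t: "t \<in> cball 0 1" for t
    proof -
      have sub: "cball t 6 \<subseteq> cball 0 7"
      proof
        fix x assume "x \<in> cball t 6"
        then show "x \<in> cball 0 7"
          using t norm_triangle_ineq[of t "x - t"] by (simp add: dist_norm norm_minus_commute)
      qed
      have "cmod ((deriv ^^ 1) ?g t) \<le> fact 1 * (3 * M / 4 ^ n) / 6 ^ 1"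
      proof (rule Cauchy_inequality)
        show "?g holomorphic_on ball t 6" using hol sub by (rule_tac holomorphic_on_subset) force+
        show "continuous_on (cball t 6) ?g"
          using holomorphic_on_imp_continuous_on[OF hol] sub by (rule continuous_on_subset)
        show "cmod (?g x) \<le> 3 * M / 4 ^ n" if "cmod (t - x) = 6" for x
        proof -
          have "x \<in> cball t 6" using that by (simp add: dist_norm)
          then have "cmod x \<le> 7" using sub by auto
          then show ?thesis unfolding arg by (intro growth nrm)
        qed
      qed simp
      then show ?thesis by simp
    qed
    have "cmod (?g 1 - ?g 0) \<le> M / 2 / 4 ^ n * cmod (1 - 0)"
    proof (rule field_differentiable_bound[where S = "cball 0 1" and f' = "deriv ?g"])
      fix t :: complex assume t: "t \<in> cball 0 1"
      have "?g holomorphic_on ball 0 7" using hol by (rule holomorphic_on_subset) auto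
      then have "(?g has_field_derivative deriv ?g t) (at t)"
        by (rule holomorphic_derivI) (use t in auto)
      then show "(?g has_field_derivative deriv ?g t) (at t within cball 0 1)"
        by (rule has_field_derivative_at_within)
    qed (use der in auto)
    moreover have "?g 1 = p ((1/4) *s w)" "?g 0 = p ((1/4) *s z0)"
      unfolding arg by simp_all
    moreover have "p ((1/4) *s w) = p w / 4 ^ n" "p ((1/4) *s z0) = p z0 / 4 ^ n"
      unfolding p_def using hcoef_smult[OF f, of w "1/4" n] hcoef_smult[OF f, of z0 "1/4" n] w z0
      by (simp_all add: power_divide)
    ultimately have "cmod ((p w - p z0) / 4 ^ n) \<le> M / 2 / 4 ^ n" by (simp add: diff_divide_distrib)
    then have "cmod (p w - p z0) \<le> M / 2"
      by (simp add: norm_divide norm_power field_simps)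
    then show ?thesis using norm_triangle_ineq2[of "p z0" "p w"] by (simp add: M_def norm_minus_commute)
  qed
  define k where "k = 7 * ?m * (n + 1)"
  have k0: "k > 0" by (simp add: k_def)
  have "real k = real ?m * (7 * (real n + 1))" by (simp only: k_def of_nat_mult of_nat_add of_nat_numeral) simp
  then have mk: "real ?m / real k = \<delta> / 7"
    using nonzero_divide_mult_cancel_left[of "real ?m" "7 * (real n + 1)"]
    by (simp only: \<delta>_def) simp
  let ?C = "?S \<inter> cball z0 (\<delta> / 7)"
  have Csets [measurable]: "?C \<in> sets \<sigma>" by (rule sphere_setsI) simp
  have Clow: "1 / (2 * real k + 1) ^ ?m \<le> measure \<sigma> ?C"
    using cap_measure_lower_bound[OF z0(1) k0] by (simp only: mk)
  note [measurable] = hcoef_measurable[OF f]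
  have "(M / 2)\<^sup>2 * measure \<sigma> ?C = (\<integral>w. (M / 2)\<^sup>2 * indicator ?C w \<partial>\<sigma>)"
    using Csets sets.Int_space_eq2 by simp
  also have "\<dots> \<le> (\<integral>w. (cmod (p w))\<^sup>2 \<partial>\<sigma>)"
  proof (rule integral_mono)
    show "integrable \<sigma> (\<lambda>w. (M / 2)\<^sup>2 * indicator ?C w)"
      by (intro integrable_mult_right integrable_real_indicator Csets) (simp add: emeasure_eq_measure)
    show "integrable \<sigma> (\<lambda>w. (cmod (p w))\<^sup>2)"
      unfolding p_def by (rule integrable_hcoef_square[OF f])
    fix w assume "w \<in> space \<sigma>"
    then have "w \<in> ?S" by (simp add: space_sphere)
    then show "(M / 2)\<^sup>2 * indicator ?C w \<le> (cmod (p w))\<^sup>2"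
      using half[of w] M0 by (auto simp: indicator_def dist_norm norm_minus_commute intro!: power_mono)
  qed
  also have "\<dots> = hsq n f" by (simp add: hsq_def p_def)
  finally have int: "(M / 2)\<^sup>2 * measure \<sigma> ?C \<le> hsq n f" .
  have "(M / 2)\<^sup>2 * (1 / (2 * real k + 1) ^ ?m) \<le> hsq n f"
    by (rule order.trans[OF mult_left_mono[OF Clow] int]) simp
  moreover have "(2 * real k + 1) ^ ?m > 0" by (simp add: add_nonneg_pos)
  ultimately have "(M / 2)\<^sup>2 \<le> hsq n f * (2 * real k + 1) ^ ?m" by (simp add: pos_divide_le_eq)
  then have "M\<^sup>2 \<le> 4 * (2 * real k + 1) ^ ?m * hsq n f" by (simp add: power_divide mult_ac)
  also have "2 * real k + 1 = 14 * real ?m * (real n + 1) + 1" by (simp add: k_def algebra_simps)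
  finally have "M\<^sup>2 \<le> sup_const n * hsq n f" by (simp add: sup_const_def)
  moreover have "(cmod (hcoef n f z))\<^sup>2 \<le> M\<^sup>2"
    using z0(2)[OF z] by (simp add: M_def p_def power_mono)
  ultimately show ?thesis by linarith
qed

end

section \<open>The Besov norm in terms of homogeneous parts\<close>

locale besov_setting = sphere_measure \<sigma> for \<sigma> :: "(complex^'n) measure" +
  fixes \<mu> :: "real measure" and N :: nat
  assumes adm: "admissible \<mu>"
begin

sublocale \<mu>: finite_measure \<mu>
  using adm by (simp add: admissible_def)

lemma sets_radial [measurable_cong]: "sets \<mu> = sets (restrict_space borel {0..1})"
  using adm by (simp add: admissible_def)

lemma space_radial: "space \<mu> = {0..1}"
  using sets_eq_imp_space_eq[OF sets_radial] by (simp add: space_restrict_space)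

lemma radial_setsI: "A \<in> sets borel \<Longrightarrow> A \<subseteq> {0..1} \<Longrightarrow> A \<in> sets \<mu>"
  unfolding sets_radial by (simp add: sets_restrict_space_iff)

lemma radial_mass_pos:
  assumes "0 < r" "r < 1"
  shows "measure \<mu> {r<..1} > 0"
  using assms adm by (simp add: admissible_def \<mu>.emeasure_eq_measure)

lemma id_radial_measurable [measurable]: "(\<lambda>r. r) \<in> borel_measurable \<mu>"
  unfolding measurable_cong_sets[OF sets_radial refl] by (rule measurable_restrict_space1) simp

lemma id_sphere_measurable [measurable]: "(\<lambda>z. z) \<in> borel_measurable \<sigma>"
  unfolding measurable_cong_sets[OF sets_sphere refl] by (rule measurable_restrict_space1) simp

abbreviation B where "B \<equiv> besov_space \<sigma> \<mu> N"

abbreviation bnorm where "bnorm \<equiv> besov_norm \<sigma> \<mu> N"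

definition moment :: "nat \<Rightarrow> real" where
  "moment n = (\<integral>r. r ^ (2 * n) \<partial>\<mu>)"

lemma integrable_moment: "integrable \<mu> (\<lambda>r. r ^ (2 * n))"
proof (rule \<mu>.integrable_const_bound[where B = 1])
  show "AE r in \<mu>. norm (r ^ (2 * n)) \<le> 1"
    by (rule AE_I2) (auto simp: space_radial power_le_one)
qed measurable

lemma nn_moment: "(\<integral>\<^sup>+r. ennreal (r ^ (2 * n)) \<partial>\<mu>) = ennreal (moment n)"
  unfolding moment_def by (rule nn_integral_eq_integral[OF integrable_moment]) (auto simp: space_radial)

lemma moment_0: "moment 0 = measure \<mu> (space \<mu>)"
  by (simp add: moment_def)

lemma moment_lower_bound:
  assumes "0 < r" "r < 1"
  shows "r ^ (2 * n) * measure \<mu> {r<..1} \<le> moment n"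
proof -
  have [measurable]: "{r<..1} \<in> sets \<mu>" by (rule radial_setsI) (use assms in auto)
  have "r ^ (2 * n) * measure \<mu> {r<..1} = (\<integral>x. r ^ (2 * n) * indicator {r<..1} x \<partial>\<mu>)"
    using sets.Int_space_eq2[of "{r<..1}" \<mu>] by simp
  also have "\<dots> \<le> moment n"
    unfolding moment_def
  proof (rule integral_mono)
    show "integrable \<mu> (\<lambda>x. r ^ (2 * n) * indicator {r<..1} x)"
      by (intro integrable_mult_right integrable_real_indicator) (simp_all add: \<mu>.emeasure_eq_measure)
    show "r ^ (2 * n) * indicator {r<..1} x \<le> x ^ (2 * n)" if "x \<in> space \<mu>" for x
      using that assms by (auto simp: space_radial indicator_def intro!: power_mono)
  qed (rule integrable_moment)
  finally show ?thesis .
qed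

lemma moment_pos: "moment n > 0"
proof -
  have "0 < (1/2) ^ (2 * n) * measure \<mu> {1/2<..1}"
    using radial_mass_pos[of "1/2"] by simp
  also have "\<dots> \<le> moment n" by (rule moment_lower_bound) auto
  finally show ?thesis .
qed

lemma scale_measurable:
  "(\<lambda>(r, w). r *\<^sub>R w) \<in> \<mu> \<Otimes>\<^sub>M \<sigma> \<rightarrow>\<^sub>M restrict_space borel (cball 0 1)"
proof (rule measurable_restrict_space2)
  show "(\<lambda>(r, w). r *\<^sub>R w) \<in> space (\<mu> \<Otimes>\<^sub>M \<sigma>) \<rightarrow> cball 0 1"
    by (auto simp: space_pair_measure space_radial space_sphere)
  show "(\<lambda>(r, w). r *\<^sub>R w) \<in> borel_measurable (\<mu> \<Otimes>\<^sub>M \<sigma>)"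
    by measurable
qed

lemma sets_radial_measure: "sets (radial_measure \<sigma> \<mu>) = sets (restrict_space borel (cball 0 1))"
  by (simp add: radial_measure_def)

lemma square_measurable:
  assumes f: "f \<in> Hol_ball"
  shows "(\<lambda>z. ennreal ((cmod (f z))\<^sup>2) * indicator (ball 0 1) z) \<in> borel_measurable (radial_measure \<sigma> \<mu>)"
proof -
  have "f \<in> borel_measurable (restrict_space borel (ball 0 1))"
    by (rule borel_measurable_continuous_on_restrict[OF Hol_ball_continuous_on[OF f]])
  then have "(\<lambda>z. ennreal ((cmod (f z))\<^sup>2)) \<in> borel_measurable (restrict_space borel (ball 0 1))"
    by measurable
  then have "(\<lambda>z. ennreal ((cmod (f z))\<^sup>2) * indicator (ball 0 1) z) \<in> borel_measurable borel"
    by (subst (asm) borel_measurable_restrict_space_iff_ennreal) auto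
  then show ?thesis
    unfolding measurable_cong_sets[OF sets_radial_measure refl] by (rule measurable_restrict_space1)
qed

lemma emeasure_radial_measure: "emeasure (radial_measure \<sigma> \<mu>) (cball 0 1) = ennreal (moment 0)"
proof -
  have "emeasure (radial_measure \<sigma> \<mu>) (cball 0 1) = emeasure (\<mu> \<Otimes>\<^sub>M \<sigma>) (space (\<mu> \<Otimes>\<^sub>M \<sigma>))"
    unfolding radial_measure_def
    by (subst emeasure_distr[OF scale_measurable])
      (auto simp: sets_restrict_space space_pair_measure space_radial space_sphere intro!: arg_cong2[where f = emeasure])
  also have "\<dots> = emeasure \<mu> (space \<mu>) * emeasure \<sigma> (space \<sigma>)"
    unfolding space_pair_measure by (rule emeasure_pair_measure_Times) auto
  finally show ?thesis by (simp add: emeasure_space_1 moment_0 \<mu>.emeasure_eq_measure)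
qed

text \<open>Parseval's identity on the sphere of radius \<open>r\<close> is integrated over \<open>r < 1\<close>. The Hardy norm is the
  value of the same series at \<open>r = 1\<close>, so that an atom of \<open>\<mu>\<close> at 1 just completes the moment.\<close>

lemma L2_sqnorm_eq:
  assumes f: "f \<in> Hol_ball"
  shows "L2_sqnorm \<sigma> \<mu> f = (\<Sum>n. ennreal (moment n * hsq n f))"
proof -
  have meas: "(\<lambda>r. ennreal (r ^ (2 * n)) * indicator {0..<1} r) \<in> borel_measurable \<mu>" for n
    by (rule measurable_compose[OF id_radial_measurable]) measurable
  have "(\<integral>\<^sup>+z\<in>ball 0 1. ennreal ((cmod (f z))\<^sup>2) \<partial>radial_measure \<sigma> \<mu>)
      = (\<integral>\<^sup>+x. (case x of (r, w) \<Rightarrow> ennreal ((cmod (f (r *\<^sub>R w)))\<^sup>2) * indicator (ball 0 1) (r *\<^sub>R w)) \<partial>(\<mu> \<Otimes>\<^sub>M \<sigma>))"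
    using square_measurable[OF f] unfolding radial_measure_def
    by (subst nn_integral_distr[OF scale_measurable]) (auto simp: case_prod_unfold)
  also have "\<dots> = (\<integral>\<^sup>+r. \<integral>\<^sup>+w. ennreal ((cmod (f (r *\<^sub>R w)))\<^sup>2) * indicator (ball 0 1) (r *\<^sub>R w) \<partial>\<sigma> \<partial>\<mu>)"
  proof (subst nn_integral_fst[symmetric])
    have "(\<lambda>z. ennreal ((cmod (f z))\<^sup>2) * indicator (ball 0 1) z) \<in> borel_measurable (restrict_space borel (cball 0 1))"
      using square_measurable[OF f] by (simp add: measurable_cong_sets[OF sets_radial_measure refl])
    from measurable_compose[OF scale_measurable this]
    show "(\<lambda>x. case x of (r, w) \<Rightarrow> ennreal ((cmod (f (r *\<^sub>R w)))\<^sup>2) * indicator (ball 0 1) (r *\<^sub>R w))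
        \<in> borel_measurable (\<mu> \<Otimes>\<^sub>M \<sigma>)"
      by (simp add: case_prod_unfold)
  qed simp
  also have "\<dots> = (\<integral>\<^sup>+r. (\<Sum>n. ennreal (hsq n f) * (ennreal (r ^ (2 * n)) * indicator {0..<1} r)) \<partial>\<mu>)"
  proof (rule nn_integral_cong)
    fix r assume "r \<in> space \<mu>"
    then have r: "0 \<le> r" "r \<le> 1" by (auto simp: space_radial)
    show "(\<integral>\<^sup>+w. ennreal ((cmod (f (r *\<^sub>R w)))\<^sup>2) * indicator (ball 0 1) (r *\<^sub>R w) \<partial>\<sigma>)
        = (\<Sum>n. ennreal (hsq n f) * (ennreal (r ^ (2 * n)) * indicator {0..<1} r))"
    proof (cases "r < 1")
      case True
      have "(\<integral>\<^sup>+w. ennreal ((cmod (f (r *\<^sub>R w)))\<^sup>2) * indicator (ball 0 1) (r *\<^sub>R w) \<partial>\<sigma>)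
          = (\<integral>\<^sup>+w. ennreal ((cmod (f (r *\<^sub>R w)))\<^sup>2) \<partial>\<sigma>)"
        by (intro nn_integral_cong) (use True r in \<open>auto simp: space_sphere\<close>)
      also have "\<dots> = (\<Sum>n. ennreal (r ^ (2 * n) * hsq n f))"
        by (rule nn_parseval[OF f r(1) True])
      finally show ?thesis
        using True r hsq_nonneg by (simp add: ennreal_mult mult.commute)
    next
      case False
      have "(\<integral>\<^sup>+w. ennreal ((cmod (f (r *\<^sub>R w)))\<^sup>2) * indicator (ball 0 1) (r *\<^sub>R w) \<partial>\<sigma>) = (\<integral>\<^sup>+w. 0 \<partial>\<sigma>)"
        by (intro nn_integral_cong) (use False r in \<open>auto simp: space_sphere\<close>)
      then show ?thesis using False by simp
    qed
  qed
  also have "\<dots> = (\<Sum>n. \<integral>\<^sup>+r. ennreal (hsq n f) * (ennreal (r ^ (2 * n)) * indicator {0..<1} r) \<partial>\<mu>)"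
    by (intro nn_integral_suminf borel_measurable_times_ennreal meas) simp
  also have "\<dots> = (\<Sum>n. ennreal (hsq n f) * (\<integral>\<^sup>+r. ennreal (r ^ (2 * n)) * indicator {0..<1} r \<partial>\<mu>))"
    by (simp only: nn_integral_cmult[OF meas])
  finally have int: "(\<integral>\<^sup>+z\<in>ball 0 1. ennreal ((cmod (f z))\<^sup>2) \<partial>radial_measure \<sigma> \<mu>)
      = (\<Sum>n. ennreal (hsq n f) * (\<integral>\<^sup>+r. ennreal (r ^ (2 * n)) * indicator {0..<1} r \<partial>\<mu>))" .
  have one: "{1} \<in> sets \<mu>" by (rule radial_setsI) auto
  have mom: "(\<integral>\<^sup>+r. ennreal (r ^ (2 * n)) * indicator {0..<1} r \<partial>\<mu>) + emeasure \<mu> {1} = ennreal (moment n)" for n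
  proof -
    have "emeasure \<mu> {1} = (\<integral>\<^sup>+r. indicator {1} r \<partial>\<mu>)" using one by simp
    then have "(\<integral>\<^sup>+r. ennreal (r ^ (2 * n)) * indicator {0..<1} r \<partial>\<mu>) + emeasure \<mu> {1}
        = (\<integral>\<^sup>+r. ennreal (r ^ (2 * n)) * indicator {0..<1} r + indicator {1} r \<partial>\<mu>)"
      using one by (simp add: nn_integral_add[OF meas])
    also have "\<dots> = (\<integral>\<^sup>+r. ennreal (r ^ (2 * n)) \<partial>\<mu>)"
      by (intro nn_integral_cong) (auto simp: space_radial indicator_def)
    finally show ?thesis by (simp add: nn_moment)
  qed
  have "emeasure \<mu> {1} * hardy_sqnorm \<sigma> f = (\<Sum>n. ennreal (hsq n f) * emeasure \<mu> {1})"
    unfolding hardy_sqnorm_eq[OF f] by (simp add: mult.commute)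
  note hardy = this
  have "L2_sqnorm \<sigma> \<mu> f = (\<Sum>n. ennreal (hsq n f) * (\<integral>\<^sup>+r. ennreal (r ^ (2 * n)) * indicator {0..<1} r \<partial>\<mu>)
      + ennreal (hsq n f) * emeasure \<mu> {1})"
    unfolding L2_sqnorm_def int hardy by (rule suminf_add[OF summableI summableI])
  also have "\<dots> = (\<Sum>n. ennreal (moment n * hsq n f))"
    unfolding distrib_left[symmetric] mom
    using moment_pos by (intro suminf_cong) (simp add: ennreal_mult hsq_nonneg less_imp_le mult.commute)
  finally show ?thesis .
qed

text \<open>The radial derivative multiplies the part of degree \<open>n\<close> by \<open>n\<close>. The constant term, which it
  kills, enters the norm with the total mass of \<open>\<omega>\<close>, which is the moment of order 0.\<close>

definition weight :: "nat \<Rightarrow> real" where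
  "weight n = (if n = 0 then 1 else real n ^ (2 * N)) * moment n"

lemma weight_pos: "weight n > 0"
  using moment_pos by (simp add: weight_def)

lemma hsq_radial_deriv_iter:
  assumes f: "f \<in> Hol_ball"
  shows "hsq n ((radial_deriv ^^ k) f) = real n ^ (2 * k) * hsq n f"
proof -
  have "hsq n ((radial_deriv ^^ k) f) = (\<integral>z. real n ^ (2 * k) * (cmod (hcoef n f z))\<^sup>2 \<partial>\<sigma>)"
    unfolding hsq_def
    by (rule Bochner_Integration.integral_cong[OF refl])
      (simp add: space_sphere hcoef_radial_deriv_iter[OF f] norm_mult norm_power power_mult_distrib power_even_eq
        flip: power_mult)
  then show ?thesis by (simp add: hsq_def)
qed

lemma hsq_0: "hsq 0 f = (cmod (f 0))\<^sup>2"
  by (simp add: hsq_def hcoef_0 prob_space)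

lemma besov_sqnorm_eq:
  assumes f: "f \<in> Hol_ball"
  shows "besov_sqnorm \<sigma> \<mu> N f = (\<Sum>n. ennreal (weight n * hsq n f))"
proof (cases "N = 0")
  case True
  then have w: "weight n = moment n" for n unfolding weight_def by simp
  show ?thesis unfolding besov_sqnorm_def w using True by (simp add: L2_sqnorm_eq[OF f])
next
  case False
  let ?a = "\<lambda>n. if n = 0 then ennreal (moment 0 * hsq 0 f) else 0"
  let ?b = "\<lambda>n. ennreal (moment n * (real n ^ (2 * N) * hsq n f))"
  have "besov_sqnorm \<sigma> \<mu> N f = ennreal (moment 0 * hsq 0 f) + (\<Sum>n. ?b n)"
    using False moment_pos[of 0]
    by (simp add: besov_sqnorm_def emeasure_radial_measure hsq_0 ennreal_mult
        L2_sqnorm_eq[OF radial_deriv_iter_Hol_ball[OF f]] hsq_radial_deriv_iter[OF f])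
  also have "ennreal (moment 0 * hsq 0 f) = (\<Sum>n. ?a n)"
    by (subst suminf_finite[of "{0}"]) auto
  also have "(\<Sum>n. ?a n) + (\<Sum>n. ?b n) = (\<Sum>n. ?a n + ?b n)"
    by (rule suminf_add) auto
  also have "\<dots> = (\<Sum>n. ennreal (weight n * hsq n f))"
    using False by (intro suminf_cong) (auto simp: weight_def mult_ac power_0_left)
  finally show ?thesis .
qed

lemma besov_space_iff: "f \<in> B \<longleftrightarrow> f \<in> Hol_ball \<and> besov_sqnorm \<sigma> \<mu> N f < \<infinity>"
  using moment_pos[of 0]
  by (auto simp: besov_space_def besov_sqnorm_def emeasure_radial_measure ennreal_mult_less_top)

lemma besov_Hol_ball: "f \<in> B \<Longrightarrow> f \<in> Hol_ball"
  by (simp add: besov_space_iff)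

subsection \<open>Isometric embedding into a space of square integrable functions\<close>

text \<open>The sum over degrees and the integral over the sphere form one integral. In this way polarization and Fatou's lemma apply
  pointwise to the sequence of homogeneous parts.\<close>

definition coef_space :: "(nat \<times> (complex^'n)) measure" where
  "coef_space = count_space UNIV \<Otimes>\<^sub>M \<sigma>"

definition coefs :: "(complex^'n \<Rightarrow> complex) \<Rightarrow> nat \<times> (complex^'n) \<Rightarrow> complex" where
  "coefs f = (\<lambda>(n, z). of_real (sqrt (weight n)) * hcoef n f z)"

lemma space_coef_space: "space coef_space = UNIV \<times> sphere 0 1"
  by (simp add: coef_space_def space_pair_measure space_sphere)

lemma coefs_measurable:
  assumes "f \<in> Hol_ball"
  shows "coefs f \<in> borel_measurable coef_space"
  unfolding coef_space_def
proof (rule measurable_pair_measure_countable1)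
  show "(\<lambda>z. coefs f (n, z)) \<in> borel_measurable \<sigma>" for n
    using hcoef_measurable[OF assms, of n] unfolding coefs_def prod.case by measurable
qed auto

lemma besov_sqnorm_coefs:
  assumes f: "f \<in> Hol_ball"
  shows "besov_sqnorm \<sigma> \<mu> N f = (\<integral>\<^sup>+x. ennreal ((cmod (coefs f x))\<^sup>2) \<partial>coef_space)"
proof -
  note [measurable] = coefs_measurable[OF f, unfolded coef_space_def]
  have inner: "(\<integral>\<^sup>+z. ennreal ((cmod (coefs f (n, z)))\<^sup>2) \<partial>\<sigma>) = ennreal (weight n * hsq n f)" for n
  proof -
    have "(\<integral>\<^sup>+z. ennreal ((cmod (coefs f (n, z)))\<^sup>2) \<partial>\<sigma>) = (\<integral>\<^sup>+z. ennreal (weight n * (cmod (hcoef n f z))\<^sup>2) \<partial>\<sigma>)"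
      using weight_pos[of n] by (simp add: coefs_def norm_mult power_mult_distrib less_imp_le)
    also have "\<dots> = ennreal (\<integral>z. weight n * (cmod (hcoef n f z))\<^sup>2 \<partial>\<sigma>)"
      using weight_pos[of n]
      by (intro nn_integral_eq_integral integrable_mult_right integrable_hcoef_square f) (simp add: less_imp_le)
    finally show ?thesis by (simp add: hsq_def)
  qed
  have "(\<integral>\<^sup>+x. ennreal ((cmod (coefs f x))\<^sup>2) \<partial>coef_space)
      = (\<integral>\<^sup>+n. \<integral>\<^sup>+z. ennreal ((cmod (coefs f (n, z)))\<^sup>2) \<partial>\<sigma> \<partial>count_space UNIV)"
    unfolding coef_space_def by (rule nn_integral_fst[symmetric]) measurable
  also have "\<dots> = (\<Sum>n. ennreal (weight n * hsq n f))"
    unfolding inner by (rule nn_integral_count_space_nat)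
  finally show ?thesis by (simp add: besov_sqnorm_eq[OF f])
qed

lemma coefs_add:
  assumes "f \<in> Hol_ball" "g \<in> Hol_ball" "x \<in> space coef_space"
  shows "coefs (\<lambda>z. f z + g z) x = coefs f x + coefs g x"
  using assms by (auto simp: coefs_def space_coef_space hcoef_add distrib_left)

lemma coefs_diff:
  assumes "f \<in> Hol_ball" "g \<in> Hol_ball" "x \<in> space coef_space"
  shows "coefs (\<lambda>z. f z - g z) x = coefs f x - coefs g x"
  using assms by (auto simp: coefs_def space_coef_space hcoef_diff right_diff_distrib)

lemma coefs_cmult:
  assumes "f \<in> Hol_ball" "x \<in> space coef_space"
  shows "coefs (\<lambda>z. c * f z) x = c * coefs f x"
  using assms by (auto simp: coefs_def space_coef_space hcoef_cmult)

lemma besov_integrable: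
  assumes "f \<in> B"
  shows "integrable coef_space (\<lambda>x. (cmod (coefs f x))\<^sup>2)"
proof (rule integrableI_nonneg)
  have f: "f \<in> Hol_ball" using assms by (rule besov_Hol_ball)
  show "(\<lambda>x. (cmod (coefs f x))\<^sup>2) \<in> borel_measurable coef_space"
    using coefs_measurable[OF f] by measurable
  show "(\<integral>\<^sup>+x. ennreal ((cmod (coefs f x))\<^sup>2) \<partial>coef_space) < \<infinity>"
    using assms besov_sqnorm_coefs[OF f] by (simp add: besov_space_iff)
qed simp

lemma besov_norm_square:
  assumes "f \<in> B"
  shows "(bnorm f)\<^sup>2 = (\<integral>x. (cmod (coefs f x))\<^sup>2 \<partial>coef_space)"
proof -
  have "besov_sqnorm \<sigma> \<mu> N f = ennreal (\<integral>x. (cmod (coefs f x))\<^sup>2 \<partial>coef_space)"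
    using besov_sqnorm_coefs[OF besov_Hol_ball[OF assms]] nn_integral_eq_integral[OF besov_integrable[OF assms]]
    by simp
  then show ?thesis by (simp add: besov_norm_def)
qed

lemma besov_norm_nonneg: "bnorm f \<ge> 0"
  by (simp add: besov_norm_def)

lemma besov_sqnorm_eq_norm:
  assumes "f \<in> B"
  shows "besov_sqnorm \<sigma> \<mu> N f = ennreal ((bnorm f)\<^sup>2)"
  using assms by (simp add: besov_norm_def besov_space_iff)

lemma besov_add:
  assumes f: "f \<in> B" and g: "g \<in> B"
  shows "(\<lambda>z. f z + g z) \<in> B"
proof -
  note h = besov_Hol_ball[OF f] besov_Hol_ball[OF g]
  note [measurable] = coefs_measurable[OF h(1)] coefs_measurable[OF h(2)]
  have "(\<integral>\<^sup>+x. ennreal ((cmod (coefs (\<lambda>z. f z + g z) x))\<^sup>2) \<partial>coef_space)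
      \<le> (\<integral>\<^sup>+x. ennreal (2 * (cmod (coefs f x))\<^sup>2 + 2 * (cmod (coefs g x))\<^sup>2) \<partial>coef_space)"
  proof (rule nn_integral_mono)
    fix x assume x: "x \<in> space coef_space"
    have "(cmod (coefs f x + coefs g x))\<^sup>2 \<le> (cmod (coefs f x) + cmod (coefs g x))\<^sup>2"
      by (intro power_mono norm_triangle_ineq) simp
    also have "\<dots> \<le> 2 * (cmod (coefs f x))\<^sup>2 + 2 * (cmod (coefs g x))\<^sup>2"
      using sum_squares_bound[of "cmod (coefs f x)" "cmod (coefs g x)"] by (simp add: power2_sum)
    finally show "ennreal ((cmod (coefs (\<lambda>z. f z + g z) x))\<^sup>2) \<le> ennreal (2 * (cmod (coefs f x))\<^sup>2 + 2 * (cmod (coefs g x))\<^sup>2)"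
      using x h by (intro ennreal_leI) (simp add: coefs_add)
  qed
  also have "\<dots> = ennreal (\<integral>x. 2 * (cmod (coefs f x))\<^sup>2 + 2 * (cmod (coefs g x))\<^sup>2 \<partial>coef_space)"
    by (rule nn_integral_eq_integral) (auto intro!: besov_integrable f g)
  also have "\<dots> < \<infinity>" by simp
  finally show ?thesis
    using h by (simp add: besov_space_iff Hol_ball_add besov_sqnorm_coefs)
qed

lemma besov_cmult:
  assumes f: "f \<in> B"
  shows "(\<lambda>z. c * f z) \<in> B"
proof -
  note h = besov_Hol_ball[OF f]
  note [measurable] = coefs_measurable[OF h]
  have "(\<integral>\<^sup>+x. ennreal ((cmod (coefs (\<lambda>z. c * f z) x))\<^sup>2) \<partial>coef_space)
      = (\<integral>\<^sup>+x. ennreal ((cmod c)\<^sup>2 * (cmod (coefs f x))\<^sup>2) \<partial>coef_space)"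
    by (intro nn_integral_cong) (simp add: coefs_cmult[OF h] norm_mult power_mult_distrib)
  also have "\<dots> = ennreal (\<integral>x. (cmod c)\<^sup>2 * (cmod (coefs f x))\<^sup>2 \<partial>coef_space)"
    by (rule nn_integral_eq_integral) (auto intro!: besov_integrable f)
  also have "\<dots> < \<infinity>" by simp
  finally show ?thesis
    using h by (simp add: besov_space_iff Hol_ball_cmult besov_sqnorm_coefs)
qed

lemma besov_diff:
  assumes f: "f \<in> B" and g: "g \<in> B"
  shows "(\<lambda>z. f z - g z) \<in> B"
  using besov_add[OF f besov_cmult[OF g, of "-1"]] by simp

lemma besov_one: "(\<lambda>_. 1) \<in> B"
proof -
  have "besov_sqnorm \<sigma> \<mu> N (\<lambda>_. 1) = (\<Sum>n\<in>{0}. ennreal (weight n * hsq n (\<lambda>_. 1)))"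
    unfolding besov_sqnorm_eq[OF Hol_ball_const]
    by (rule suminf_finite) (auto simp: hsq_def hcoef_const)
  then show ?thesis by (simp add: besov_space_iff Hol_ball_const)
qed

lemma integrable_coefs_product:
  assumes f: "f \<in> B" and g: "g \<in> B"
  shows "integrable coef_space (\<lambda>x. coefs f x * cnj (coefs g x))"
proof (rule Bochner_Integration.integrable_bound)
  show "integrable coef_space (\<lambda>x. (cmod (coefs f x))\<^sup>2 + (cmod (coefs g x))\<^sup>2)"
    by (intro Bochner_Integration.integrable_add besov_integrable f g)
  note [measurable] = coefs_measurable[OF besov_Hol_ball[OF f]] coefs_measurable[OF besov_Hol_ball[OF g]]
  show "(\<lambda>x. coefs f x * cnj (coefs g x)) \<in> borel_measurable coef_space" by measurable
  show "AE x in coef_space. norm (coefs f x * cnj (coefs g x)) \<le> norm ((cmod (coefs f x))\<^sup>2 + (cmod (coefs g x))\<^sup>2)"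
  proof (rule AE_I2)
    fix x
    have "0 \<le> cmod (coefs f x) * cmod (coefs g x)" by simp
    then have "cmod (coefs f x) * cmod (coefs g x) \<le> (cmod (coefs f x))\<^sup>2 + (cmod (coefs g x))\<^sup>2"
      using sum_squares_bound[of "cmod (coefs f x)" "cmod (coefs g x)"] by linarith
    then show "norm (coefs f x * cnj (coefs g x)) \<le> norm ((cmod (coefs f x))\<^sup>2 + (cmod (coefs g x))\<^sup>2)"
      by (simp add: norm_mult)
  qed
qed

lemma besov_norm_square_polar:
  assumes f: "f \<in> B" and g: "g \<in> B"
  shows "(bnorm (\<lambda>z. f z + g z))\<^sup>2 - (bnorm (\<lambda>z. f z - g z))\<^sup>2
    = 4 * Re (\<integral>x. coefs f x * cnj (coefs g x) \<partial>coef_space)"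
proof -
  note h = besov_Hol_ball[OF f] besov_Hol_ball[OF g]
  have "(bnorm (\<lambda>z. f z + g z))\<^sup>2 - (bnorm (\<lambda>z. f z - g z))\<^sup>2
     = (\<integral>x. (cmod (coefs (\<lambda>z. f z + g z) x))\<^sup>2 - (cmod (coefs (\<lambda>z. f z - g z) x))\<^sup>2 \<partial>coef_space)"
    unfolding besov_norm_square[OF besov_add[OF f g]] besov_norm_square[OF besov_diff[OF f g]]
    by (intro Bochner_Integration.integral_diff[symmetric] besov_integrable besov_add besov_diff f g)
  also have "\<dots> = (\<integral>x. 4 * Re (coefs f x * cnj (coefs g x)) \<partial>coef_space)"
  proof (rule Bochner_Integration.integral_cong[OF refl])
    fix x assume x: "x \<in> space coef_space"
    have "(cmod (a + b))\<^sup>2 - (cmod (a - b))\<^sup>2 = 4 * Re (a * cnj b)" for a b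
      unfolding cmod_power2 by (simp add: power2_eq_square algebra_simps)
    then show "(cmod (coefs (\<lambda>z. f z + g z) x))\<^sup>2 - (cmod (coefs (\<lambda>z. f z - g z) x))\<^sup>2
        = 4 * Re (coefs f x * cnj (coefs g x))"
      by (simp only: coefs_add[OF h x] coefs_diff[OF h x])
  qed
  also have "\<dots> = 4 * Re (\<integral>x. coefs f x * cnj (coefs g x) \<partial>coef_space)"
    by (simp only: integral_mult_right_zero integral_Re[OF integrable_coefs_product[OF f g]])
  finally show ?thesis .
qed

lemma besov_inner:
  assumes f: "f \<in> B" and g: "g \<in> B"
  shows "hfs_inner bnorm f g = (\<integral>x. coefs f x * cnj (coefs g x) \<partial>coef_space)"
proof -
  let ?I = "\<integral>x. coefs f x * cnj (coefs g x) \<partial>coef_space"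
  have "(\<integral>x. coefs f x * cnj (coefs (\<lambda>z. \<i> * g z) x) \<partial>coef_space)
      = (\<integral>x. (- \<i>) * (coefs f x * cnj (coefs g x)) \<partial>coef_space)"
    by (rule Bochner_Integration.integral_cong[OF refl])
      (simp add: coefs_cmult[OF besov_Hol_ball[OF g]])
  also have "\<dots> = (- \<i>) * ?I" by (rule integral_mult_right_zero)
  finally have "Re (\<integral>x. coefs f x * cnj (coefs (\<lambda>z. \<i> * g z) x) \<partial>coef_space) = Im ?I" by simp
  then show ?thesis
    unfolding hfs_inner_def besov_norm_square_polar[OF f g] besov_norm_square_polar[OF f besov_cmult[OF g]]
    by (simp add: complex_eq_iff)
qed

section \<open>The Besov space is a Hilbert function space\<close>

lemma summable_sup_const:
  assumes "0 < q" "q < 1"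
  shows "summable (\<lambda>n. sqrt (sup_const n) * q ^ n)"
proof -
  define a where "a = 14 * real DIM(complex^'n)"
  have a: "a > 0" by (simp add: a_def)
  \<comment> \<open>For the asymptotic expansion \<open>q\<^sup>n\<close> is written as an exponential with rate of known sign.\<close>
  define c where "c = - ln q / 2"
  have c: "c > 0" "q = exp (- 2 * c)" using assms by (auto simp: c_def)
  have "(\<lambda>n. sqrt (4 * (a * (real n + 1) + 1) ^ m) * exp (- 2 * c * real n)) \<in> O(\<lambda>n. exp (- c * real n))" for m
    using c(1) a by real_asymp
  moreover have "exp (- 2 * c * real n) = q ^ n" "exp (- c * real n) = exp (- c) ^ n" for n
    by (simp_all only: c(2) exp_of_nat2_mult)
  ultimately have big: "(\<lambda>n. sqrt (4 * (a * (real n + 1) + 1) ^ m) * q ^ n) \<in> O(\<lambda>n. exp (- c) ^ n)" for m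
    by (simp only:)
  have "summable (\<lambda>n. norm (exp (- c) ^ n))" using c(1) by (simp add: summable_geometric)
  from summable_comparison_test_bigo[OF this big[unfolded a_def]] show ?thesis by (simp only: sup_const_def)
qed

text \<open>The weights decay slower than every geometric sequence with ratio below 1, because \<open>\<mu>\<close> charges
  every interval \<open>(r, 1]\<close>. Hence the homogeneous expansion converges locally uniformly, with
  control by the norm.\<close>

lemma besov_eval_bound:
  assumes s: "s < 1"
  obtains C where "C \<ge> 0" "\<And>f z. f \<in> B \<Longrightarrow> norm z \<le> s \<Longrightarrow> cmod (f z) \<le> C * bnorm f"
proof -
  define t where "t = max s (1/2)"
  have t: "0 < t" "t < 1" "s \<le> t" using s by (auto simp: t_def)
  define \<rho> where "\<rho> = (1 + t) / 2"
  have \<rho>: "0 < \<rho>" "\<rho> < 1" "t < \<rho>" using t by (auto simp: \<rho>_def)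
  define m0 where "m0 = measure \<mu> {\<rho><..1}"
  have m0: "m0 > 0" unfolding m0_def by (rule radial_mass_pos[OF \<rho>(1,2)])
  have weight: "\<rho> ^ (2 * n) * m0 \<le> weight n" for n
  proof -
    have "\<rho> ^ (2 * n) * m0 \<le> moment n" unfolding m0_def by (rule moment_lower_bound[OF \<rho>(1,2)])
    also have "\<dots> \<le> weight n"
    proof (cases "n = 0")
      case False
      then have "1 \<le> real n ^ (2 * N)" by (intro one_le_power) simp
      then show ?thesis using False moment_pos[of n] by (simp add: weight_def)
    qed (simp add: weight_def)
    finally show ?thesis .
  qed
  define c where "c n = sqrt (sup_const n) * (t / \<rho>) ^ n / sqrt m0" for n
  have sc: "sup_const n \<ge> 0" for n by (simp add: sup_const_def)
  have c0: "c n \<ge> 0" for n using t \<rho> m0 sc by (simp add: c_def)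
  have sum_c: "summable c"
    unfolding c_def using t \<rho> by (intro summable_divide summable_sup_const) auto
  have coef: "cmod (hcoef n f z) \<le> c n * bnorm f"
    if f: "f \<in> B" and z: "norm z \<le> s" for f z n
  proof -
    have hol: "f \<in> Hol_ball" by (rule besov_Hol_ball[OF f])
    let ?B = "bnorm f"
    have "ennreal (weight n * hsq n f) \<le> (\<Sum>n. ennreal (weight n * hsq n f))"
      using sum_le_suminf[of "\<lambda>n. ennreal (weight n * hsq n f)" "{n}"] by simp
    also have "\<dots> = ennreal (?B\<^sup>2)"
      using besov_sqnorm_eq[OF hol] besov_sqnorm_eq_norm[OF f] by simp
    finally have wh: "weight n * hsq n f \<le> ?B\<^sup>2" by (simp add: ennreal_le_iff)
    have "\<rho> ^ (2 * n) * m0 * hsq n f \<le> ?B\<^sup>2"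
      using mult_right_mono[OF weight hsq_nonneg, of n n f] wh by linarith
    then have h: "hsq n f \<le> ?B\<^sup>2 / (\<rho> ^ (2 * n) * m0)"
      using \<rho> m0 by (simp add: pos_le_divide_eq mult.commute)
    obtain u where u: "u \<in> sphere 0 1" "z = of_real (norm z) *s u" by (rule polar_decomposition)
    have "(cmod (hcoef n f u))\<^sup>2 \<le> sup_const n * (?B\<^sup>2 / (\<rho> ^ (2 * n) * m0))"
      using hcoef_sup_bound[OF hol u(1), of n] mult_left_mono[OF h sc[of n]] by linarith
    then have "cmod (hcoef n f u) \<le> sqrt (sup_const n * (?B\<^sup>2 / (\<rho> ^ (2 * n) * m0)))"
      by (rule real_le_rsqrt)
    also have "\<dots> = sqrt (sup_const n) * ?B / (\<rho> ^ n * sqrt m0)"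
      using \<rho> m0 besov_norm_nonneg[of f]
      by (simp add: real_sqrt_mult real_sqrt_divide power_even_eq)
    finally have hu: "cmod (hcoef n f u) \<le> sqrt (sup_const n) * ?B / (\<rho> ^ n * sqrt m0)" .
    have "cmod (hcoef n f z) = norm z ^ n * cmod (hcoef n f u)"
    proof -
      have "hcoef n f (of_real (norm z) *s u) = of_real (norm z) ^ n * hcoef n f u"
        by (rule hcoef_smult[OF hol]) (use u z s in auto)
      then show ?thesis using u(2) by (metis norm_mult norm_power norm_of_real abs_norm_cancel)
    qed
    also have "\<dots> \<le> t ^ n * (sqrt (sup_const n) * ?B / (\<rho> ^ n * sqrt m0))"
      using hu z t by (intro mult_mono power_mono) auto
    finally show ?thesis by (simp add: c_def power_divide mult_ac)
  qed
  show thesis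
  proof (rule that[of "\<Sum>n. c n"])
    show "(\<Sum>n. c n) \<ge> 0" by (rule suminf_nonneg[OF sum_c c0])
    fix f and z :: "complex^'n" assume f: "f \<in> B" and z: "norm z \<le> s"
    have "(\<lambda>n. hcoef n f z) sums f z"
      by (rule hcoef_sums_1[OF besov_Hol_ball[OF f]]) (use z s in simp)
    then have "cmod (f z) \<le> (\<Sum>n. c n * bnorm f)"
      using norm_suminf_le[OF coef[OF f z] summable_mult2[OF sum_c]] by (simp add: sums_iff)
    then show "cmod (f z) \<le> (\<Sum>n. c n) * bnorm f"
      using suminf_mult2[OF sum_c] by simp
  qed
qed

lemma besov_norm_eq_0:
  assumes "f \<in> B" "\<And>z. z \<in> ball 0 1 \<Longrightarrow> f z = 0"
  shows "bnorm f = 0"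
proof -
  have "hcoef n f z = 0" if "norm z \<le> 1" for n and z :: "complex^'n"
    using hcoef_cong[OF Hol_ball_const[of 0] assms(2) that] by (simp add: hcoef_const)
  then have "hsq n f = 0" for n
    unfolding hsq_def using Bochner_Integration.integral_cong[OF refl, of \<sigma> "\<lambda>z. (cmod (hcoef n f z))\<^sup>2" "\<lambda>_. 0"]
    by (simp add: space_sphere)
  then show ?thesis
    by (simp add: besov_norm_def besov_sqnorm_eq[OF besov_Hol_ball[OF assms(1)]])
qed

text \<open>A Cauchy sequence converges locally uniformly, and Fatou's lemma for the coefficients shows
  that it converges to the same limit in norm.\<close>

lemma besov_complete:
  assumes F: "\<And>k::nat. F k \<in> B"
    and Cau: "\<And>e. e > 0 \<Longrightarrow> \<exists>K. \<forall>k\<ge>K. \<forall>l\<ge>K. bnorm (\<lambda>z. F k z - F l z) < e"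
  shows "\<exists>g\<in>B. (\<lambda>k. bnorm (\<lambda>z. F k z - g z)) \<longlonglongrightarrow> 0"
proof -
  have hol: "F k \<in> Hol_ball" for k by (rule besov_Hol_ball[OF F])
  have unif: "uniformly_Cauchy_on (cball 0 s) F" if s: "s < 1" for s
  proof (rule uniformly_Cauchy_onI)
    fix e :: real assume e: "e > 0"
    obtain C where C: "C \<ge> 0" "\<And>f z. f \<in> B \<Longrightarrow> norm z \<le> s \<Longrightarrow> cmod (f z) \<le> C * bnorm f"
      using besov_eval_bound[OF s] by metis
    have "e / (C + 1) > 0" using e C by simp
    then obtain K where K: "\<And>k l. k \<ge> K \<Longrightarrow> l \<ge> K \<Longrightarrow> bnorm (\<lambda>z. F k z - F l z) < e / (C + 1)"
      using Cau by blast
    have "dist (F k z) (F l z) < e" if "z \<in> cball 0 s" "k \<ge> K" "l \<ge> K" for k l z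
    proof -
      have "cmod (F k z - F l z) \<le> C * bnorm (\<lambda>z. F k z - F l z)"
        using C(2)[OF besov_diff[OF F F], of z k l] that by simp
      also have "\<dots> \<le> C * (e / (C + 1))"
        using K[OF that(2,3)] C by (intro mult_left_mono) auto
      also have "\<dots> < e" using e C by (simp add: pos_divide_less_eq)
      finally show ?thesis by (simp add: dist_norm)
    qed
    then show "\<exists>M. \<forall>x\<in>cball 0 s. \<forall>m\<ge>M. \<forall>n\<ge>M. dist (F m x) (F n x) < e" by blast
  qed
  define g where "g z = lim (\<lambda>k. F k z)" for z
  have ul: "uniform_limit (cball 0 s) F g sequentially" if s: "s < 1" for s
  proof -
    obtain l where l: "uniform_limit (cball 0 s) F l sequentially"
      using unif[OF s] Cauchy_uniformly_convergent unfolding uniformly_convergent_on_def by blast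
    have "l z = g z" if "z \<in> cball 0 s" for z
      unfolding g_def using tendsto_uniform_limitI[OF l that] by (simp add: limI)
    then show ?thesis using l by (metis (no_types, lifting) uniform_limit_cong')
  qed
  have g: "g \<in> Hol_ball" by (rule Hol_ball_uniform_limit[OF hol ul])
  have hc: "(\<lambda>k. hcoef n (F k) z) \<longlonglongrightarrow> hcoef n g z" if z: "norm z \<le> 1" for n z
  proof (rule metric_LIMSEQ_I)
    fix e :: real assume e: "e > 0"
    have "\<forall>\<^sub>F k in sequentially. \<forall>x\<in>cball 0 (1/2). dist (F k x) (g x) < e / 2 / 2 ^ n"
      using ul[of "1/2"] e by (intro uniform_limitD) auto
    then obtain K where K: "\<And>k x. k \<ge> K \<Longrightarrow> x \<in> cball 0 (1/2) \<Longrightarrow> dist (F k x) (g x) < e / 2 / 2 ^ n"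
      unfolding eventually_sequentially by blast
    have "dist (hcoef n (F k) z) (hcoef n g z) < e" if k: "k \<ge> K" for k
    proof -
      have "cmod (hcoef n (\<lambda>z. F k z - g z) z) \<le> (e / 2 / 2 ^ n) / (1/2) ^ n"
      proof (rule hcoef_bound[OF Hol_ball_diff[OF hol g]])
        show "cmod (F k x - g x) \<le> e / 2 / 2 ^ n" if "norm x \<le> 1/2" for x
          using K[OF k, of x] that by (simp add: dist_norm less_imp_le)
      qed (use z in auto)
      then have "cmod (hcoef n (F k) z - hcoef n g z) \<le> e / 2"
        unfolding hcoef_diff[OF hol g z] by (simp add: power_divide)
      then show ?thesis using e by (simp add: dist_norm)
    qed
    then show "\<exists>K. \<forall>k\<ge>K. dist (hcoef n (F k) z) (hcoef n g z) < e" by blast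
  qed
  have coefs_lim: "(\<lambda>k. coefs (F k) x) \<longlonglongrightarrow> coefs g x" if "x \<in> space coef_space" for x
  proof -
    obtain n z where x: "x = (n, z)" by (cases x)
    show ?thesis
      using tendsto_mult_left[OF hc[of z n], of "of_real (sqrt (weight n))"] that
      by (simp add: x coefs_def space_coef_space)
  qed
  have small: "besov_sqnorm \<sigma> \<mu> N (\<lambda>z. F k z - g z) \<le> ennreal (e\<^sup>2)"
    if e: "e > 0" and K: "\<And>k l. k \<ge> K \<Longrightarrow> l \<ge> K \<Longrightarrow> bnorm (\<lambda>z. F k z - F l z) < e" and k: "k \<ge> K" for e K k
  proof -
    note [measurable] = coefs_measurable[OF Hol_ball_diff[OF hol hol]]
    have "besov_sqnorm \<sigma> \<mu> N (\<lambda>z. F k z - g z)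
        = (\<integral>\<^sup>+x. liminf (\<lambda>l. ennreal ((cmod (coefs (\<lambda>z. F k z - F l z) x))\<^sup>2)) \<partial>coef_space)"
      unfolding besov_sqnorm_coefs[OF Hol_ball_diff[OF hol g]]
    proof (rule nn_integral_cong)
      fix x assume x: "x \<in> space coef_space"
      have "(\<lambda>l. ennreal ((cmod (coefs (\<lambda>z. F k z - F l z) x))\<^sup>2)) \<longlonglongrightarrow> ennreal ((cmod (coefs (\<lambda>z. F k z - g z) x))\<^sup>2)"
        unfolding coefs_diff[OF hol hol x] coefs_diff[OF hol g x]
        by (intro tendsto_intros tendsto_ennrealI coefs_lim x)
      then show "ennreal ((cmod (coefs (\<lambda>z. F k z - g z) x))\<^sup>2)
          = liminf (\<lambda>l. ennreal ((cmod (coefs (\<lambda>z. F k z - F l z) x))\<^sup>2))"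
        by (rule lim_imp_Liminf[OF sequentially_bot, symmetric])
    qed
    also have "\<dots> \<le> liminf (\<lambda>l. \<integral>\<^sup>+x. ennreal ((cmod (coefs (\<lambda>z. F k z - F l z) x))\<^sup>2) \<partial>coef_space)"
      by (rule nn_integral_liminf) measurable
    also have "\<dots> = liminf (\<lambda>l. ennreal ((bnorm (\<lambda>z. F k z - F l z))\<^sup>2))"
      unfolding besov_sqnorm_coefs[OF Hol_ball_diff[OF hol hol], symmetric]
        besov_sqnorm_eq_norm[OF besov_diff[OF F F]] ..
    also have "\<dots> \<le> ennreal (e\<^sup>2)"
    proof (rule Liminf_le)
      show "\<forall>\<^sub>F l in sequentially. ennreal ((bnorm (\<lambda>z. F k z - F l z))\<^sup>2) \<le> ennreal (e\<^sup>2)"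
        unfolding eventually_sequentially
        using K[OF k] besov_norm_nonneg
        by (intro exI[of _ K] allI impI ennreal_leI power_mono) (auto simp: less_imp_le)
    qed simp
    finally show ?thesis .
  qed
  have diff_mem: "(\<lambda>z. F k z - g z) \<in> B"
    if "\<And>k l. k \<ge> K \<Longrightarrow> l \<ge> K \<Longrightarrow> bnorm (\<lambda>z. F k z - F l z) < 1" "k \<ge> K" for k K
    unfolding besov_space_iff
    using small[of 1 K k, OF _ that] Hol_ball_diff[OF hol g] by (auto intro: le_less_trans)
  have gB: "g \<in> B"
  proof -
    obtain K where K: "\<And>k l. k \<ge> K \<Longrightarrow> l \<ge> K \<Longrightarrow> bnorm (\<lambda>z. F k z - F l z) < 1"
      using Cau[of 1] by auto
    have "(\<lambda>z. F K z - g z) \<in> B" by (rule diff_mem[OF K order_refl])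
    from besov_diff[OF F[of K] this] show ?thesis by simp
  qed
  have "(\<lambda>k. bnorm (\<lambda>z. F k z - g z)) \<longlonglongrightarrow> 0"
  proof (rule metric_LIMSEQ_I)
    fix e :: real assume e: "e > 0"
    obtain K where K: "\<And>k l. k \<ge> K \<Longrightarrow> l \<ge> K \<Longrightarrow> bnorm (\<lambda>z. F k z - F l z) < e / 2"
      using Cau[of "e/2"] e by auto
    have "dist (bnorm (\<lambda>z. F k z - g z)) 0 < e" if k: "k \<ge> K" for k
    proof -
      have "ennreal ((bnorm (\<lambda>z. F k z - g z))\<^sup>2) \<le> ennreal ((e/2)\<^sup>2)"
        using small[of "e/2" K k, OF _ K k] e besov_sqnorm_eq_norm[OF besov_diff[OF F gB]] by simp
      then have "(bnorm (\<lambda>z. F k z - g z))\<^sup>2 \<le> (e/2)\<^sup>2" by (simp add: ennreal_le_iff)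
      then have "bnorm (\<lambda>z. F k z - g z) \<le> e/2" by (rule power2_le_imp_le) (use e in simp)
      then show ?thesis using e besov_norm_nonneg by simp
    qed
    then show "\<exists>K. \<forall>k\<ge>K. dist (bnorm (\<lambda>z. F k z - g z)) 0 < e" by blast
  qed
  with gB show ?thesis by blast
qed

sublocale besov: hilbert_function_space "ball 0 1" B bnorm
proof
  fix f g h :: "complex^'n \<Rightarrow> complex" and c :: complex
  show "hfs_inner bnorm (\<lambda>z. f z + g z) h = hfs_inner bnorm f h + hfs_inner bnorm g h"
    if f: "f \<in> B" and g: "g \<in> B" and h: "h \<in> B"
  proof -
    have "(\<integral>x. coefs (\<lambda>z. f z + g z) x * cnj (coefs h x) \<partial>coef_space)
        = (\<integral>x. coefs f x * cnj (coefs h x) + coefs g x * cnj (coefs h x) \<partial>coef_space)"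
      by (rule Bochner_Integration.integral_cong[OF refl])
        (simp add: coefs_add[OF besov_Hol_ball[OF f] besov_Hol_ball[OF g]] distrib_right)
    then show ?thesis
      using f g h by (simp add: besov_inner besov_add integrable_coefs_product)
  qed
  show "hfs_inner bnorm (\<lambda>z. c * f z) g = c * hfs_inner bnorm f g" if f: "f \<in> B" and g: "g \<in> B"
  proof -
    have "(\<integral>x. coefs (\<lambda>z. c * f z) x * cnj (coefs g x) \<partial>coef_space)
        = (\<integral>x. c * (coefs f x * cnj (coefs g x)) \<partial>coef_space)"
      by (rule Bochner_Integration.integral_cong[OF refl]) (simp add: coefs_cmult[OF besov_Hol_ball[OF f]])
    then show ?thesis
      using f g by (simp add: besov_inner besov_cmult)
  qed
  show "hfs_inner bnorm g f = cnj (hfs_inner bnorm f g)" if f: "f \<in> B" and g: "g \<in> B"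
    unfolding besov_inner[OF f g] besov_inner[OF g f] Bochner_Integration.integral_cnj[symmetric]
    by (simp add: mult.commute)
  show "hfs_inner bnorm f f = of_real ((bnorm f)\<^sup>2)" if f: "f \<in> B"
    unfolding besov_inner[OF f f] besov_norm_square[OF f] complex_norm_square[symmetric]
    by (simp only: integral_complex_of_real)
  show "\<exists>C. \<forall>f\<in>B. cmod (f z) \<le> C * bnorm f" if "z \<in> ball 0 1" for z
    using besov_eval_bound[of "norm z"] that by (metis mem_ball_0 order_refl)
qed (use besov_one besov_add besov_cmult besov_norm_nonneg besov_norm_eq_0 besov_complete in auto)

section \<open>Quotients of multipliers\<close>

lemma L2_sqnorm_dominated:
  fixes F :: "complex^'n \<Rightarrow> complex" and G :: "'i \<Rightarrow> complex^'n \<Rightarrow> complex"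
  assumes G: "\<And>i. i \<in> I \<Longrightarrow> G i \<in> Hol_ball" "\<And>i. i \<in> I \<Longrightarrow> L2_sqnorm \<sigma> \<mu> (G i) < \<infinity>" and "finite I"
    and le: "\<And>z. z \<in> ball 0 1 \<Longrightarrow> cmod (F z) \<le> (\<Sum>i\<in>I. cmod (G i z))"
  shows "L2_sqnorm \<sigma> \<mu> F < \<infinity>"
proof -
  let ?c = "ennreal (real (card I))" and ?G = "\<lambda>i z. ennreal ((cmod (G i z))\<^sup>2)"
  have sq: "ennreal ((cmod (F z))\<^sup>2) \<le> ?c * (\<Sum>i\<in>I. ?G i z)" if z: "z \<in> ball 0 1" for z
  proof -
    have "(cmod (F z))\<^sup>2 \<le> (\<Sum>i\<in>I. cmod (G i z))\<^sup>2" by (rule power_mono[OF le[OF z]]) simp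
    also have "\<dots> \<le> real (card I) * (\<Sum>i\<in>I. (cmod (G i z))\<^sup>2)"
      using sum_squared_le_sum_of_squares[of "\<lambda>i. cmod (G i z)" I] by (simp add: mult.commute)
    finally have "ennreal ((cmod (F z))\<^sup>2) \<le> ennreal (real (card I) * (\<Sum>i\<in>I. (cmod (G i z))\<^sup>2))"
      by (rule ennreal_leI)
    also have "\<dots> = ?c * (\<Sum>i\<in>I. ?G i z)"
      by (subst ennreal_mult) (auto intro: sum_nonneg)
    finally show ?thesis .
  qed
  have "(\<integral>\<^sup>+z\<in>ball 0 1. ennreal ((cmod (F z))\<^sup>2) \<partial>radial_measure \<sigma> \<mu>)
      \<le> (\<integral>\<^sup>+z. ?c * (\<Sum>i\<in>I. ?G i z * indicator (ball 0 1) z) \<partial>radial_measure \<sigma> \<mu>)"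
  proof (rule nn_integral_mono)
    fix z
    show "ennreal ((cmod (F z))\<^sup>2) * indicator (ball 0 1) z
        \<le> ?c * (\<Sum>i\<in>I. ?G i z * indicator (ball 0 1) z)"
      using sq[of z] by (cases "z \<in> ball 0 1") (simp_all add: indicator_def)
  qed
  also have "\<dots> = ?c * (\<Sum>i\<in>I. \<integral>\<^sup>+z\<in>ball 0 1. ?G i z \<partial>radial_measure \<sigma> \<mu>)"
    using square_measurable[OF G(1)]
    by (subst nn_integral_cmult) (auto simp: nn_integral_sum intro!: borel_measurable_sum)
  also have "\<dots> < \<infinity>"
    using G(2) \<open>finite I\<close> by (auto simp: ennreal_mult_less_top L2_sqnorm_def ennreal_sum_less_top)
  finally have int: "(\<integral>\<^sup>+z\<in>ball 0 1. ennreal ((cmod (F z))\<^sup>2) \<partial>radial_measure \<sigma> \<mu>) < \<infinity>" .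
  have hardy: "hardy_sqnorm \<sigma> F \<le> ?c * (\<Sum>i\<in>I. hardy_sqnorm \<sigma> (G i))"
    unfolding hardy_sqnorm_def[of \<sigma> F]
  proof (rule SUP_least)
    fix r :: real assume r: "r \<in> {0..<1}"
    have meas: "(\<lambda>z. ?G i (r *\<^sub>R z)) \<in> borel_measurable \<sigma>" if "i \<in> I" for i
    proof -
      have "(\<lambda>z. G i (r *\<^sub>R z)) \<in> borel_measurable \<sigma>"
        unfolding scaleR_eq_vector_smult
        by (intro measurable_continuous_sphere continuous_Hol_ball_sphere G that) (use r in auto)
      then show ?thesis by measurable
    qed
    have "(\<integral>\<^sup>+z. ennreal ((cmod (F (r *\<^sub>R z)))\<^sup>2) \<partial>\<sigma>) \<le> (\<integral>\<^sup>+z. ?c * (\<Sum>i\<in>I. ?G i (r *\<^sub>R z)) \<partial>\<sigma>)"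
      by (intro nn_integral_mono sq) (use r in \<open>auto simp: space_sphere\<close>)
    also have "\<dots> = ?c * (\<Sum>i\<in>I. \<integral>\<^sup>+z. ?G i (r *\<^sub>R z) \<partial>\<sigma>)"
    proof -
      have "(\<integral>\<^sup>+z. (\<Sum>i\<in>I. ?G i (r *\<^sub>R z)) \<partial>\<sigma>) = (\<Sum>i\<in>I. \<integral>\<^sup>+z. ?G i (r *\<^sub>R z) \<partial>\<sigma>)"
        by (rule nn_integral_sum[OF meas])
      then show ?thesis by (subst nn_integral_cmult[OF borel_measurable_sum[OF meas]]) simp_all
    qed
    also have "\<dots> \<le> ?c * (\<Sum>i\<in>I. hardy_sqnorm \<sigma> (G i))"
      unfolding hardy_sqnorm_def using r by (intro mult_left_mono sum_mono SUP_upper) auto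
    finally show "(\<integral>\<^sup>+z. ennreal ((cmod (F (r *\<^sub>R z)))\<^sup>2) \<partial>\<sigma>) \<le> ?c * (\<Sum>i\<in>I. hardy_sqnorm \<sigma> (G i))" .
  qed
  have "emeasure \<mu> {1} * hardy_sqnorm \<sigma> F \<le> emeasure \<mu> {1} * (?c * (\<Sum>i\<in>I. hardy_sqnorm \<sigma> (G i)))"
    by (rule mult_left_mono[OF hardy]) simp
  also have "\<dots> = ?c * (\<Sum>i\<in>I. emeasure \<mu> {1} * hardy_sqnorm \<sigma> (G i))"
    by (simp add: sum_distrib_left mult.left_commute)
  also have "\<dots> < \<infinity>"
    using G(2) \<open>finite I\<close> by (auto simp: ennreal_mult_less_top L2_sqnorm_def ennreal_sum_less_top)
  finally show ?thesis using int by (simp add: L2_sqnorm_def)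
qed

text \<open>The binomial expansion of \<open>(u - c v)\<^sup>n\<^sup>+\<^sup>1\<close>: all of its terms except \<open>u\<^sup>n\<^sup>+\<^sup>1\<close> are divisible by \<open>v\<close>.\<close>

lemma quotient_expansion:
  fixes u v c :: complex
  assumes "v \<noteq> 0"
  shows "u ^ Suc n / v = (u - c * v) ^ Suc n / v
    - (\<Sum>i\<le>n. of_nat (Suc n choose i) * (- c) ^ (Suc n - i) * (u ^ i * v ^ (n - i)))"
proof -
  have "(u - c * v) ^ Suc n = (\<Sum>i\<le>Suc n. of_nat (Suc n choose i) * u ^ i * (- c * v) ^ (Suc n - i))"
    using binomial_ring[of u "- c * v" "Suc n"] by simp
  also have "\<dots> = (\<Sum>i\<le>n. of_nat (Suc n choose i) * u ^ i * (- c * v) ^ (Suc n - i)) + u ^ Suc n"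
    by simp
  also have "(\<Sum>i\<le>n. of_nat (Suc n choose i) * u ^ i * (- c * v) ^ (Suc n - i))
      = v * (\<Sum>i\<le>n. of_nat (Suc n choose i) * (- c) ^ (Suc n - i) * (u ^ i * v ^ (n - i)))"
    unfolding sum_distrib_left
  proof (rule sum.cong[OF refl])
    fix i assume "i \<in> {..n}"
    then have "Suc n - i = Suc (n - i)" by auto
    then show "of_nat (Suc n choose i) * u ^ i * (- c * v) ^ (Suc n - i)
        = v * (of_nat (Suc n choose i) * (- c) ^ (Suc n - i) * (u ^ i * v ^ (n - i)))"
      by (simp only: power_mult_distrib power_Suc) (simp add: mult_ac)
  qed
  finally show ?thesis using assms by (simp add: field_simps)
qed

text \<open>Fix a point \<open>z\<close> and put \<open>c = \<phi> z / \<psi> z\<close>. In the expansion of \<open>\<phi>\<^sup>N\<^sup>+\<^sup>1 f / \<psi>\<close> above, the first term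
  has \<open>N + 1\<close> factors vanishing at \<open>z\<close>, so that the \<open>N\<close>-th radial derivative at \<open>z\<close> only sees the products
  \<open>\<phi>\<^sup>i \<psi>\<^sup>N\<^sup>-\<^sup>i f\<close>, which lie in the space, with coefficients bounded because of \<open>\<bar>c\<bar> \<le> 1\<close>.\<close>

lemma quotient_Mult:
  assumes \<phi>: "\<phi> \<in> Mult B" and \<psi>: "\<psi> \<in> Mult B"
    and le: "\<And>z. z \<in> ball 0 1 \<Longrightarrow> cmod (\<phi> z) \<le> cmod (\<psi> z)"
    and nz: "\<And>z. z \<in> ball 0 1 \<Longrightarrow> \<psi> z \<noteq> 0"
  shows "(\<lambda>z. \<phi> z ^ Suc N / \<psi> z) \<in> Mult B"
  unfolding Mult_def
proof (intro CollectI ballI)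
  fix f assume f: "f \<in> B"
  have Mult_hol: "\<theta> \<in> Hol_ball" if "\<theta> \<in> Mult B" for \<theta>
    using besov_Hol_ball[OF besov.Mult_mem[OF that besov_one]] by simp
  note \<phi>h = Mult_hol[OF \<phi>] and \<psi>h = Mult_hol[OF \<psi>] and fh = besov_Hol_ball[OF f]
  define g where "g z = f z / \<psi> z" for z
  have gh: "g \<in> Hol_ball" unfolding g_def by (rule Hol_ball_divide[OF fh \<psi>h nz])
  define F where "F z = \<phi> z ^ Suc N / \<psi> z * f z" for z
  have F_eq: "F = (\<lambda>z. \<phi> z ^ Suc N * g z)" by (simp add: F_def g_def fun_eq_iff)
  have Fh: "F \<in> Hol_ball" unfolding F_eq by (intro Hol_ball_mult Hol_ball_power \<phi>h gh)
  define P where "P i z = \<phi> z ^ i * \<psi> z ^ (N - i) * f z" for i z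
  have P: "P i \<in> B" for i
    unfolding P_def by (intro besov.Mult_mem besov.Mult_mult besov.Mult_power \<phi> \<psi> f)
  have Ph: "P i \<in> Hol_ball" for i by (rule besov_Hol_ball[OF P])
  define G where "G i = (radial_deriv ^^ N) (\<lambda>z. of_nat (Suc N choose i) * P i z)" for i
  have Gh: "G i \<in> Hol_ball" for i
    unfolding G_def by (intro radial_deriv_iter_Hol_ball Hol_ball_cmult Ph)
  have GL: "L2_sqnorm \<sigma> \<mu> (G i) < \<infinity>" for i
    using besov_cmult[OF P] by (simp add: G_def besov_space_def)
  have "cmod ((radial_deriv ^^ N) F z) \<le> (\<Sum>i\<le>N. cmod (G i z))" if z: "z \<in> ball 0 1" for z
  proof -
    define c where "c = \<phi> z / \<psi> z"
    have c: "cmod c \<le> 1" using le[OF z] nz[OF z] by (simp add: c_def norm_divide)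
    define u where "u w = \<phi> w - c * \<psi> w" for w
    have uh: "u \<in> Hol_ball" unfolding u_def by (intro Hol_ball_diff Hol_ball_cmult \<phi>h \<psi>h)
    have uz: "u z = 0" using nz[OF z] by (simp add: u_def c_def)
    define T where "T i w = (- c) ^ (Suc N - i) * (of_nat (Suc N choose i) * P i w)" for i w
    have Th: "T i \<in> Hol_ball" for i unfolding T_def by (intro Hol_ball_cmult Ph)
    have exp: "F w = u w ^ Suc N * g w + (-1) * (\<Sum>i\<le>N. T i w)" if w: "w \<in> ball 0 1" for w
    proof -
      have "F w = ((u w) ^ Suc N / \<psi> w - (\<Sum>i\<le>N. of_nat (Suc N choose i) * (- c) ^ (Suc N - i) * (\<phi> w ^ i * \<psi> w ^ (N - i)))) * f w"
        unfolding F_def u_def by (subst quotient_expansion[OF nz[OF w], of _ _ c]) (rule refl)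
      also have "\<dots> = u w ^ Suc N * g w - (\<Sum>i\<le>N. T i w)"
        by (simp only: left_diff_distrib sum_distrib_right T_def P_def g_def times_divide_eq_left times_divide_eq_right) (simp only: mult_ac)
      finally show ?thesis by simp
    qed
    have "(radial_deriv ^^ N) F z = (radial_deriv ^^ N) (\<lambda>w. u w ^ Suc N * g w + (-1) * (\<Sum>i\<le>N. T i w)) z"
      by (rule radial_deriv_iter_cong[OF _ exp z])
        (intro Hol_ball_add Hol_ball_mult Hol_ball_power Hol_ball_const Hol_ball_sum uh gh Th)
    also have "\<dots> = (radial_deriv ^^ N) (\<lambda>w. u w ^ Suc N * g w) z + (radial_deriv ^^ N) (\<lambda>w. (-1) * (\<Sum>i\<le>N. T i w)) z"
      by (rule radial_deriv_iter_add[OF _ _ z])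
        (intro Hol_ball_mult Hol_ball_power Hol_ball_const Hol_ball_sum uh gh Th)+
    also have "(radial_deriv ^^ N) (\<lambda>w. u w ^ Suc N * g w) z = 0"
      by (rule radial_deriv_iter_vanish[OF uh gh z uz lessI])
    also have "(radial_deriv ^^ N) (\<lambda>w. (-1) * (\<Sum>i\<le>N. T i w)) z = - (\<Sum>i\<le>N. (radial_deriv ^^ N) (T i) z)"
      using radial_deriv_iter_cmult[OF Hol_ball_sum[of "{..N}" T] z, of N "-1"] Th
        radial_deriv_iter_sum[of "{..N}" T, OF Th z] by simp
    also have "(\<Sum>i\<le>N. (radial_deriv ^^ N) (T i) z) = (\<Sum>i\<le>N. (- c) ^ (Suc N - i) * G i z)"
      unfolding T_def G_def by (intro sum.cong refl radial_deriv_iter_cmult Hol_ball_cmult Ph z)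
    finally have "cmod ((radial_deriv ^^ N) F z) \<le> (\<Sum>i\<le>N. cmod ((- c) ^ (Suc N - i) * G i z))"
      by (simp add: norm_sum)
    also have "\<dots> \<le> (\<Sum>i\<le>N. cmod (G i z))"
    proof (rule sum_mono)
      fix i
      have "cmod c ^ (Suc N - i) \<le> 1" by (rule power_le_one) (use c in auto)
      then show "cmod ((- c) ^ (Suc N - i) * G i z) \<le> cmod (G i z)"
        by (simp only: norm_mult norm_power norm_minus_cancel) (simp add: mult_left_le_one_le)
    qed
    finally show ?thesis .
  qed
  then have "L2_sqnorm \<sigma> \<mu> ((radial_deriv ^^ N) F) < \<infinity>"
    by (rule L2_sqnorm_dominated[OF Gh GL finite_atMost])
  then show "(\<lambda>z. \<phi> z ^ Suc N / \<psi> z * f z) \<in> B"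
    using Fh unfolding F_def[abs_def] besov_space_def by blast
qed

text \<open>With \<open>u\<^sub>n \<phi> \<longlonglongrightarrow> 1\<close> also \<open>(u\<^sub>n \<phi>)\<^sup>N\<^sup>+\<^sup>1 \<longlonglongrightarrow> 1\<close>, because powers preserve boundedness and pointwise limits. The left-hand side is
  \<open>\<psi>\<close> times the multiplier \<open>u\<^sub>n\<^sup>N\<^sup>+\<^sup>1 \<sqdot> \<phi>\<^sup>N\<^sup>+\<^sup>1 / \<psi>\<close>.\<close>

lemma weak_star_seq_cyclic_mono:
  assumes \<phi>: "\<phi> \<in> Mult B" and \<psi>: "\<psi> \<in> Mult B"
    and le: "\<And>z. z \<in> ball 0 1 \<Longrightarrow> cmod (\<phi> z) \<le> cmod (\<psi> z)"
    and cyc: "weak_star_seq_cyclic B bnorm \<phi>"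
  shows "weak_star_seq_cyclic B bnorm \<psi>"
proof -
  obtain u where u: "\<And>n. u n \<in> Mult B"
    and lim: "limitin (weak_star_topology B bnorm) (\<lambda>n z. u n z * \<phi> z) (\<lambda>_. 1) sequentially"
    using cyc by (auto simp: weak_star_seq_cyclic_def)
  define a where "a n z = u n z * \<phi> z" for n z
  have a: "a n \<in> Mult B" for n unfolding a_def by (rule besov.Mult_mult[OF u \<phi>])
  obtain C where C: "C \<ge> 0" "\<And>n f. f \<in> B \<Longrightarrow> bnorm (\<lambda>z. a n z * f z) \<le> C * bnorm f"
    "\<And>z. z \<in> ball 0 1 \<Longrightarrow> (\<lambda>n. a n z) \<longlonglongrightarrow> 1"
    by (rule besov.weak_star_limit_imp[OF a lim[folded a_def]]) blast
  have nz: "\<psi> z \<noteq> 0" if z: "z \<in> ball 0 1" for z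
  proof
    assume "\<psi> z = 0"
    then have "\<phi> z = 0" using le[OF z] by simp
    then have "(\<lambda>n. a n z) = (\<lambda>_. 0)" by (simp add: a_def)
    with C(3)[OF z] show False by (simp add: LIMSEQ_const_iff)
  qed
  define v where "v n z = u n z ^ Suc N * (\<phi> z ^ Suc N / \<psi> z)" for n z
  have v: "v n \<in> Mult B" for n
    unfolding v_def by (intro besov.Mult_mult besov.Mult_power u quotient_Mult \<phi> \<psi> le nz)
  have v_eq: "v n z * \<psi> z = a n z ^ Suc N" if "z \<in> ball 0 1" for n z
    using nz[OF that] by (simp add: v_def a_def power_mult_distrib)
  have pow: "bnorm (\<lambda>z. a n z ^ k * f z) \<le> C ^ k * bnorm f" if f: "f \<in> B" for n k f
  proof (induction k)
    case (Suc k)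
    have "bnorm (\<lambda>z. a n z * (a n z ^ k * f z)) \<le> C * bnorm (\<lambda>z. a n z ^ k * f z)"
      by (rule C(2)[OF besov.Mult_mem[OF besov.Mult_power[OF a] f]])
    also have "\<dots> \<le> C * (C ^ k * bnorm f)" by (rule mult_left_mono[OF Suc.IH C(1)])
    finally show ?case by (simp add: mult.assoc)
  qed simp
  have "limitin (weak_star_topology B bnorm) (\<lambda>n z. v n z * \<psi> z) (\<lambda>_. 1) sequentially"
  proof (rule besov.weak_star_limitI[where C = "C ^ Suc N"])
    show v\<psi>: "(\<lambda>z. v n z * \<psi> z) \<in> Mult B" for n by (rule besov.Mult_mult[OF v \<psi>])
    show "bnorm (\<lambda>z. v n z * \<psi> z * f z) \<le> C ^ Suc N * bnorm f" if f: "f \<in> B" for n f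
    proof -
      have "bnorm (\<lambda>z. v n z * \<psi> z * f z) = bnorm (\<lambda>z. a n z ^ Suc N * f z)"
        by (rule besov.nrm_cong[OF besov.Mult_mem[OF v\<psi> f] besov.Mult_mem[OF besov.Mult_power[OF a] f]])
          (simp only: v_eq)
      also have "\<dots> \<le> C ^ Suc N * bnorm f" by (rule pow[OF f])
      finally show ?thesis .
    qed
    show "(\<lambda>n. v n z * \<psi> z) \<longlonglongrightarrow> 1" if z: "z \<in> ball 0 1" for z
      using tendsto_power[OF C(3)[OF z], of "Suc N"] by (simp only: v_eq[OF z] power_one)
  qed
  with v show ?thesis unfolding weak_star_seq_cyclic_def by blast
qed

end

theorem theorem1p2:
  fixes \<sigma> :: "(complex^'n) measure" and \<mu> :: "real measure" and N :: nat
    and \<phi> \<psi> :: "complex^'n \<Rightarrow> complex"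
  assumes "rotation_invariant_probability \<sigma>"
    and "admissible \<mu>"
    and "\<phi> \<in> Mult (besov_space \<sigma> \<mu> N)"
    and "\<psi> \<in> Mult (besov_space \<sigma> \<mu> N)"
    and "\<And>z. z \<in> ball 0 1 \<Longrightarrow> cmod (\<phi> z) \<le> cmod (\<psi> z)"
    and "weak_star_seq_cyclic (besov_space \<sigma> \<mu> N) (besov_norm \<sigma> \<mu> N) \<phi>"
  shows "weak_star_seq_cyclic (besov_space \<sigma> \<mu> N) (besov_norm \<sigma> \<mu> N) \<psi>"
proof -
  interpret besov_setting \<sigma> \<mu> N
    by unfold_locales (rule assms)+
  show ?thesis by (rule weak_star_seq_cyclic_mono[OF assms(3-6)])
qed

end
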